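(* Let $a\in C^1([0,1])$ with $a(x)>0$ for every $x\in[0,1]$. Let $u_0>0$ and let $f\in C^1([0,\infty))$ satisfy $f(0)=f(u_0)=0$, $f(s)<0$ for $s\in(0,u_0)$ and $f(s)>0$ for $s\in(u_0,\infty)$. Assume that at least one of the following two conditions holds: (A) there exists $\bar u>u_0$ such that $\int_{u_0}^{\bar u}f(s)\,ds = C_a\int_{u_0}^{0}f(s)\,ds$, where $$C_a:=\max\Big\{\tfrac{a(1)}{a(0)}\exp\Big(\int_0^1\tfrac{(a')^-(x)}{a(x)}dx\Big),\ \tfrac{a(0)}{a(1)}\exp\Big(\int_0^1\tfrac{(a')^+(x)}{a(x)}dx\Big)\Big\};$$ (B) $\|a\|_{L^1(0,1)}\,\max_{[0,\infty)} f^-<1$. Suppose moreover that, for some integer $k\ge 1$, $f'(u_0)>\lambda_{k+1}$. Then there exist at least $2k$ distinct non-constant (positive) BV-solutions $u_1,\dots,u_{2k}$ of $$-\left(\frac{u'}{\sqrt{1+u'^2}}\right)'=a(x)f(u)\ \text{ in }(0,1),\qquad u>0\ \text{ in }(0,1),\qquad u'(0)=u'(1)=0. \quad (P)$$ Furthermore: (I) for every $j=1,\dots,k$ there exist exactly $j+2$ points $0=x_{j,0}<x_{j,1}<\dots<x_{j,j}<x_{j,j+1}=1$ such that (a) $u_j\in C^2([0,x_{j,1}))\cap C^2((x_{j,j},1])$, $u_j\in C^2((x_{j,i},x_{j,i+1}))$ for $i=1,\dots,j-1$, and $u_j'(0)=0=u_j'(1)$; (b) $(-1)^{i+1}(u_j(x)-u_0)>0$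 for every $x\in(x_{j,i},x_{j,i+1})$, for $i=0,\dots,j$; (c) for every $i=1,\dots,j$ one of the following holds: (i) $u_j(x_{j,i})=u_0$ and $u_j\in C^2((x_{j,i-1},x_{j,i+1}))$; (ii) $u_j(x_{j,i}^-)\le u_0\le u_j(x_{j,i}^+)$ and $u_j'(x_{j,i}^-)=+\infty=u_j'(x_{j,i}^+)$ if $i$ is odd, while $u_j(x_{j,i}^+)\le u_0\le u_j(x_{j,i}^-)$ and $u_j'(x_{j,i}^-)=-\infty=u_j'(x_{j,i}^+)$ if $i$ is even. (II) for every $\ell=1,\dots,k$, writing $w=u_{2k+1-\ell}$, there exist exactly $\ell+2$ points $0=x_{\ell,0}<x_{\ell,1}<\dots<x_{\ell,\ell}<x_{\ell,\ell+1}=1$ such that (a) $w\in C^2([0,x_{\ell,1}))\cap C^2((x_{\ell,\ell},1])$, $w\in C^2((x_{\ell,i},x_{\ell,i+1}))$ for $i=1,\dots,\ell-1$, and $w'(0)=0=w'(1)$; (b) $(-1)^{i+1}(w(x)-u_0)<0$ for every $x\in(x_{\ell,i},x_{\ell,i+1})$, for $i=0,\dots,\ell$; (c) for every $i=1,\dots,\ell$ one of the following holds: (i) $w(x_{\ell,i})=u_0$ and $w\in C^2((x_{\ell,i-1},x_{\ell,i+1}))$; (ii) $w(x_{\ell,i}^-)\le u_0\le w(x_{\ell,i}^+)$ and $w'(x_{\ell,i}^-)=+\infty=w'(x_{\ell,i}^+)$ if $i$ is even, while $w(x_{\ell,i}^+)\le u_0\le w(x_{\ell,i}^-)$ and $w'(x_{\ell,i}^-)=-\infty=w'(x_{\ell,i}^+)$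 if $i$ is odd. (III) for every $j=1,\dots,2k$ the energy $\mathcal E_j$ corresponding to the solution $u_j$ can be extended by continuity to $[0,1]$.
   Context: For a real function $g$, $g^\pm$ denote its positive and negative parts ($g=g^+-g^-$, $g^\pm\ge0$). $\lambda_k$ ($k\ge1$) is the $k$-th eigenvalue of $-u''=\lambda a(x)u$ in $(0,1)$ with $u'(0)=u'(1)=0$, so that $0=\lambda_1<\lambda_2<\lambda_3<\dots\to\infty$. BV-solution: a function $u\in BV(0,1)$ (with $u>0$ in $(0,1)$, as required by the problem $(P)$) is a BV-solution of $(P)$ if for every $v\in BV(0,1)$ $$\int_0^1\sqrt{1+|Dv|^2}\ \ge\ \int_0^1\sqrt{1+|Du|^2}+\int_0^1 a(x)f(u)(v-u)\,dx,$$ where $$\int_0^1\sqrt{1+|Dv|^2}:=\sup\Big\{\int_0^1(v w_1'+w_2)\,dx:\ w_1,w_2\in C^1_c(0,1),\ \|w_1^2+w_2^2\|_\infty\le1\Big\}.$$ BV functions are defined up to a.e. equality, and pointwise and regularity statements refer to a suitable representative. $u(x^\pm)$ are the one-sided limits of $u$ at $x$, and $u'(x^-),u'(x^+)$ are the left and right Dini derivatives of $u$ at $x$ (at a jump point, computed using $u(x^-)$, respectively $u(x^+)$, as the value at $x$). Energy: for a solution $u$ of $(P)$, with $F(u)=\int_{u_0}^u f(s)\,ds$, $$\mathcal E(x):=1-\frac{1}{\sqrt{1+(u'(x))^2}}+a(x)F(u(x)),$$ defined at all points $x\in[0,1]$ where $u$ is continuous, i.e. up to a finite number of points for the solutions above;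 if $u$ is continuous but not differentiable at $\bar x$, then $|u'(\bar x)|=+\infty$ and $\mathcal E(\bar x)=1+a(\bar x)F(u(\bar x))$. *)

theory Defs
  imports "HOL-Analysis.Analysis"
begin

definition pos_part :: "real \<Rightarrow> real" where
  "pos_part y = max y 0"

definition neg_part :: "real \<Rightarrow> real" where
  "neg_part y = max (- y) 0"

text \<open>Derivatives are taken within \<open>S\<close>, hence are one-sided at endpoints belonging to the
  interval \<open>S\<close>.\<close>

primrec C_k_on :: "nat \<Rightarrow> (real \<Rightarrow> real) \<Rightarrow> real set \<Rightarrow> bool" where
  "C_k_on 0 g S \<longleftrightarrow> continuous_on S g"
| "C_k_on (Suc n) g S \<longleftrightarrow>
     (\<exists>g'. (\<forall>x\<in>S. (g has_real_derivative g' x) (at x within S)) \<and> C_k_on n g' S)"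

text \<open>Elements of \<open>C\<^sup>1\<^sub>c(0,1)\<close> are represented by their extension by zero to the whole line;
  a closed subset of the bounded interval \<open>(0,1)\<close> is compact.\<close>

definition C1c :: "(real \<Rightarrow> real) set" where
  "C1c = {w. C_k_on 1 w UNIV \<and> closure {x. w x \<noteq> 0} \<subseteq> {0<..<1}}"

definition BV :: "(real \<Rightarrow> real) set" where
  "BV = {u. set_integrable lebesgue {0<..<1} u \<and>
            bdd_above {(LINT x:{0<..<1}|lebesgue. u x * deriv w x) | w.
                         w \<in> C1c \<and> (\<forall>x. \<bar>w x\<bar> \<le> 1)}}"

text \<open>The integral of \<open>sqrt (1 + |Dv|\<^sup>2)\<close>; for \<open>v \<in> BV\<close> the set is bounded above, so the
  real-valued supremum is meaningful.\<close>

definition area :: "(real \<Rightarrow> real) \<Rightarrow> real" where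
  "area v = Sup {(LINT x:{0<..<1}|lebesgue. v x * deriv w1 x + w2 x) | w1 w2.
                   w1 \<in> C1c \<and> w2 \<in> C1c \<and> (\<forall>x. (w1 x)\<^sup>2 + (w2 x)\<^sup>2 \<le> 1)}"

definition BV_solution :: "(real \<Rightarrow> real) \<Rightarrow> (real \<Rightarrow> real) \<Rightarrow> (real \<Rightarrow> real) \<Rightarrow> bool" where
  "BV_solution a f u \<longleftrightarrow>
     u \<in> BV \<and> (\<forall>x\<in>{0<..<1}. u x > 0) \<and>
     (\<forall>v\<in>BV. area v \<ge> area u + (LINT x:{0<..<1}|lebesgue. a x * f (u x) * (v x - u x)))"

abbreviation left_lim :: "(real \<Rightarrow> real) \<Rightarrow> real \<Rightarrow> real" where
  "left_lim u x \<equiv> Lim (at_left x) u"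

abbreviation right_lim :: "(real \<Rightarrow> real) \<Rightarrow> real \<Rightarrow> real" where
  "right_lim u x \<equiv> Lim (at_right x) u"

text \<open>The usual pointwise representative of a BV function of one variable: one-sided limits
  exist in \<open>(0,1)\<close> and the value lies between them. In particular it is continuous wherever
  the two limits agree.\<close>

definition good_representative :: "(real \<Rightarrow> real) \<Rightarrow> bool" where
  "good_representative u \<longleftrightarrow>
     (\<forall>x\<in>{0<..<1}. (u \<longlongrightarrow> left_lim u x) (at_left x) \<and> (u \<longlongrightarrow> right_lim u x) (at_right x) \<and>
        min (left_lim u x) (right_lim u x) \<le> u x \<and> u x \<le> max (left_lim u x) (right_lim u x))"

text \<open>Extended-real one-sided Dini derivatives, based at the one-sided limit rather than at
  the value: both the upper and the lower one are required to equal \<open>D\<close>.\<close>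

definition has_left_Dini :: "(real \<Rightarrow> real) \<Rightarrow> real \<Rightarrow> ereal \<Rightarrow> bool" where
  "has_left_Dini u x D \<longleftrightarrow>
     Limsup (at_left x) (\<lambda>y. ereal ((u y - left_lim u x) / (y - x))) = D \<and>
     Liminf (at_left x) (\<lambda>y. ereal ((u y - left_lim u x) / (y - x))) = D"

definition has_right_Dini :: "(real \<Rightarrow> real) \<Rightarrow> real \<Rightarrow> ereal \<Rightarrow> bool" where
  "has_right_Dini u x D \<longleftrightarrow>
     Limsup (at_right x) (\<lambda>y. ereal ((u y - right_lim u x) / (y - x))) = D \<and>
     Liminf (at_right x) (\<lambda>y. ereal ((u y - right_lim u x) / (y - x))) = D"

text \<open>Real eigenvalues of \<open>- \<phi>'' = l a \<phi>\<close> with Neumann conditions.\<close>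

definition neumann_eigenvalues :: "(real \<Rightarrow> real) \<Rightarrow> real set" where
  "neumann_eigenvalues a = {l. \<exists>\<phi> \<phi>'.
      (\<forall>x\<in>{0..1}. (\<phi> has_real_derivative \<phi>' x) (at x within {0..1})) \<and>
      continuous_on {0..1} \<phi>' \<and>
      (\<forall>x\<in>{0<..<1}. (\<phi>' has_real_derivative - (l * a x * \<phi> x)) (at x)) \<and>
      \<phi>' 0 = 0 \<and> \<phi>' 1 = 0 \<and> (\<exists>x\<in>{0..1}. \<phi> x \<noteq> 0)}"

text \<open>Counting starts at \<open>k = 1\<close>. The eigenvalues are simple, so counting them without
  multiplicity is the usual enumeration.\<close>

definition is_kth_neumann_eigenvalue :: "(real \<Rightarrow> real) \<Rightarrow> nat \<Rightarrow> real \<Rightarrow> bool" where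
  "is_kth_neumann_eigenvalue a k l \<longleftrightarrow>
     l \<in> neumann_eigenvalues a \<and> finite {m \<in> neumann_eigenvalues a. m \<le> l} \<and>
     card {m \<in> neumann_eigenvalues a. m \<le> l} = k"

definition C_const :: "(real \<Rightarrow> real) \<Rightarrow> (real \<Rightarrow> real) \<Rightarrow> real" where
  "C_const a a' = max (a 1 / a 0 * exp (LBINT x=0..1. neg_part (a' x) / a x))
                      (a 0 / a 1 * exp (LBINT x=0..1. pos_part (a' x) / a x))"

text \<open>The interval integral is signed: it changes sign for \<open>s < u0\<close>.\<close>

definition primitive :: "(real \<Rightarrow> real) \<Rightarrow> real \<Rightarrow> real \<Rightarrow> real" where
  "primitive f u0 s = (LBINT t=u0..s. f t)"

definition energy ::
  "(real \<Rightarrow> real) \<Rightarrow> (real \<Rightarrow> real) \<Rightarrow> real \<Rightarrow> (real \<Rightarrow> real) \<Rightarrow> real \<Rightarrow> real" where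
  "energy a f u0 u x =
     (if u differentiable (at x within {0..1})
      then 1 - 1 / sqrt (1 + (vector_derivative u (at x within {0..1}))\<^sup>2)
             + a x * primitive f u0 (u x)
      else 1 + a x * primitive f u0 (u x))"

text \<open>The energy counts as defined only where \<open>u\<close> is continuous.\<close>

definition energy_extends_continuously ::
  "(real \<Rightarrow> real) \<Rightarrow> (real \<Rightarrow> real) \<Rightarrow> real \<Rightarrow> (real \<Rightarrow> real) \<Rightarrow> bool" where
  "energy_extends_continuously a f u0 u \<longleftrightarrow>
     finite {x\<in>{0..1}. \<not> continuous (at x within {0..1}) u} \<and>
     (\<exists>E. continuous_on {0..1} E \<and>
        (\<forall>x\<in>{0..1}. continuous (at x within {0..1}) u \<longrightarrow> E x = energy a f u0 u x))"

definition steep_up :: "real \<Rightarrow> (real \<Rightarrow> real) \<Rightarrow> real \<Rightarrow> bool" where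
  "steep_up u0 u x \<longleftrightarrow> left_lim u x \<le> u0 \<and> u0 \<le> right_lim u x \<and>
     has_left_Dini u x \<infinity> \<and> has_right_Dini u x \<infinity>"

definition steep_down :: "real \<Rightarrow> (real \<Rightarrow> real) \<Rightarrow> real \<Rightarrow> bool" where
  "steep_down u0 u x \<longleftrightarrow> right_lim u x \<le> u0 \<and> u0 \<le> left_lim u x \<and>
     has_left_Dini u x (-\<infinity>) \<and> has_right_Dini u x (-\<infinity>)"

text \<open>The two families of solutions differ only by a global sign: \<open>\<sigma> = 1\<close> describes solutions
  lying below \<open>u0\<close> near 0, \<open>\<sigma> = -1\<close> those lying above. At the node \<open>p i\<close> the solution goes up
  iff \<open>\<sigma> (-1)^(i+1) > 0\<close>. Only the values \<open>p 0, ..., p (n+1)\<close> matter.\<close>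

definition nodal_profile ::
  "real \<Rightarrow> real \<Rightarrow> (real \<Rightarrow> real) \<Rightarrow> nat \<Rightarrow> (nat \<Rightarrow> real) \<Rightarrow> bool" where
  "nodal_profile \<sigma> u0 u n p \<longleftrightarrow>
     p 0 = 0 \<and> p (n+1) = 1 \<and> (\<forall>i\<le>n. p i < p (i+1)) \<and>
     C_k_on 2 u {0..<p 1} \<and> C_k_on 2 u {p n<..1} \<and>
     (\<forall>i\<in>{1..<n}. C_k_on 2 u {p i<..<p (i+1)}) \<and>
     (u has_real_derivative 0) (at 0 within {0..1}) \<and>
     (u has_real_derivative 0) (at 1 within {0..1}) \<and>
     (\<forall>i\<le>n. \<forall>x\<in>{p i<..<p (i+1)}. \<sigma> * (-1) ^ (i+1) * (u x - u0) > 0) \<and>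
     (\<forall>i\<in>{1..n}.
        u (p i) = u0 \<and> C_k_on 2 u {p (i-1)<..<p (i+1)} \<or>
        (if \<sigma> * (-1) ^ (i+1) > 0 then steep_up u0 u (p i) else steep_down u0 u (p i)))"

text \<open>``Exactly'' \<open>n + 2\<close> points: neither the number nor the position of the points can be
  chosen differently.\<close>

definition has_exact_nodal_profile :: "real \<Rightarrow> real \<Rightarrow> (real \<Rightarrow> real) \<Rightarrow> nat \<Rightarrow> bool" where
  "has_exact_nodal_profile \<sigma> u0 u n \<longleftrightarrow>
     (\<exists>p. nodal_profile \<sigma> u0 u n p \<and>
        (\<forall>m q. nodal_profile \<sigma> u0 u m q \<longrightarrow> m = n \<and> (\<forall>i\<le>n+1. q i = p i)))"

end

theory Submission
  imports Defs
begin

text \<open>Graphs of solutions are traced by arclength, with tangent angle \<open>\<beta>\<close>: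
  \<open>x' = cos \<beta>\<close>, \<open>u' = sin \<beta>\<close>, \<open>\<beta>' = - a(x) f(u)\<close>, where \<open>\<beta>\<close> is clamped to \<open>[- pi/2, pi/2]\<close> under the sine
  and the cosine. While \<open>\<bar>\<beta>\<bar> \<ge> pi/2\<close> the curve moves vertically and conserves the energy, until \<open>\<beta>\<close>
  returns to \<open>\<plusminus> pi/2\<close>; this produces jumps across which the energy is continuous. The curve that
  starts horizontally at height \<open>d\<close> winds around \<open>(u0, 0)\<close> in the \<open>(u, \<beta>)\<close> plane, and it is a solution
  with \<open>n\<close> nodes if the winding angle is \<open>n pi\<close> when it reaches \<open>x = 1\<close>. For \<open>d\<close> near \<open>u0\<close> the angle
  exceeds \<open>k pi\<close>, by Sturm comparison with the eigenfunctions of the linearised problem. For \<open>d = 0\<close> the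
  curve rests, and for a suitable large \<open>d\<close> it does not complete a half turn: under (A) because the energy,
  weighted by an exponential of the variation of \<open>ln a\<close>, is monotone; under (B) because the slope is bounded. By
  connectedness every \<open>n \<le> k\<close> is attained on both sides of \<open>u0\<close>.

  For the minimality, \<open>w = sin \<beta>\<close> is a Lipschitz function of \<open>x\<close> with \<open>w' = - a f(u)\<close>. Testing the area of
  \<open>v\<close> with smooth approximations of \<open>(- w, sqrt (1 - w\<^sup>2))\<close> bounds it from below by the integral of
  \<open>a f(u) v + sqrt (1 - w\<^sup>2)\<close>, which for \<open>v = u\<close> is the length of the curve, an upper bound of the area
  of \<open>u\<close>.\<close>

section \<open>Lipschitz ordinary differential equations\<close>

text \<open>The obstacle is that a curve may run vertically: the time at which it reaches
  \<open>x = 1\<close> need not exist, need not be unique and need not depend continuously on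
  \<open>d\<close>. An intermediate value argument for the final angle is therefore replaced by a
  covering of the set of initial heights by two relatively open sets, and compactness comes from a
  bound on the times at which a curve with \<open>x \<le> 1\<close> can be horizontal. Clamping at
  \<open>pi/2\<close> is what makes jumps harmless. The cosine vanishes exactly where the clamp
  acts, so the clamped sine is still C1 and the flux satisfies its equation in \<open>x\<close>
  across vertical pieces as if there were no jump. The constant \<open>C_a\<close> is the larger of
  two exponentials, of the total increasing and of the total decreasing variation of
  \<open>ln a\<close>. The first one prevents the curve that starts at the height given by (A) from
  completing a half turn; the second one keeps the curves that are used below this height, so that
  \<open>f\<close> may be changed above it.\<close>

lemma norm_integral_exp_bound:
  fixes h :: "real \<Rightarrow> 'a::euclidean_space"
  assumes c: "continuous_on {0..s} h" and s: "0 \<le> s" and l: "0 < l"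
    and b: "\<And>r. r \<in> {0..s} \<Longrightarrow> norm (h r) \<le> M * exp (l * r)" and M: "0 \<le> M"
  shows "norm (integral {0..s} h) \<le> M / l * exp (l * s)"
proof -
  have "((\<lambda>r. M * exp (l * r)) has_integral (M / l * exp (l * s) - M / l * exp (l * 0))) {0..s}"
    using s l by (intro fundamental_theorem_of_calculus)
      (auto intro!: derivative_eq_intros simp: has_real_derivative_iff_has_vector_derivative[symmetric])
  then have i: "(\<lambda>r. M * exp (l * r)) integrable_on {0..s}"
    "integral {0..s} (\<lambda>r. M * exp (l * r)) = M / l * exp (l * s) - M / l"
    by (auto simp: has_integral_iff)
  have "norm (integral {0..s} h) \<le> integral {0..s} (\<lambda>r. M * exp (l * r))"
    using c b by (intro integral_norm_bound_integral) (auto intro: integrable_continuous_real i)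
  also have "\<dots> \<le> M / l * exp (l * s)" unfolding i(2) using M l by simp
  finally show ?thesis .
qed

lemma exp_weighted_bound:
  fixes h :: "real \<Rightarrow> 'a::euclidean_space"
  assumes c: "continuous_on {0..s} h" and s: "0 \<le> s" and l: "0 < l"
    and b: "\<And>r. r \<in> {0..s} \<Longrightarrow> norm (h r) \<le> M * exp (l * r)" and M: "0 \<le> M"
  shows "norm (exp (- (l * s)) *\<^sub>R integral {0..s} h) \<le> M / l"
proof -
  have "norm (exp (- (l * s)) *\<^sub>R integral {0..s} h) \<le> exp (- (l * s)) * (M / l * exp (l * s))"
    unfolding norm_scaleR using norm_integral_exp_bound[OF assms] by (intro mult_mono) auto
  also have "\<dots> = M / l" by (simp add: exp_minus field_simps)
  finally show ?thesis .
qed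

text \<open>The weight \<open>exp (- l s)\<close> turns the Picard operator on the whole half-line into a
  contraction of the bounded continuous functions.\<close>

lemma lipschitz_ode_forward:
  fixes V :: "'a::euclidean_space \<Rightarrow> 'a"
  assumes lip: "\<And>x y. norm (V x - V y) \<le> L * norm (x - y)"
  obtains y where "y 0 = y0" "\<And>s. s \<ge> 0 \<Longrightarrow> (y has_vector_derivative V (y s)) (at s within {0..})"
proof -
  define K where "K = max L 0"
  have K: "K \<ge> 0" "\<And>x y. norm (V x - V y) \<le> K * norm (x - y)"
    unfolding K_def by (simp, meson lip mult_right_mono order_trans max.cobounded1 norm_ge_zero)
  \<comment> \<open>This rate makes the contraction constant \<open>K / l\<close> at most
    1/2.\<close>
  define l where "l = 2 * K + 1"
  have l: "l > 0" "K / l \<le> 1/2" using K(1) by (auto simp: l_def field_simps)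
  have cV: "continuous_on S V" for S
    by (rule lipschitz_on_continuous_on[of K]) (auto simp: lipschitz_on_def dist_norm K)
  \<comment> \<open>The unknown is the bounded function \<open>z\<close> in
    \<open>y = y0 + exp (l * s) z\<close>, and \<open>Op\<close> is the Picard operator in this
    variable. The term \<open>max s 0\<close> continues it by its value 0 to negative times, so that
    it acts on bounded continuous functions of the whole line.\<close>
  define h where "h z r = V (y0 + exp (l * r) *\<^sub>R z r)" for z :: "real \<Rightarrow> 'a" and r
  define Op where "Op z s = exp (- (l * max s 0)) *\<^sub>R integral {0..max s 0} (h z)" for z s
  have ch: "continuous_on S (h z)" if "continuous_on UNIV z" for z S
    unfolding h_def by (intro continuous_intros continuous_on_compose2[OF cV[of UNIV]] continuous_on_subset[OF that]) auto
  have cI: "continuous_on {0..} (\<lambda>s. integral {0..s} (h z))" if "continuous_on UNIV z" for z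
  \<comment> \<open>For negative \<open>s\<close> the interval \<open>{0..s}\<close> is empty and
    the integral is 0. Enlarging the half-line to an open set turns continuity at 0 into continuity
    at an interior point.\<close>
  proof (rule continuous_on_subset[of "{-1<..}"])
    show "continuous_on {-1<..} (\<lambda>s. integral {0..s} (h z))"
    proof (subst continuous_on_eq_continuous_at)
      show "\<forall>x\<in>{-1<..}. continuous (at x) (\<lambda>s. integral {0..s} (h z))"
      proof
        fix x :: real assume x: "x \<in> {-1<..}"
        have "continuous_on {0..x+1} (\<lambda>s. integral {0..s} (h z))"
          using x by (intro indefinite_integral_continuous_1 integrable_continuous_real ch that)
        moreover have "continuous_on {-1..0} (\<lambda>s. integral {0..s} (h z))"
        proof (rule continuous_on_eq[of _ "\<lambda>_. 0"])
          show "0 = integral {0..s} (h z)" if "s \<in> {-1..0}" for s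
            using that by (cases "s = 0") auto
        qed auto
        ultimately have "continuous_on ({-1..0} \<union> {0..x+1}) (\<lambda>s. integral {0..s} (h z))"
          by (intro continuous_on_closed_Un) auto
        moreover have "{-1..0} \<union> {0..x+1} = {-1..x+1}" using x by auto
        ultimately have "continuous_on {-1..x+1} (\<lambda>s. integral {0..s} (h z))" by simp
        then show "continuous (at x) (\<lambda>s. integral {0..s} (h z))"
          using x by (auto simp: continuous_on_interior)
      qed
    qed auto
  qed auto
  have cOp: "continuous_on UNIV (Op z)" if "continuous_on UNIV z" for z
    unfolding Op_def by (intro continuous_intros continuous_on_compose2[OF cI[OF that]]) auto
  have hb: "norm (h z r) \<le> (norm (V y0) + K * B) * exp (l * r)"
    if "r \<ge> 0" "\<And>r. norm (z r) \<le> B" for z r B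
  proof -
    have "norm (h z r) \<le> norm (V y0) + norm (h z r - V y0)" by norm
    also have "norm (h z r - V y0) \<le> K * norm (exp (l * r) *\<^sub>R z r)"
      unfolding h_def using K(2)[of "y0 + exp (l * r) *\<^sub>R z r" y0] by simp
    also have "\<dots> \<le> K * (exp (l * r) * B)" using that K by (intro mult_left_mono) auto
    also have "norm (V y0) + K * (exp (l * r) * B) \<le> norm (V y0) * exp (l * r) + K * (exp (l * r) * B)"
      using that l by (intro add_right_mono) (simp add: mult_le_cancel_left1)
    finally show ?thesis by (simp add: algebra_simps)
  qed
  have bOp: "Op z \<in> bcontfun" if "z \<in> bcontfun" for z
  proof -
    from that obtain B where B: "\<And>r. norm (z r) \<le> B"
      by (auto simp: bcontfun_def bounded_iff)
    have B0: "B \<ge> 0" using B[of 0] norm_ge_zero order_trans by blast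
    have "norm (Op z s) \<le> (norm (V y0) + K * B) / l" for s
      unfolding Op_def using that K B0 l
      by (intro exp_weighted_bound) (auto simp: bcontfun_def intro!: ch hb B)
    then show ?thesis using cOp that by (auto simp: bcontfun_def bounded_iff)
  qed
  define T where "T z = Bcontfun (Op (apply_bcontfun z))" for z :: "real \<Rightarrow>\<^sub>C 'a"
  have T: "apply_bcontfun (T z) = Op (apply_bcontfun z)" for z
    unfolding T_def by (intro Bcontfun_inverse bOp apply_bcontfun)
  have "\<exists>!z. T z = z"
  proof (rule banach_fix_type[of "1/2"])
    have "dist (T z) (T w) \<le> 1/2 * dist z w" for z w
    proof (rule dist_bound)
      fix s :: real
      let ?m = "max s 0"
      have "Op (apply_bcontfun z) s - Op (apply_bcontfun w) s = exp (- (l * ?m)) *\<^sub>R (integral {0..?m} (h (apply_bcontfun z)) - integral {0..?m} (h (apply_bcontfun w)))"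
        by (simp add: Op_def scaleR_diff_right)
      also have "integral {0..?m} (h (apply_bcontfun z)) - integral {0..?m} (h (apply_bcontfun w)) = integral {0..?m} (\<lambda>r. h (apply_bcontfun z) r - h (apply_bcontfun w) r)"
        by (intro integral_diff[symmetric] integrable_continuous_real ch) auto
      finally have e: "Op (apply_bcontfun z) s - Op (apply_bcontfun w) s = exp (- (l * ?m)) *\<^sub>R integral {0..?m} (\<lambda>r. h (apply_bcontfun z) r - h (apply_bcontfun w) r)" .
      have "norm (exp (- (l * ?m)) *\<^sub>R integral {0..?m} (\<lambda>r. h (apply_bcontfun z) r - h (apply_bcontfun w) r)) \<le> (K * dist z w) / l"
      proof (intro exp_weighted_bound)
        fix r
        have "norm (h (apply_bcontfun z) r - h (apply_bcontfun w) r) \<le> K * norm (exp (l * r) *\<^sub>R (z r - w r))"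
          unfolding h_def using K(2)[of "y0 + exp (l * r) *\<^sub>R z r" "y0 + exp (l * r) *\<^sub>R w r"]
          by (simp add: scaleR_diff_right)
        also have "\<dots> \<le> K * (exp (l * r) * dist z w)"
          using K dist_bounded[of z r w] by (intro mult_left_mono) (auto simp: dist_norm)
        finally show "norm (h (apply_bcontfun z) r - h (apply_bcontfun w) r) \<le> K * dist z w * exp (l * r)" by (simp add: algebra_simps)
      qed (use K l in \<open>auto intro!: continuous_intros ch\<close>)
      also have "\<dots> \<le> 1/2 * dist z w"
        using mult_right_mono[OF l(2) zero_le_dist[of z w]] by simp
      finally show "dist (T z s) (T w s) \<le> 1/2 * dist z w" by (simp only: T dist_norm e)
    qed
    then show "\<forall>x y. dist (T x) (T y) \<le> 1/2 * dist x y" by blast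
  qed auto
  then obtain z where "T z = z" by blast
  then have z: "Op (apply_bcontfun z) = apply_bcontfun z" using T[of z] by simp
  have cz: "continuous_on UNIV (apply_bcontfun z)" by simp
  define y where "y s = y0 + exp (l * s) *\<^sub>R z s" for s
  have y: "y s = y0 + integral {0..s} (\<lambda>r. V (y r))" if "s \<ge> 0" for s
  proof -
    have "z s = exp (- (l * s)) *\<^sub>R integral {0..s} (h z)"
      using that fun_cong[OF z, of s] by (simp add: Op_def)
    then have "y s = y0 + (exp (l * s) * exp (- (l * s))) *\<^sub>R integral {0..s} (h z)" by (simp add: y_def)
    then show ?thesis by (simp add: exp_minus h_def[abs_def] y_def[abs_def])
  qed
  have cVy: "continuous_on S (\<lambda>r. V (y r))" for S
    using ch[OF cz, of S] by (simp add: h_def[abs_def] y_def[abs_def])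
  show thesis
  proof
    show "y 0 = y0" using y[of 0] by simp
    fix s :: real assume s: "s \<ge> 0"
    have "((\<lambda>u. integral {0..u} (\<lambda>r. V (y r))) has_vector_derivative V (y s)) (at s within {0..s+1})"
      using s by (intro integral_has_vector_derivative cVy) auto
    then have "((\<lambda>u. y0 + integral {0..u} (\<lambda>r. V (y r))) has_vector_derivative V (y s)) (at s within {0..s+1})"
      using has_vector_derivative_add[OF has_vector_derivative_const] by fastforce
    then have "(y has_vector_derivative V (y s)) (at s within {0..s+1})"
      by (rule has_vector_derivative_transform[rotated 2]) (use s y in auto)
    moreover have "at s within {0..s+1} = at s within {0..}"
      using s by (intro at_within_nhd[of _ "{..<s+1}"]) auto
    ultimately show "(y has_vector_derivative V (y s)) (at s within {0..})" by simp
  qed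
qed

text \<open>Backward time for \<open>V\<close> is forward time for \<open>- V\<close>. The two
  half-line solutions are glued at 0, where both one-sided derivatives are
  \<open>V y0\<close>.\<close>

theorem lipschitz_ode_global:
  fixes V :: "'a::euclidean_space \<Rightarrow> 'a"
  assumes lip: "\<And>x y. norm (V x - V y) \<le> L * norm (x - y)"
  obtains y where "y 0 = y0" "\<And>s. (y has_vector_derivative V (y s)) (at s)"
proof -
  obtain p where p: "p 0 = y0" "\<And>s. s \<ge> 0 \<Longrightarrow> (p has_vector_derivative V (p s)) (at s within {0..})"
    using lipschitz_ode_forward[OF lip] by metis
  have "norm (- V x - - V y) \<le> L * norm (x - y)" for x y
    using lip[of y x] by (simp add: norm_minus_commute)
  then obtain q where q: "q 0 = y0" "\<And>s. s \<ge> 0 \<Longrightarrow> (q has_vector_derivative - V (q s)) (at s within {0..})"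
    using lipschitz_ode_forward[of "\<lambda>x. - V x"] by metis
  define y where "y s = (if s \<ge> 0 then p s else q (- s))" for s
  have r: "((\<lambda>s. q (- s)) has_vector_derivative V (q (- s))) (at s within {..0})" if "s \<le> 0" for s
  proof -
    have "(q \<circ> uminus has_vector_derivative ((-1) *\<^sub>R (- V (q (- s))))) (at s within {..0})"
    proof (rule vector_diff_chain_within)
      show "(uminus has_vector_derivative (-1::real)) (at s within {..0})"
        by (auto intro!: derivative_eq_intros simp: has_real_derivative_iff_has_vector_derivative[symmetric])
      have "uminus ` {..0} = {0::real..}" using image_uminus_atMost[of 0] by simp
      then show "(q has_vector_derivative - V (q (- s))) (at (- s) within uminus ` {..0})"
        using q(2)[of "-s"] that by simp
    qed
    then show ?thesis by (simp add: o_def)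
  qed
  show thesis
  proof
    show "y 0 = y0" by (simp add: y_def p)
    fix s
    show "(y has_vector_derivative V (y s)) (at s)"
    proof -
      have pos: "(y has_vector_derivative V (y s)) (at s within {0..})" if "s \<ge> 0"
        using that p(2)[OF that] by (intro has_vector_derivative_transform[of _ _ y p]) (auto simp: y_def)
      have neg: "(y has_vector_derivative V (y s)) (at s within {..0})" if "s \<le> 0"
      proof -
        have "y t = q (- t)" if "t \<le> 0" for t using that p q by (auto simp: y_def)
        then show ?thesis using that r[OF that] by (intro has_vector_derivative_transform[of _ _ y "\<lambda>s. q (- s)"]) auto
      qed
      consider "s > 0" | "s < 0" | "s = 0" by linarith
      then show ?thesis
      proof cases
        case 1
        then have "at s within {0..} = at s" by (intro at_within_interior) auto
        then show ?thesis using \<open>s > 0\<close> pos by simp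
      next
        case 2
        then have "at s within {..0} = at s" by (intro at_within_interior) auto
        then show ?thesis using \<open>s < 0\<close> neg by simp
      next
        case 3
        have "(y has_vector_derivative V (y s)) (at s within {0..} \<union> {..0})"
          using pos neg 3 unfolding has_vector_derivative_def has_derivative_within
          by (auto intro: Lim_Un)
        moreover have "{0..} \<union> {..0} = (UNIV :: real set)" by auto
        ultimately show ?thesis by simp
      qed
    qed
  qed
qed

text \<open>Gronwall's inequality, by the integrating factor \<open>exp (- K * s)\<close>. The rate
  \<open>K\<close> may have either sign; negative rates serve to run estimates backwards.\<close>

lemma exp_growth_bound:
  fixes \<phi> :: "real \<Rightarrow> real"
  assumes d: "\<And>s. a < s \<Longrightarrow> s < b \<Longrightarrow> (\<phi> has_real_derivative \<phi>' s) (at s)"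
    and c: "continuous_on {a..b} \<phi>"
    and k: "\<And>s. a < s \<Longrightarrow> s < b \<Longrightarrow> \<phi>' s \<le> K * \<phi> s" and ab: "a \<le> b"
  shows "\<phi> b \<le> \<phi> a * exp (K * (b - a))"
proof -
  have "\<phi> b * exp (- K * b) \<le> \<phi> a * exp (- K * a)"
  proof (rule DERIV_nonpos_imp_decreasing_open[OF ab])
    fix s assume s: "a < s" "s < b"
    have "((\<lambda>s. \<phi> s * exp (- K * s)) has_real_derivative (\<phi>' s - K * \<phi> s) * exp (- K * s)) (at s)"
      by (auto intro!: derivative_eq_intros d s simp: algebra_simps)
    moreover have "(\<phi>' s - K * \<phi> s) * exp (- K * s) \<le> 0"
      using k[OF s] by (intro mult_nonpos_nonneg) auto
    ultimately show "\<exists>y. ((\<lambda>s. \<phi> s * exp (- K * s)) has_real_derivative y) (at s) \<and> y \<le> 0" by blast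
  qed (auto intro!: continuous_intros c)
  then have "\<phi> b * exp (- K * b) * exp (K * b) \<le> \<phi> a * exp (- K * a) * exp (K * b)"
    by (rule mult_right_mono) simp
  then show ?thesis
    by (simp add: mult.assoc exp_add[symmetric] algebra_simps)
qed

text \<open>The norm may fail to be differentiable where the solutions meet, so Gronwall is applied
  to the squared distance, with rate \<open>2 * L\<close>.\<close>

lemma lipschitz_ode_dependence:
  fixes V :: "'a::euclidean_space \<Rightarrow> 'a"
  assumes lip: "\<And>x y. norm (V x - V y) \<le> L * norm (x - y)"
    and y: "\<And>s. a < s \<Longrightarrow> s < b \<Longrightarrow> (y has_vector_derivative V (y s)) (at s)" "continuous_on {a..b} y"
    and z: "\<And>s. a < s \<Longrightarrow> s < b \<Longrightarrow> (z has_vector_derivative V (z s)) (at s)" "continuous_on {a..b} z"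
    and ab: "a \<le> b"
  shows "norm (y b - z b) \<le> norm (y a - z a) * exp (L * (b - a))"
proof -
  define \<phi> where "\<phi> s = (y s - z s) \<bullet> (y s - z s)" for s
  have "\<phi> b \<le> \<phi> a * exp (2 * L * (b - a))"
  proof (rule exp_growth_bound[OF _ _ _ ab])
    fix s assume s: "a < s" "s < b"
    show "(\<phi> has_real_derivative 2 * ((y s - z s) \<bullet> (V (y s) - V (z s)))) (at s)"
      unfolding \<phi>_def has_field_derivative_def
      by (rule has_derivative_eq_rhs, (rule derivative_intros y(1)[unfolded has_vector_derivative_def] z(1)[unfolded has_vector_derivative_def] s)+)
         (auto simp: fun_eq_iff inner_commute algebra_simps)
    have "(y s - z s) \<bullet> (V (y s) - V (z s)) \<le> norm (y s - z s) * norm (V (y s) - V (z s))"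
      by (rule norm_cauchy_schwarz)
    also have "\<dots> \<le> norm (y s - z s) * (L * norm (y s - z s))" by (intro mult_left_mono lip) auto
    also have "\<dots> = L * \<phi> s" by (simp add: \<phi>_def power2_norm_eq_inner[symmetric] power2_eq_square)
    finally show "2 * ((y s - z s) \<bullet> (V (y s) - V (z s))) \<le> 2 * L * \<phi> s" by simp
  qed (auto simp: \<phi>_def intro!: continuous_intros y z)
  also have "exp (2 * L * (b - a)) = (exp (L * (b - a)))\<^sup>2" by (simp add: power2_eq_square exp_add[symmetric])
  finally have "(norm (y b - z b))\<^sup>2 \<le> (norm (y a - z a) * exp (L * (b - a)))\<^sup>2"
    by (simp add: \<phi>_def power2_norm_eq_inner[symmetric] power_mult_distrib)
  then show ?thesis by (rule power2_le_imp_le) simp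
qed

text \<open>Time reversal reduces this to the forward estimate for \<open>- V\<close>. The two
  estimates together make coincidence at one time equivalent to coincidence at another.\<close>

lemma lipschitz_ode_dependence_backward:
  fixes V :: "'a::euclidean_space \<Rightarrow> 'a"
  assumes lip: "\<And>x y. norm (V x - V y) \<le> L * norm (x - y)"
    and y: "\<And>s. a < s \<Longrightarrow> s < b \<Longrightarrow> (y has_vector_derivative V (y s)) (at s)" "continuous_on {a..b} y"
    and z: "\<And>s. a < s \<Longrightarrow> s < b \<Longrightarrow> (z has_vector_derivative V (z s)) (at s)" "continuous_on {a..b} z"
    and ab: "a \<le> b"
  shows "norm (y a - z a) \<le> norm (y b - z b) * exp (L * (b - a))"
proof -
  have d: "((\<lambda>s. w (- s)) has_vector_derivative - V (w (- s))) (at s)"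
    if "(w has_vector_derivative V (w (- s))) (at (- s))" for w s
  proof -
    have "(w \<circ> uminus has_vector_derivative ((-1) *\<^sub>R V (w (- s)))) (at s)"
      using that by (intro vector_diff_chain_at)
        (auto intro!: derivative_eq_intros simp: has_real_derivative_iff_has_vector_derivative[symmetric])
    then show ?thesis by (simp add: o_def)
  qed
  have c: "continuous_on {- b..- a} (\<lambda>s. w (- s))" if "continuous_on {a..b} w" for w :: "real \<Rightarrow> 'a"
    by (rule continuous_on_compose2[OF that]) (auto intro!: continuous_intros)
  have "norm (y (- (- a)) - z (- (- a))) \<le> norm (y (- (- b)) - z (- (- b))) * exp (L * (- a - - b))"
  proof (rule lipschitz_ode_dependence[where V="\<lambda>x. - V x" and y="\<lambda>s. y (- s)" and z="\<lambda>s. z (- s)"])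
    show "norm (- V x - - V y) \<le> L * norm (x - y)" for x y
      using lip[of y x] by (simp add: norm_minus_commute)
  qed (use ab y z in \<open>auto intro!: d c\<close>)
  then show ?thesis by simp
qed

section \<open>Pruefer angles\<close>

lemma antiderivative_real:
  fixes g :: "real \<Rightarrow> real"
  assumes "continuous_on UNIV g"
  obtains G where "G c = 0" "\<And>x. (G has_real_derivative g x) (at x)"
proof -
  have "\<exists>F. \<forall>x::real. -\<infinity> < ereal x \<longrightarrow> ereal x < \<infinity> \<longrightarrow> (F has_vector_derivative g x) (at x)"
    by (rule einterval_antiderivative) (use assms in \<open>auto simp: continuous_on_eq_continuous_at\<close>)
  then obtain F where "\<And>x. (F has_real_derivative g x) (at x)"
    by (auto simp: has_real_derivative_iff_has_vector_derivative)
  then have "((\<lambda>x. F x - F c) has_real_derivative g x) (at x)" for x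
    by (auto intro!: derivative_eq_intros)
  then show thesis using that[of "\<lambda>x. F x - F c"] by simp
qed

lemma continuous_on_Icc_abs_bound:
  fixes f :: "real \<Rightarrow> real"
  assumes "continuous_on {a..b} f"
  obtains B where "B \<ge> 0" "\<And>x. x \<in> {a..b} \<Longrightarrow> \<bar>f x\<bar> \<le> B"
proof -
  have "bounded (f ` {a..b})" using compact_continuous_image[OF assms] by (simp add: compact_imp_bounded)
  then obtain B where "\<And>x. x \<in> {a..b} \<Longrightarrow> \<bar>f x\<bar> \<le> B" unfolding bounded_iff by fastforce
  then show thesis using that[of "max B 0"] by (meson max.cobounded1 max.cobounded2 order_trans)
qed

text \<open>The pair \<open>(p, q)\<close> in polar form: both \<open>P = p cos \<theta> - q sin \<theta>\<close> and
  \<open>Q = p sin \<theta> + q cos \<theta>\<close> satisfy \<open>y' = \<rho> y\<close>, and \<open>Q\<close> starts at zero.\<close>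

lemma polar_form:
  fixes p q p' q' \<theta> :: "real \<Rightarrow> real"
  assumes p: "\<And>s. 0 < s \<Longrightarrow> s < T \<Longrightarrow> (p has_real_derivative p' s) (at s)"
    and q: "\<And>s. 0 < s \<Longrightarrow> s < T \<Longrightarrow> (q has_real_derivative q' s) (at s)"
    and cont: "continuous_on {0..T} p" "continuous_on {0..T} q"
      "continuous_on {0..T} p'" "continuous_on {0..T} q'"
    and ne: "\<And>s. s \<in> {0..T} \<Longrightarrow> p s \<noteq> 0 \<or> q s \<noteq> 0"
    and \<theta>: "\<theta> 0 = 0" "continuous_on {0..T} \<theta>"
      "\<And>s. 0 < s \<Longrightarrow> s < T \<Longrightarrow>
        (\<theta> has_real_derivative (q s * p' s - p s * q' s) / ((p s)\<^sup>2 + (q s)\<^sup>2)) (at s)"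
    and q0: "q 0 = 0"
  obtains P where "\<And>s. s \<in> {0..T} \<Longrightarrow> p s = P s * cos (\<theta> s)"
    "\<And>s. s \<in> {0..T} \<Longrightarrow> q s = - P s * sin (\<theta> s)"
    "\<And>s. s \<in> {0..T} \<Longrightarrow> p 0 * P s > 0"
proof (cases "T \<ge> 0")
  case True
  \<comment> \<open>\<open>\<rho>\<close> is the logarithmic derivative of the modulus of
    \<open>(p, q)\<close>, and \<open>w\<close> below is the clockwise angular speed;
    \<open>(p', q')\<close> is split into these radial and rotational parts.\<close>
  define \<rho> where "\<rho> s = (p s * p' s + q s * q' s) / ((p s)\<^sup>2 + (q s)\<^sup>2)" for s
  have pos: "(p s)\<^sup>2 + (q s)\<^sup>2 \<noteq> 0" if "s \<in> {0..T}" for s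
    using ne[OF that] by (simp add: sum_power2_eq_zero_iff)
  have c\<rho>: "continuous_on {0..T} \<rho>"
    unfolding \<rho>_def using pos by (intro continuous_intros cont) auto
  define R where "R s = integral {0..s} \<rho>" for s
  have R: "(R has_real_derivative \<rho> s) (at s)" if "0 < s" "s < T" for s
  proof -
    have "(R has_real_derivative \<rho> s) (at s within {0..T})"
      unfolding R_def using c\<rho> that by (intro integral_has_real_derivative) auto
    then show ?thesis using that at_within_interior[of s "{0..T}"] by simp
  qed
  have cR: "continuous_on {0..T} R"
    unfolding R_def by (intro indefinite_integral_continuous_1 integrable_continuous_real c\<rho>)
  define w where "w s = (q s * p' s - p s * q' s) / ((p s)\<^sup>2 + (q s)\<^sup>2)" for s
  have pq': "p' s = \<rho> s * p s + w s * q s" "q' s = \<rho> s * q s - w s * p s" if "s \<in> {0..T}" for s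
  proof -
    define D where "D = (p s)\<^sup>2 + (q s)\<^sup>2"
    have D: "D \<noteq> 0" using pos[OF that] by (simp add: D_def)
    have 1: "(p s * p' s + q s * q' s) * p s + (q s * p' s - p s * q' s) * q s = p' s * D"
      "(p s * p' s + q s * q' s) * q s - (q s * p' s - p s * q' s) * p s = q' s * D"
      unfolding D_def by (simp_all add: algebra_simps power2_eq_square)
    have "\<rho> s * p s + w s * q s = ((p s * p' s + q s * q' s) * p s + (q s * p' s - p s * q' s) * q s) / D"
      "\<rho> s * q s - w s * p s = ((p s * p' s + q s * q' s) * q s - (q s * p' s - p s * q' s) * p s) / D"
      unfolding \<rho>_def w_def D_def by (simp_all only: add_divide_distrib[symmetric] diff_divide_distrib[symmetric] times_divide_eq_left)
    note 2 = this[unfolded 1 nonzero_mult_div_cancel_right[OF D]]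
    show "p' s = \<rho> s * p s + w s * q s" by (rule 2(1)[symmetric])
    show "q' s = \<rho> s * q s - w s * p s" by (rule 2(2)[symmetric])
  qed
  \<comment> \<open>Both rotated components satisfy this scalar linear equation, so each is its
    initial value times \<open>exp (R s)\<close>: \<open>Q\<close> stays 0 and \<open>P\<close>
    keeps the sign of \<open>p 0\<close>.\<close>
  have lin: "y s = y 0 * exp (R s)"
    if y: "\<And>s. 0 < s \<Longrightarrow> s < T \<Longrightarrow> (y has_real_derivative \<rho> s * y s) (at s)"
      "continuous_on {0..T} y" and s: "s \<in> {0..T}" for y s
  proof -
    have "y s * exp (- R s) = y 0 * exp (- R 0)"
    proof (cases "s = 0")
      case False
      show ?thesis
      proof (rule DERIV_isconst_end[of 0 s "\<lambda>s. y s * exp (- R s)"])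
        show "continuous_on {0..s} (\<lambda>s. y s * exp (- R s))"
          by (intro continuous_intros continuous_on_subset[OF y(2)] continuous_on_subset[OF cR]) (use s in auto)
        fix t assume "0 < t" "t < s"
        then show "((\<lambda>s. y s * exp (- R s)) has_real_derivative 0) (at t)"
          using s by (auto intro!: derivative_eq_intros y R)
      qed (use s False in auto)
    qed auto
    then have "y s * exp (- R s) * exp (R s) = y 0 * exp (R s)" by (simp add: R_def)
    then show ?thesis by (simp add: mult.assoc exp_add[symmetric])
  qed
  define P where "P s = p s * cos (\<theta> s) - q s * sin (\<theta> s)" for s
  define Q where "Q s = p s * sin (\<theta> s) + q s * cos (\<theta> s)" for s
  have P: "P s = p 0 * exp (R s)" if "s \<in> {0..T}" for s
  proof -
    have "P s = P 0 * exp (R s)"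
    proof (rule lin[OF _ _ that])
      fix s assume s: "0 < s" "s < T"
      then have e: "p' s = \<rho> s * p s + w s * q s" "q' s = \<rho> s * q s - w s * p s" using pq' by auto
      have "(\<theta> has_real_derivative w s) (at s)" using \<theta>(3)[OF s] by (simp add: w_def)
      then show "(P has_real_derivative \<rho> s * P s) (at s)"
        unfolding P_def by (auto intro!: derivative_eq_intros p q s simp: e algebra_simps)
    qed (auto simp: P_def intro!: continuous_intros cont \<theta>)
    then show ?thesis using q0 \<theta> by (simp add: P_def)
  qed
  have Q: "Q s = 0" if "s \<in> {0..T}" for s
  proof -
    have "Q s = Q 0 * exp (R s)"
    proof (rule lin[OF _ _ that])
      fix s assume s: "0 < s" "s < T"
      then have e: "p' s = \<rho> s * p s + w s * q s" "q' s = \<rho> s * q s - w s * p s" using pq' by auto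
      have "(\<theta> has_real_derivative w s) (at s)" using \<theta>(3)[OF s] by (simp add: w_def)
      then show "(Q has_real_derivative \<rho> s * Q s) (at s)"
        unfolding Q_def by (auto intro!: derivative_eq_intros p q s simp: e algebra_simps)
    qed (auto simp: Q_def intro!: continuous_intros cont \<theta>)
    then show ?thesis using q0 \<theta> by (simp add: Q_def)
  qed
  show thesis
  proof
    fix s assume s: "s \<in> {0..T}"
    let ?c = "cos (\<theta> s)" and ?s = "sin (\<theta> s)"
    have 1: "?c * ?c + ?s * ?s = 1" using sin_cos_squared_add3[of "\<theta> s"] by simp
    have "P s * ?c + Q s * ?s = p s * (?c * ?c + ?s * ?s)"
      unfolding P_def Q_def by algebra
    then show "p s = P s * cos (\<theta> s)" unfolding 1 using Q[OF s] by simp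
    have "- P s * ?s + Q s * ?c = q s * (?c * ?c + ?s * ?s)"
      unfolding P_def Q_def by algebra
    then show "q s = - P s * sin (\<theta> s)" unfolding 1 using Q[OF s] by simp
    have "p 0 \<noteq> 0" using ne[of 0] q0 True by auto
    then have "p 0 * p 0 * exp (R s) > 0" by (metis exp_gt_zero mult_pos_pos not_real_square_gt_zero)
    then show "p 0 * P s > 0" using P[OF s] by (simp add: mult.assoc)
  qed
qed (use that in auto)

lemma abs_sin_diff_le: "\<bar>sin x - sin y\<bar> \<le> \<bar>x - y\<bar>" for x y :: real
proof -
  have "\<bar>sin x - sin y\<bar> = 2 * \<bar>sin ((x - y)/2)\<bar> * \<bar>cos ((x + y)/2)\<bar>"
    by (simp add: sin_diff_sin abs_mult)
  also have "\<dots> \<le> 2 * \<bar>(x - y)/2\<bar> * 1"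
    by (intro mult_mono) (auto intro: abs_sin_x_le_abs_x[of "(x-y)/2", simplified] simp: abs_cos_le_one)
  finally show ?thesis by simp
qed

lemma abs_cos_diff_le: "\<bar>cos x - cos y\<bar> \<le> \<bar>x - y\<bar>" for x y :: real
  using abs_sin_diff_le[of "pi/2 - x" "pi/2 - y"] by (simp add: cos_sin_eq)

lemma abs_sin2_diff_le: "\<bar>(sin x)\<^sup>2 - (sin y)\<^sup>2\<bar> \<le> 2 * \<bar>x - y\<bar>" for x y :: real
proof -
  have "(sin x)\<^sup>2 - (sin y)\<^sup>2 = (sin x - sin y) * (sin x + sin y)"
    by (simp add: power2_eq_square algebra_simps)
  then have "\<bar>(sin x)\<^sup>2 - (sin y)\<^sup>2\<bar> = \<bar>sin x - sin y\<bar> * \<bar>sin x + sin y\<bar>" by (simp add: abs_mult)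
  also have "\<dots> \<le> \<bar>x - y\<bar> * 2"
    using abs_sin_le_one[of x] abs_sin_le_one[of y] by (intro mult_mono abs_sin_diff_le) linarith+
  finally show ?thesis by simp
qed

text \<open>Sturm comparison for Pruefer angles. The difference \<open>\<delta>\<close> satisfies \<open>\<delta>' \<ge> - K \<bar>\<delta>\<bar>\<close>, so it
  stays nonnegative; it is positive near 0 thanks to the term \<open>\<kappa> cos\<^sup>2\<close>.\<close>

lemma angle_comparison:
  fixes \<theta>1 \<theta>2 d1 g h :: "real \<Rightarrow> real"
  assumes d1: "\<And>s. 0 < s \<Longrightarrow> s < T \<Longrightarrow> (\<theta>1 has_real_derivative d1 s) (at s)"
      "\<And>s. 0 < s \<Longrightarrow> s < T \<Longrightarrow> d1 s \<ge> g s * (cos (\<theta>1 s))\<^sup>2 + h s * (sin (\<theta>1 s))\<^sup>2 + \<kappa> * (cos (\<theta>1 s))\<^sup>2"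
    and d2: "\<And>s. 0 < s \<Longrightarrow> s < T \<Longrightarrow>
        (\<theta>2 has_real_derivative g s * (cos (\<theta>2 s))\<^sup>2 + h s * (sin (\<theta>2 s))\<^sup>2) (at s)"
    and cont: "continuous_on {0..T} \<theta>1" "continuous_on {0..T} \<theta>2"
    and bd: "\<And>s. 0 < s \<Longrightarrow> s < T \<Longrightarrow> \<bar>g s\<bar> \<le> M" "\<And>s. 0 < s \<Longrightarrow> s < T \<Longrightarrow> \<bar>h s\<bar> \<le> M"
    and k: "\<kappa> > 0" and T: "T > 0" and init: "\<theta>1 0 = 0" "\<theta>2 0 = 0"
  shows "\<theta>1 T > \<theta>2 T"
proof -
  define \<delta> where "\<delta> s = \<theta>1 s - \<theta>2 s" for s
  \<comment> \<open>\<open>\<bar>g - h\<bar>\<close> is at most \<open>2 * M\<close>, and squared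
    sines differ by at most twice the difference of the angles.\<close>
  define K where "K = 4 * M"
  have M: "M \<ge> 0" using bd(1)[of "T/2"] T by auto
  define G where "G s = d1 s - (g s * (cos (\<theta>2 s))\<^sup>2 + h s * (sin (\<theta>2 s))\<^sup>2)" for s
  have \<delta>': "(\<delta> has_real_derivative G s) (at s)" if "0 < s" "s < T" for s
    unfolding \<delta>_def G_def by (intro derivative_intros d1 d2 that)
  have G: "G s \<ge> - K * \<bar>\<delta> s\<bar> + \<kappa> * (cos (\<theta>1 s))\<^sup>2" if s: "0 < s" "s < T" for s
  proof -
    have "\<bar>(g s - h s) * ((sin (\<theta>1 s))\<^sup>2 - (sin (\<theta>2 s))\<^sup>2)\<bar> \<le> (2 * M) * (2 * \<bar>\<delta> s\<bar>)"
      unfolding abs_mult \<delta>_def using bd[OF s] M by (intro mult_mono abs_sin2_diff_le) auto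
    moreover have "g s * (cos (\<theta>1 s))\<^sup>2 + h s * (sin (\<theta>1 s))\<^sup>2
      - (g s * (cos (\<theta>2 s))\<^sup>2 + h s * (sin (\<theta>2 s))\<^sup>2)
      = - ((g s - h s) * ((sin (\<theta>1 s))\<^sup>2 - (sin (\<theta>2 s))\<^sup>2))"
      by (simp add: cos_squared_eq algebra_simps)
    ultimately show ?thesis using d1(2)[OF s] unfolding G_def K_def by (simp only: abs_le_iff) linarith
  qed
  have c\<delta>: "continuous_on {0..T} \<delta>" unfolding \<delta>_def by (intro continuous_intros cont)
  have nonneg: "\<delta> s \<ge> 0" if s: "s \<in> {0..T}" for s
  proof (rule ccontr)
    assume neg: "\<not> \<delta> s \<ge> 0"
    \<comment> \<open>If \<open>\<delta>\<close> is negative at \<open>s\<close>, let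
      \<open>t0\<close> be the last earlier time at which it is nonnegative. From there on Gronwall
      bounds \<open>- \<delta>\<close> by a multiple of its nonpositive value at
      \<open>t0\<close>.\<close>
    define Z where "Z = {t \<in> {0..s}. \<delta> t \<ge> 0}"
    have "Z = {0..s} \<inter> \<delta> -` {0..}" by (auto simp: Z_def)
    moreover have "closed ({0..s} \<inter> \<delta> -` {0..})"
      by (intro continuous_closed_preimage continuous_on_subset[OF c\<delta>]) (use s in auto)
    ultimately have "closed Z" by simp
    have "0 \<in> Z" using s init by (auto simp: Z_def \<delta>_def)
    moreover have bZ: "bdd_above Z" by (rule bdd_aboveI[of _ s]) (auto simp: Z_def)
    ultimately have m: "Sup Z \<in> Z" using \<open>closed Z\<close> by (intro closed_contains_Sup) auto
    define t0 where "t0 = Sup Z"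
    have t0: "0 \<le> t0" "t0 \<le> s" "\<delta> t0 \<ge> 0" using m by (auto simp: Z_def t0_def)
    have after: "\<delta> t < 0" if "t0 < t" "t \<le> s" for t
    proof (rule ccontr)
      assume "\<not> \<delta> t < 0"
      then have "t \<in> Z" using that t0 by (auto simp: Z_def)
      then show False using cSup_upper[OF _ bZ] that by (force simp: t0_def)
    qed
    have "- \<delta> s \<le> - \<delta> t0 * exp (K * (s - t0))"
    proof (rule exp_growth_bound[OF _ _ _ t0(2)])
      fix t assume t: "t0 < t" "t < s"
      show "((\<lambda>s. - \<delta> s) has_real_derivative - G t) (at t)"
        using t t0 s by (intro derivative_intros \<delta>') auto
      have "\<kappa> * (cos (\<theta>1 t))\<^sup>2 \<ge> 0" using k by simp
      then show "- G t \<le> K * - \<delta> t" using G[of t] after[of t] t t0 s by auto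
    qed (intro continuous_intros continuous_on_subset[OF c\<delta>], use t0 s in auto)
    also have "\<dots> \<le> 0" using t0 by simp
    finally show False using neg by simp
  qed
  have ccos: "continuous_on {0..T} (\<lambda>s. cos (\<theta>1 s))" by (intro continuous_intros cont)
  have "\<exists>d>0. \<forall>s\<in>{0..T}. dist s 0 < d \<longrightarrow> dist (cos (\<theta>1 s)) (cos (\<theta>1 0)) < 1/2"
    by (rule ccos[unfolded continuous_on_iff, rule_format]) (use T in auto)
  then obtain \<eta> where \<eta>: "\<eta> > 0"
    "\<And>s. s \<in> {0..T} \<Longrightarrow> dist s 0 < \<eta> \<Longrightarrow> dist (cos (\<theta>1 s)) (cos (\<theta>1 0)) < 1/2"
    by blast
  \<comment> \<open>Up to \<open>t1\<close> the angle \<open>\<theta>1\<close> is so small that its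
    cosine exceeds 1/2, and the term with \<open>\<kappa>\<close> makes
    \<open>\<delta> s * exp (K * s)\<close> strictly increase; afterwards this product never
    decreases.\<close>
  define t1 where "t1 = min T (\<eta>/2)"
  have t1: "0 < t1" "t1 \<le> T" "t1 < \<eta>" using T \<eta> by (auto simp: t1_def)
  have ed: "((\<lambda>s. \<delta> s * exp (K * s)) has_real_derivative (G s + K * \<delta> s) * exp (K * s)) (at s)" if "0 < s" "s < T" for s
    using that by (auto intro!: derivative_eq_intros \<delta>' simp: algebra_simps)
  have Gp: "G s + K * \<delta> s \<ge> \<kappa> * (cos (\<theta>1 s))\<^sup>2" if "0 < s" "s < T" for s
    using G[OF that] nonneg[of s] that by simp
  have "\<delta> 0 * exp (K * 0) < \<delta> t1 * exp (K * t1)"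
  proof (rule DERIV_pos_imp_increasing_open[OF t1(1)])
    fix s assume s: "0 < s" "s < t1"
    then have "cos (\<theta>1 s) > 1/2" using \<eta>(2)[of s] t1 init by (auto simp: dist_real_def)
    then have "\<kappa> * (cos (\<theta>1 s))\<^sup>2 > 0" using k by (intro mult_pos_pos zero_less_power) auto
    then have "G s + K * \<delta> s > 0" using Gp[of s] s t1 by linarith
    then show "\<exists>y. ((\<lambda>s. \<delta> s * exp (K * s)) has_real_derivative y) (at s) \<and> 0 < y"
      using ed[of s] s t1 by (intro exI[of _ "(G s + K * \<delta> s) * exp (K * s)"]) auto
  qed (intro continuous_intros continuous_on_subset[OF c\<delta>], use t1 in auto)
  also have "\<delta> t1 * exp (K * t1) \<le> \<delta> T * exp (K * T)"
  proof (rule DERIV_nonneg_imp_increasing_open[OF t1(2)])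
    fix s assume s: "t1 < s" "s < T"
    have "\<kappa> * (cos (\<theta>1 s))\<^sup>2 \<ge> 0" using k by simp
    then have "G s + K * \<delta> s \<ge> 0" using Gp[of s] s t1 by auto
    then show "\<exists>y. ((\<lambda>s. \<delta> s * exp (K * s)) has_real_derivative y) (at s) \<and> 0 \<le> y"
      using ed[of s] s t1 by (intro exI[of _ "(G s + K * \<delta> s) * exp (K * s)"]) auto
  qed (intro continuous_intros continuous_on_subset[OF c\<delta>], use t1 in auto)
  finally have "\<delta> T * exp (K * T) > 0" using init by (simp add: \<delta>_def)
  then show ?thesis by (simp add: \<delta>_def zero_less_mult_iff)
qed

section \<open>Neumann eigenvalues\<close>

text \<open>In the polar form \<open>\<phi> = P cos \<theta>\<close>,
  \<open>\<phi>' = - P sin \<theta>\<close> the Neumann conditions say that \<open>\<theta>\<close>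
  starts at 0 and ends at a zero of the sine. A negative eigenvalue would make
  \<open>\<phi> * \<phi>'\<close> strictly increase between its zeros at the two ends.\<close>

lemma neumann_eigenvalue_angle:
  fixes a :: "real \<Rightarrow> real"
  assumes l: "l \<in> neumann_eigenvalues a"
    and ca: "continuous_on {0..1} a" and pa: "\<And>x. x \<in> {0..1} \<Longrightarrow> a x > 0"
  shows "l \<ge> 0" and "\<exists>\<theta> m. \<theta> 0 = 0 \<and> continuous_on {0..1} \<theta> \<and> \<theta> 1 = real m * pi \<and>
     (\<forall>s\<in>{0<..<1}. (\<theta> has_real_derivative l * a s * (cos (\<theta> s))\<^sup>2 + (sin (\<theta> s))\<^sup>2) (at s))"
proof -
  obtain \<phi> \<phi>' where d: "\<And>x. x \<in> {0..1} \<Longrightarrow> (\<phi> has_real_derivative \<phi>' x) (at x within {0..1})"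
    and c': "continuous_on {0..1} \<phi>'"
    and d': "\<And>x. x \<in> {0<..<1} \<Longrightarrow> (\<phi>' has_real_derivative - (l * a x * \<phi> x)) (at x)"
    and bc: "\<phi>' 0 = 0" "\<phi>' 1 = 0" and nz: "\<exists>x\<in>{0..1}. \<phi> x \<noteq> 0"
    using l unfolding neumann_eigenvalues_def by blast
  have c: "continuous_on {0..1} \<phi>"
    by (rule DERIV_continuous_on) (use d in auto)
  have d: "(\<phi> has_real_derivative \<phi>' x) (at x)" if "0 < x" "x < 1" for x
    using d[of x] at_within_interior[of x "{0..1}"] that by simp
  obtain A where "\<And>x. x \<in> {0..1} \<Longrightarrow> \<bar>a x\<bar> \<le> A"
    by (rule continuous_on_Icc_abs_bound[OF ca]) blast
  then have A: "\<And>x. x \<in> {0..1} \<Longrightarrow> a x \<le> A" by (meson abs_le_D1)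
  \<comment> \<open>The derivative of \<open>E\<close> is at most \<open>K * E\<close> in absolute
    value, so a single zero of \<open>E\<close> would spread by Gronwall in both directions and
    annihilate the eigenfunction.\<close>
  define E where "E s = (\<phi> s)\<^sup>2 + (\<phi>' s)\<^sup>2" for s
  define K where "K = 1 + \<bar>l\<bar> * A"
  have cE: "continuous_on S E" if "S \<subseteq> {0..1}" for S
    unfolding E_def by (intro continuous_intros continuous_on_subset[OF c] continuous_on_subset[OF c'] that)
  have dE: "(E has_real_derivative 2 * \<phi> x * \<phi>' x * (1 - l * a x)) (at x)" if "0 < x" "x < 1" for x
    unfolding E_def using that by (auto intro!: derivative_eq_intros d d' simp: algebra_simps)
  have bE: "\<bar>2 * \<phi> x * \<phi>' x * (1 - l * a x)\<bar> \<le> K * E x" if "0 < x" "x < 1" for x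
  proof -
    have "0 \<le> (\<bar>\<phi> x\<bar> - \<bar>\<phi>' x\<bar>)\<^sup>2" by simp
    then have 1: "\<bar>2 * \<phi> x * \<phi>' x\<bar> \<le> E x"
      by (simp add: E_def power2_eq_square algebra_simps abs_mult)
    have "\<bar>l * a x\<bar> \<le> \<bar>l\<bar> * A"
      unfolding abs_mult using A[of x] pa[of x] that by (intro mult_left_mono) auto
    then have 2: "\<bar>1 - l * a x\<bar> \<le> K" unfolding K_def by linarith
    have "\<bar>2 * \<phi> x * \<phi>' x * (1 - l * a x)\<bar> = \<bar>2 * \<phi> x * \<phi>' x\<bar> * \<bar>1 - l * a x\<bar>" by (simp only: abs_mult)
    also have "\<dots> \<le> E x * K" by (intro mult_mono 1 2) (auto simp: E_def)
    finally show ?thesis by (simp only: mult.commute)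
  qed
  have nE: "E s \<noteq> 0" if s: "s \<in> {0..1}" for s
  proof
    assume z: "E s = 0"
    obtain x where x: "x \<in> {0..1}" "\<phi> x \<noteq> 0" using nz by blast
    then have pos: "E x > 0" by (simp add: E_def add_pos_nonneg)
    show False
    proof (cases "s \<le> x")
      case True
      have "E x \<le> E s * exp (K * (x - s))"
      proof (rule exp_growth_bound[OF dE _ _ True])
        fix t assume "s < t" "t < x"
        then show "2 * \<phi> t * \<phi>' t * (1 - l * a t) \<le> K * E t" using bE[of t] x s by simp
      qed (use s x in \<open>auto intro!: cE\<close>)
      then show False using z pos by simp
    next
      case False
      have "- E s \<le> - E x * exp ((- K) * (s - x))"
      proof (rule exp_growth_bound)
        fix t assume "x < t" "t < s"
        then have t: "0 < t" "t < 1" using x s by auto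
        show "((\<lambda>s. - E s) has_real_derivative - (2 * \<phi> t * \<phi>' t * (1 - l * a t))) (at t)"
          by (intro derivative_intros dE t)
        show "- (2 * \<phi> t * \<phi>' t * (1 - l * a t)) \<le> - K * - E t" using bE[OF t] by simp
      qed (use s x False in \<open>auto intro!: continuous_intros cE\<close>)
      then show False using z pos by (simp add: mult_le_0_iff)
    qed
  qed
  show l0: "l \<ge> 0"
  proof (rule ccontr)
    assume "\<not> l \<ge> 0"
    then have ln: "l < 0" by simp
    define w where "w s = \<phi> s * \<phi>' s" for s
    have dw: "(w has_real_derivative (\<phi>' s)\<^sup>2 + (- l) * a s * (\<phi> s)\<^sup>2) (at s)" if "0 < s" "s < 1" for s
      unfolding w_def using that by (auto intro!: derivative_eq_intros d d' simp: algebra_simps power2_eq_square)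
    have cw: "continuous_on S w" if "S \<subseteq> {0..1}" for S
      unfolding w_def by (intro continuous_intros continuous_on_subset[OF c] continuous_on_subset[OF c'] that)
    have pw: "(\<phi>' s)\<^sup>2 + (- l) * a s * (\<phi> s)\<^sup>2 > 0" if "0 < s" "s < 1" for s
    proof -
      have "\<phi> s \<noteq> 0 \<or> \<phi>' s \<noteq> 0" using nE[of s] that by (auto simp: E_def)
      moreover have "(- l) * a s > 0" using ln pa[of s] that by (intro mult_pos_pos) auto
      ultimately show ?thesis
      proof (cases "\<phi> s = 0")
        case False
        then have "(- l) * a s * (\<phi> s)\<^sup>2 > 0" using \<open>(- l) * a s > 0\<close> by (metis mult_pos_pos zero_less_power2)
        then show ?thesis using zero_le_power2[of "\<phi>' s"] by linarith
      qed auto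
    qed
    have "w 0 < w 1"
    proof (rule DERIV_pos_imp_increasing_open[of 0 1 w])
      fix x :: real assume "0 < x" "x < 1"
      then show "\<exists>y. (w has_real_derivative y) (at x) \<and> 0 < y" using dw pw by blast
    qed (auto intro!: cw)
    then show False by (simp add: w_def bc)
  qed
  define g where "g s = ((\<phi>' s)\<^sup>2 + l * a s * (\<phi> s)\<^sup>2) / E s" for s
  define \<theta> where "\<theta> s = integral {0..s} g" for s
  have cg: "continuous_on {0..1} g"
    unfolding g_def by (intro continuous_intros c c' ca cE) (use nE in auto)
  have c\<theta>: "continuous_on {0..1} \<theta>"
    unfolding \<theta>_def by (intro indefinite_integral_continuous_1 integrable_continuous_real cg)
  have d\<theta>: "(\<theta> has_real_derivative g s) (at s)" if "0 < s" "s < 1" for s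
  proof -
    have "(\<theta> has_real_derivative g s) (at s within {0..1})"
      unfolding \<theta>_def using cg that by (intro integral_has_real_derivative) auto
    then show ?thesis using that at_within_interior[of s "{0..1}"] by simp
  qed
  have \<theta>0: "\<theta> 0 = 0" by (simp add: \<theta>_def)
  obtain P where P: "\<And>s. s \<in> {0..1} \<Longrightarrow> \<phi> s = P s * cos (\<theta> s)"
    "\<And>s. s \<in> {0..1} \<Longrightarrow> \<phi>' s = - P s * sin (\<theta> s)" "\<And>s. s \<in> {0..1} \<Longrightarrow> \<phi> 0 * P s > 0"
  proof (rule polar_form[of 1 \<phi> \<phi>' \<phi>' "\<lambda>x. - (l * a x * \<phi> x)" \<theta>])
    fix s :: real assume s: "0 < s" "s < 1"
    show "(\<theta> has_real_derivative (\<phi>' s * \<phi>' s - \<phi> s * - (l * a s * \<phi> s)) / ((\<phi> s)\<^sup>2 + (\<phi>' s)\<^sup>2)) (at s)"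
      using d\<theta>[OF s] by (simp add: g_def E_def power2_eq_square algebra_simps)
  next
    fix s :: real assume "s \<in> {0..1}"
    then show "\<phi> s \<noteq> 0 \<or> \<phi>' s \<noteq> 0" using nE[of s] by (auto simp: E_def)
  qed (use d d' c c' c\<theta> \<theta>0 bc in \<open>auto intro!: continuous_intros ca\<close>)
  have Pn: "P s \<noteq> 0" if "s \<in> {0..1}" for s using P(3)[OF that] by auto
  have gs: "g s = l * a s * (cos (\<theta> s))\<^sup>2 + (sin (\<theta> s))\<^sup>2" if s: "s \<in> {0..1}" for s
  proof -
    have "E s = (P s)\<^sup>2 * (cos (\<theta> s))\<^sup>2 + (P s)\<^sup>2 * (sin (\<theta> s))\<^sup>2"
      using P(1,2)[OF s] by (simp add: E_def power_mult_distrib)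
    also have "\<dots> = (P s)\<^sup>2" unfolding distrib_left[symmetric] by simp
    finally have e: "E s = (P s)\<^sup>2" .
    have "(\<phi>' s)\<^sup>2 + l * a s * (\<phi> s)\<^sup>2 = (P s)\<^sup>2 * (l * a s * (cos (\<theta> s))\<^sup>2 + (sin (\<theta> s))\<^sup>2)"
      using P(1,2)[OF s] by (simp add: power_mult_distrib algebra_simps)
    then show ?thesis unfolding g_def e using Pn[OF s] nonzero_mult_div_cancel_left[of "(P s)\<^sup>2"] by (metis power_not_zero)
  qed
  have "sin (\<theta> 1) = 0" using P(2)[of 1] Pn[of 1] bc by auto
  then obtain i :: int where i: "\<theta> 1 = of_int i * pi" by (auto simp: sin_zero_iff_int2)
  have "\<theta> 0 \<le> \<theta> 1"
  proof (rule DERIV_nonneg_imp_increasing_open[of 0 1 \<theta>])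
    fix x :: real assume x: "0 < x" "x < 1"
    have "g x \<ge> 0" using gs[of x] x l0 pa[of x] by auto
    then show "\<exists>y. (\<theta> has_real_derivative y) (at x) \<and> 0 \<le> y" using d\<theta>[OF x] by blast
  qed (auto intro: c\<theta>)
  then have "0 \<le> of_int i * pi" using i \<theta>0 by simp
  then have "i \<ge> 0" using pi_gt_zero by (auto simp: zero_le_mult_iff)
  then have \<theta>1: "\<theta> 1 = real (nat i) * pi" using i by simp
  have "\<forall>s\<in>{0<..<1}. (\<theta> has_real_derivative l * a s * (cos (\<theta> s))\<^sup>2 + (sin (\<theta> s))\<^sup>2) (at s)"
  proof
    fix s :: real assume s: "s \<in> {0<..<1}"
    then have "(\<theta> has_real_derivative g s) (at s)" by (intro d\<theta>) auto
    then show "(\<theta> has_real_derivative l * a s * (cos (\<theta> s))\<^sup>2 + (sin (\<theta> s))\<^sup>2) (at s)"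
      using gs[of s] s by simp
  qed
  with \<theta>0 c\<theta> \<theta>1 show "\<exists>\<theta> m. \<theta> 0 = 0 \<and> continuous_on {0..1} \<theta> \<and> \<theta> 1 = real m * pi \<and>
     (\<forall>s\<in>{0<..<1}. (\<theta> has_real_derivative l * a s * (cos (\<theta> s))\<^sup>2 + (sin (\<theta> s))\<^sup>2) (at s))"
    by (intro exI[of _ \<theta>] exI[of _ "nat i"] conjI)
qed

text \<open>The final angles of the eigenfunctions are multiples of \<open>pi\<close> and strictly increase with
  the eigenvalue, so that of the \<open>(k+1)\<close>-st one is at least \<open>k pi\<close>.\<close>

lemma kth_eigenvalue_angle:
  fixes a :: "real \<Rightarrow> real"
  assumes ca: "continuous_on {0..1} a" and pa: "\<And>x. x \<in> {0..1} \<Longrightarrow> a x > 0"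
    and kth: "is_kth_neumann_eigenvalue a (k + 1) lam"
  obtains \<theta> where "lam \<ge> 0" "\<theta> 0 = 0" "continuous_on {0..1} \<theta>" "\<theta> 1 \<ge> real k * pi"
    "\<And>s. s \<in> {0<..<1} \<Longrightarrow> (\<theta> has_real_derivative lam * a s * (cos (\<theta> s))\<^sup>2 + (sin (\<theta> s))\<^sup>2) (at s)"
proof -
  let ?Q = "\<lambda>l \<theta> (m::nat). \<theta> 0 = 0 \<and> continuous_on {0..1} \<theta> \<and> \<theta> 1 = real m * pi \<and>
     (\<forall>s\<in>{0<..<1}. (\<theta> has_real_derivative l * a s * (cos (\<theta> s))\<^sup>2 + (sin (\<theta> s))\<^sup>2) (at s))"
  define ev where "ev = {l \<in> neumann_eigenvalues a. l \<le> lam}"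
  have "\<forall>l\<in>neumann_eigenvalues a. \<exists>\<theta> m. ?Q l \<theta> m"
    using neumann_eigenvalue_angle(2)[OF _ ca pa] by blast
  then have "\<forall>l\<in>neumann_eigenvalues a. \<exists>p. ?Q l (fst p) (snd p)" by (simp only: fst_conv snd_conv split_paired_Ex)
  from bchoice[OF this] obtain p where p: "\<forall>l\<in>neumann_eigenvalues a. ?Q l (fst (p l)) (snd (p l))" ..
  define \<Theta> where "\<Theta> l = fst (p l)" for l
  define m where "m l = snd (p l)" for l
  have \<Theta>: "?Q l (\<Theta> l) (m l)" if "l \<in> neumann_eigenvalues a" for l
    using bspec[OF p that] unfolding \<Theta>_def m_def .
  note \<Theta>0 = \<Theta>[THEN conjunct1] and \<Theta>c = \<Theta>[THEN conjunct2, THEN conjunct1]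
    and \<Theta>1 = \<Theta>[THEN conjunct2, THEN conjunct2, THEN conjunct1]
    and \<Theta>d = \<Theta>[THEN conjunct2, THEN conjunct2, THEN conjunct2, THEN bspec]
  obtain A where "\<And>x. x \<in> {0..1} \<Longrightarrow> \<bar>a x\<bar> \<le> A"
    by (rule continuous_on_Icc_abs_bound[OF ca]) blast
  then have A: "\<And>x. x \<in> {0..1} \<Longrightarrow> a x \<le> A" by (meson abs_le_D1)
  obtain x0 where x0: "x0 \<in> {0..1}" "\<And>x. x \<in> {0..1} \<Longrightarrow> a x0 \<le> a x"
    using continuous_attains_inf[OF compact_Icc _ ca] by auto
  have mono: "m l1 < m l2" if l1: "l1 \<in> neumann_eigenvalues a" and l2: "l2 \<in> neumann_eigenvalues a" and lt: "l1 < l2" for l1 l2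
  proof -
    have nn: "l1 \<ge> 0" using neumann_eigenvalue_angle(1)[OF l1 ca pa] .
    \<comment> \<open>The minimum of \<open>a\<close> turns the gap between the eigenvalues into the
      uniform excess \<open>(l2 - l1) * a x0\<close> that the comparison asks for.\<close>
    have "\<Theta> l2 1 > \<Theta> l1 1"
    proof (rule angle_comparison[where ?\<theta>1.0="\<Theta> l2" and ?\<theta>2.0="\<Theta> l1" and ?d1.0="\<lambda>s. l2 * a s * (cos (\<Theta> l2 s))\<^sup>2 + (sin (\<Theta> l2 s))\<^sup>2"
          and g="\<lambda>s. l1 * a s" and h="\<lambda>_. 1" and \<kappa>="(l2 - l1) * a x0" and M="max 1 (l1 * A)"])
      fix s :: real assume s: "0 < s" "s < 1"
      show "(\<Theta> l2 has_real_derivative l2 * a s * (cos (\<Theta> l2 s))\<^sup>2 + (sin (\<Theta> l2 s))\<^sup>2) (at s)"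
        using \<Theta>d[OF l2] s by simp
      show "(\<Theta> l1 has_real_derivative (l1 * a s) * (cos (\<Theta> l1 s))\<^sup>2 + 1 * (sin (\<Theta> l1 s))\<^sup>2) (at s)"
        using \<Theta>d[OF l1] s by simp
      have "(l2 - l1) * a x0 \<le> (l2 - l1) * a s" using x0(2)[of s] s lt by (intro mult_left_mono) auto
      then have "l1 * a s + (l2 - l1) * a x0 \<le> l2 * a s" by (simp add: algebra_simps)
      then have "(l1 * a s + (l2 - l1) * a x0) * (cos (\<Theta> l2 s))\<^sup>2 \<le> l2 * a s * (cos (\<Theta> l2 s))\<^sup>2"
        by (intro mult_right_mono) auto
      then show "l2 * a s * (cos (\<Theta> l2 s))\<^sup>2 + (sin (\<Theta> l2 s))\<^sup>2 \<ge>
        l1 * a s * (cos (\<Theta> l2 s))\<^sup>2 + 1 * (sin (\<Theta> l2 s))\<^sup>2 + ((l2 - l1) * a x0) * (cos (\<Theta> l2 s))\<^sup>2"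
        by (simp add: algebra_simps)
      have "\<bar>l1 * a s\<bar> \<le> l1 * A" using A[of s] pa[of s] s nn by (auto simp: abs_mult intro!: mult_left_mono)
      then show "\<bar>l1 * a s\<bar> \<le> max 1 (l1 * A)" by simp
      show "\<bar>1::real\<bar> \<le> max 1 (l1 * A)" by simp
    next
      show "continuous_on {0..1} (\<Theta> l2)" "\<Theta> l2 0 = 0" by (rule \<Theta>c[OF l2], rule \<Theta>0[OF l2])
      show "continuous_on {0..1} (\<Theta> l1)" "\<Theta> l1 0 = 0" by (rule \<Theta>c[OF l1], rule \<Theta>0[OF l1])
      show "(l2 - l1) * a x0 > 0" using lt pa[OF x0(1)] by simp
    qed simp
    then show ?thesis unfolding \<Theta>1[OF l1] \<Theta>1[OF l2] by simp
  qed
  have lam: "lam \<in> neumann_eigenvalues a" "finite ev" "card ev = k + 1"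
    using kth by (auto simp: is_kth_neumann_eigenvalue_def ev_def)
  \<comment> \<open>The \<open>k + 1\<close> eigenvalues up to \<open>lam\<close> have distinct
    indices among \<open>0, ..., m lam\<close>, which forces \<open>k \<le> m lam\<close>.\<close>
  have "inj_on m ev"
  proof (rule inj_onI)
    fix x y assume h: "x \<in> ev" "y \<in> ev" "m x = m y"
    then show "x = y" using mono[of x y] mono[of y x] by (cases x y rule: linorder_cases) (auto simp: ev_def)
  qed
  moreover have "m ` ev \<subseteq> {..m lam}"
  proof
    fix i assume "i \<in> m ` ev"
    then obtain l where l: "l \<in> neumann_eigenvalues a" "l \<le> lam" "i = m l" by (auto simp: ev_def)
    then show "i \<in> {..m lam}" using mono[OF l(1) lam(1)] by (cases "l = lam") auto
  qed
  ultimately have "card ev \<le> card {..m lam}" by (intro card_inj_on_le) auto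
  then have "k \<le> m lam" using lam by simp
  then have "\<Theta> lam 1 \<ge> real k * pi" unfolding \<Theta>1[OF lam(1)] by simp
  then show thesis
    using that[of "\<Theta> lam"] \<Theta>0[OF lam(1)] \<Theta>c[OF lam(1)] \<Theta>d[OF lam(1)] neumann_eigenvalue_angle(1)[OF lam(1) ca pa] by simp
qed

section \<open>The arclength flow and shooting\<close>

text \<open>\<open>A\<close> and \<open>G\<close> are global stand-ins for \<open>a\<close> and
  \<open>f\<close>. They are bounded and Lipschitz, so that the flow exists for all times, and
  \<open>G\<close> is zero on the negative axis, so that a curve which sinks below 0 keeps its
  direction for ever. The clamping angle \<open>b\<close> is a parameter because the two alternative
  hypotheses are treated with different values of it.\<close>

locale curvature_flow =
  fixes b :: real and A G :: "real \<Rightarrow> real" and u0 LA MA LG MG :: real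
  assumes b: "0 < b" "b \<le> pi / 2"
    and A_lip: "\<And>x y. \<bar>A x - A y\<bar> \<le> LA * \<bar>x - y\<bar>"
    and A_bd: "\<And>x. 0 < A x" "\<And>x. A x \<le> MA"
    and G_lip: "\<And>u v. \<bar>G u - G v\<bar> \<le> LG * \<bar>u - v\<bar>"
    and G_bd: "\<And>u. \<bar>G u\<bar> \<le> MG"
    and u0: "0 < u0"
    and G_neg: "\<And>u. 0 < u \<Longrightarrow> u < u0 \<Longrightarrow> G u < 0"
    and G_pos: "\<And>u. u0 < u \<Longrightarrow> 0 < G u"
    and G_zero: "\<And>u. u \<le> 0 \<Longrightarrow> G u = 0" "G u0 = 0"
begin

definition cl :: "real \<Rightarrow> real" where "cl \<beta> = max (- b) (min b \<beta>)"
definition S :: "real \<Rightarrow> real" where "S \<beta> = sin (cl \<beta>)"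
definition C :: "real \<Rightarrow> real" where "C \<beta> = cos (cl \<beta>)"

lemma cl_lip: "\<bar>cl x - cl y\<bar> \<le> \<bar>x - y\<bar>" using b by (auto simp: cl_def)

lemma cl_bd: "- b \<le> cl \<beta>" "cl \<beta> \<le> b" "\<bar>cl \<beta>\<bar> \<le> pi/2" using b by (auto simp: cl_def)

lemma cl_id: "\<bar>\<beta>\<bar> \<le> b \<Longrightarrow> cl \<beta> = \<beta>" by (auto simp: cl_def)

lemma S_lip: "\<bar>S x - S y\<bar> \<le> \<bar>x - y\<bar>"
  unfolding S_def using abs_sin_diff_le cl_lip order_trans by blast

lemma C_lip: "\<bar>C x - C y\<bar> \<le> \<bar>x - y\<bar>"
  unfolding C_def using abs_cos_diff_le cl_lip order_trans by blast

lemma C_bd: "0 \<le> C \<beta>" "C \<beta> \<le> 1"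
  using cl_bd[of \<beta>] by (auto simp: C_def intro!: cos_ge_zero)

lemma S_bd: "\<bar>S \<beta>\<bar> \<le> 1" by (auto simp: S_def)

lemma S2_C2: "(S \<beta>)\<^sup>2 + (C \<beta>)\<^sup>2 = 1" by (simp add: S_def C_def)

lemma SC_0 [simp]: "S 0 = 0" "C 0 = 1" using b by (auto simp: S_def C_def cl_def)

lemma S_pos: "\<beta> > 0 \<Longrightarrow> S \<beta> > 0"
  unfolding S_def using b by (intro sin_gt_zero) (auto simp: cl_def min_def max_def)

lemma S_neg: "\<beta> < 0 \<Longrightarrow> S \<beta> < 0"
proof -
  have "cl (- \<beta>) = - cl \<beta>" using b by (auto simp: cl_def min_def max_def)
  then show "\<beta> < 0 \<Longrightarrow> S \<beta> < 0" using S_pos[of "- \<beta>"] by (simp add: S_def)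
qed

lemma continuous_S [continuous_intros]: "continuous_on X (g :: (_::t2_space) \<Rightarrow> real) \<Longrightarrow> continuous_on X (\<lambda>x. S (g x))"
  unfolding S_def cl_def by (intro continuous_intros continuous_on_max continuous_on_min)

lemma continuous_C [continuous_intros]: "continuous_on X (g :: (_::t2_space) \<Rightarrow> real) \<Longrightarrow> continuous_on X (\<lambda>x. C (g x))"
  unfolding C_def cl_def by (intro continuous_intros continuous_on_max continuous_on_min)

lemma continuous_A [continuous_intros]: "continuous_on X g \<Longrightarrow> continuous_on X (\<lambda>x. A (g x))"
proof -
  have "continuous_on UNIV A"
    by (rule lipschitz_on_continuous_on[of "max LA 0"])
       (auto simp: lipschitz_on_def dist_real_def intro!: order_trans[OF A_lip] mult_right_mono)
  then show "continuous_on X g \<Longrightarrow> ?thesis" by (rule continuous_on_compose2) auto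
qed

lemma continuous_G [continuous_intros]: "continuous_on X g \<Longrightarrow> continuous_on X (\<lambda>x. G (g x))"
proof -
  have "continuous_on UNIV G"
    by (rule lipschitz_on_continuous_on[of "max LG 0"])
       (auto simp: lipschitz_on_def dist_real_def intro!: order_trans[OF G_lip] mult_right_mono)
  then show "continuous_on X g \<Longrightarrow> ?thesis" by (rule continuous_on_compose2) auto
qed

definition V :: "real \<times> real \<times> real \<Rightarrow> real \<times> real \<times> real" where
  "V y = (C (snd (snd y)), S (snd (snd y)), - (A (fst y) * G (fst (snd y))))"

definition L :: real where "L = 2 + \<bar>MG * LA\<bar> + \<bar>MA * LG\<bar>"

lemma V_lip: "norm (V y - V z) \<le> L * norm (y - z)"
proof -
  obtain x u \<beta> where y: "y = (x, u, \<beta>)" by (metis prod.exhaust)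
  obtain x' u' \<beta>' where z: "z = (x', u', \<beta>')" by (metis prod.exhaust)
  let ?N = "norm (y - z)"
  have N: "\<bar>x - x'\<bar> \<le> ?N" "\<bar>u - u'\<bar> \<le> ?N" "\<bar>\<beta> - \<beta>'\<bar> \<le> ?N"
  proof -
    have e: "y - z = (x - x', u - u', \<beta> - \<beta>')" by (simp add: y z)
    have "norm (u - u', \<beta> - \<beta>') \<le> ?N" unfolding e by (rule norm_snd_le)
    moreover have "norm (u - u') \<le> norm (u - u', \<beta> - \<beta>')" by (rule norm_fst_le)
    moreover have "norm (\<beta> - \<beta>') \<le> norm (u - u', \<beta> - \<beta>')" by (rule norm_snd_le)
    moreover have "norm (x - x') \<le> ?N" unfolding e by (rule norm_fst_le)
    ultimately show "\<bar>x - x'\<bar> \<le> ?N" "\<bar>u - u'\<bar> \<le> ?N" "\<bar>\<beta> - \<beta>'\<bar> \<le> ?N" by auto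
  qed
  have "\<bar>A x * G u - A x' * G u'\<bar> \<le> \<bar>A x\<bar> * \<bar>G u - G u'\<bar> + \<bar>A x - A x'\<bar> * \<bar>G u'\<bar>"
    unfolding abs_mult[symmetric] by (rule order_trans[OF _ abs_triangle_ineq]) (simp add: algebra_simps)
  also have "\<dots> \<le> MA * (\<bar>LG\<bar> * ?N) + (\<bar>LA\<bar> * ?N) * MG"
  proof -
    have "\<bar>G u - G u'\<bar> \<le> \<bar>LG\<bar> * ?N"
      by (rule order_trans[OF G_lip]) (meson N(2) abs_ge_self abs_ge_zero mult_mono)
    moreover have "\<bar>A x - A x'\<bar> \<le> \<bar>LA\<bar> * ?N"
      by (rule order_trans[OF A_lip]) (meson N(1) abs_ge_self abs_ge_zero mult_mono)
    moreover have "\<bar>A x\<bar> \<le> MA" using A_bd[of x] by simp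
    ultimately show ?thesis using G_bd[of u'] A_bd[of x]
      by (intro add_mono mult_mono) (auto intro: order_trans)
  qed
  also have "\<dots> \<le> (\<bar>MG * LA\<bar> + \<bar>MA * LG\<bar>) * ?N"
  proof -
    have "MA \<ge> 0" "MG \<ge> 0" using A_bd[of 0] G_bd[of 0] by auto
    then show ?thesis by (simp add: abs_mult algebra_simps)
  qed
  finally have AG: "\<bar>A x * G u - A x' * G u'\<bar> \<le> (\<bar>MG * LA\<bar> + \<bar>MA * LG\<bar>) * ?N" .
  have "norm (V y - V z) \<le> \<bar>C \<beta> - C \<beta>'\<bar> + norm (S \<beta> - S \<beta>', - (A x * G u) + A x' * G u')"
    by (simp add: V_def y z norm_Pair_le[of "C \<beta> - C \<beta>'", simplified])
  also have "norm (S \<beta> - S \<beta>', - (A x * G u) + A x' * G u') \<le> \<bar>S \<beta> - S \<beta>'\<bar> + \<bar>A x * G u - A x' * G u'\<bar>"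
    using norm_Pair_le[of "S \<beta> - S \<beta>'" "- (A x * G u) + A x' * G u'"] by simp
  finally show ?thesis
    using AG N(3) C_lip[of \<beta> \<beta>'] S_lip[of \<beta> \<beta>'] by (simp add: L_def algebra_simps)
qed

section \<open>The flow and its dependence on the initial height\<close>

definition flow :: "real \<Rightarrow> real \<Rightarrow> real \<times> real \<times> real" where
  "flow d = (SOME y. y 0 = (0, d, 0) \<and> (\<forall>s. (y has_vector_derivative V (y s)) (at s)))"

lemma flow: "flow d 0 = (0, d, 0)" "(flow d has_vector_derivative V (flow d s)) (at s)"
proof -
  have "\<exists>y. y 0 = (0, d, 0) \<and> (\<forall>s. (y has_vector_derivative V (y s)) (at s))"
    using lipschitz_ode_global[OF V_lip] by metis
  from someI_ex[OF this] show "flow d 0 = (0, d, 0)" "(flow d has_vector_derivative V (flow d s)) (at s)"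
    unfolding flow_def[symmetric] by auto
qed

lemma continuous_flow: "continuous_on X (flow d)"
  by (rule continuous_on_vector_derivative) (auto intro: has_vector_derivative_at_within flow)

definition X :: "real \<Rightarrow> real \<Rightarrow> real" where "X d s = fst (flow d s)"
definition U :: "real \<Rightarrow> real \<Rightarrow> real" where "U d s = fst (snd (flow d s))"
definition B :: "real \<Rightarrow> real \<Rightarrow> real" where "B d s = snd (snd (flow d s))"

lemma flow_eq: "flow d s = (X d s, U d s, B d s)" by (simp add: X_def U_def B_def)

lemma init [simp]: "X d 0 = 0" "U d 0 = d" "B d 0 = 0" by (simp_all add: X_def U_def B_def flow)

lemma deriv_X: "(X d has_real_derivative C (B d s)) (at s)"
  and deriv_U: "(U d has_real_derivative S (B d s)) (at s)"
  and deriv_B: "(B d has_real_derivative - (A (X d s) * G (U d s))) (at s)"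
proof -
  note f = flow(2)[of d s]
  note g = bounded_linear.has_vector_derivative[OF bounded_linear_snd f]
  show "(X d has_real_derivative C (B d s)) (at s)"
    using bounded_linear.has_vector_derivative[OF bounded_linear_fst f]
    by (simp add: has_real_derivative_iff_has_vector_derivative X_def[abs_def] V_def B_def)
  show "(U d has_real_derivative S (B d s)) (at s)"
    using bounded_linear.has_vector_derivative[OF bounded_linear_fst g]
    by (simp add: has_real_derivative_iff_has_vector_derivative U_def[abs_def] V_def B_def)
  show "(B d has_real_derivative - (A (X d s) * G (U d s))) (at s)"
    using bounded_linear.has_vector_derivative[OF bounded_linear_snd g]
    by (simp add: has_real_derivative_iff_has_vector_derivative B_def[abs_def] U_def X_def V_def)
qed

lemma continuous_XUB [continuous_intros]:
  "continuous_on Y (X d)" "continuous_on Y (U d)" "continuous_on Y (B d)"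
  by (rule DERIV_continuous_on[OF has_field_derivative_at_within[OF deriv_X]]
      DERIV_continuous_on[OF has_field_derivative_at_within[OF deriv_U]]
      DERIV_continuous_on[OF has_field_derivative_at_within[OF deriv_B]])+

lemma X_mono: "s \<le> t \<Longrightarrow> X d s \<le> X d t"
  by (rule DERIV_nonneg_imp_nondecreasing) (use deriv_X C_bd in blast)+

lemma X_nonneg: "0 \<le> s \<Longrightarrow> 0 \<le> X d s"
  using X_mono[of 0 s d] by simp

lemma solution_unique:
  assumes "\<And>s. s0 < s \<Longrightarrow> s < s1 \<Longrightarrow> (y has_vector_derivative V (y s)) (at s)" "continuous_on {s0..s1} y" "s0 \<le> s1"
  shows "y s0 = flow d s0 \<longleftrightarrow> y s1 = flow d s1"
  using lipschitz_ode_dependence[OF V_lip assms(1,2) flow(2) continuous_flow assms(3)]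
    lipschitz_ode_dependence_backward[OF V_lip assms(1,2) flow(2) continuous_flow assms(3)]
  by (metis diff_self mult_zero_left norm_le_zero_iff norm_zero right_minus_eq)

lemma flow_lipschitz:
  assumes "0 \<le> s" "s \<le> T" shows "norm (flow d s - flow e s) \<le> exp (L * T) * \<bar>d - e\<bar>"
proof -
  have "norm (flow d s - flow e s) \<le> norm (flow d 0 - flow e 0) * exp (L * (s - 0))"
    by (rule lipschitz_ode_dependence[OF V_lip flow(2) continuous_flow flow(2) continuous_flow assms(1)])
  also have "norm (flow d 0 - flow e 0) = \<bar>d - e\<bar>" by (simp add: flow norm_Pair)
  also have "\<bar>d - e\<bar> * exp (L * (s - 0)) \<le> \<bar>d - e\<bar> * exp (L * T)"
    using assms by (intro mult_left_mono) (auto simp: L_def intro!: mult_left_mono)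
  finally show ?thesis by (simp add: mult.commute)
qed

lemma continuous_flow2: "continuous_on (D \<times> {0..T}) (\<lambda>(d, s). flow d s)"
proof -
  have "continuous_on ({0..T} \<times> D) (\<lambda>(s, d). flow d s)"
  proof (rule continuous_on_TimesI)
    show "local_lipschitz {0..T} D (\<lambda>s d. flow d s)"
    proof (rule local_lipschitzI)
      fix t x assume "t \<in> {0..T}" "x \<in> D"
      have "(exp (L * T))-lipschitz_on (cball x 1 \<inter> D) (\<lambda>d. flow d s)" if "s \<in> {0..T}" for s
        using flow_lipschitz[of s T] that by (auto simp: lipschitz_on_def dist_norm)
      then show "\<exists>u>0. \<exists>L. \<forall>t\<in>cball t u \<inter> {0..T}. L-lipschitz_on (cball x u \<inter> D) (\<lambda>d. flow d t)"
        by (intro exI[of _ 1] conjI exI[of _ "exp (L * T)"]) auto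
    qed
  qed (use continuous_flow in \<open>auto simp: eta_contract_eq\<close>)
  then have "continuous_on (D \<times> {0..T}) (\<lambda>p. (\<lambda>(s, d). flow d s) (prod.swap p))"
    by (rule continuous_on_compose2) (auto intro: continuous_on_swap)
  then show ?thesis by (simp add: case_prod_beta)
qed

section \<open>Rest states and positivity\<close>

lemma constant_solution:
  assumes "G v = 0"
  shows "((\<lambda>t. (x + (t - s), v, 0)) has_vector_derivative V (x + (t - s), v, 0)) (at t)"
proof -
  have e: "V (x + (t - s), v, 0) = (1, 0, 0)" by (simp add: V_def assms)
  show ?thesis unfolding e has_vector_derivative_def
    by (auto intro!: derivative_eq_intros simp: zero_prod_def)
qed

text \<open>By uniqueness, a curve can pass through a horizontal point over a zero of
  \<open>G\<close> only if it has been resting at that height from the start.\<close>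

lemma stationary:
  assumes "G v = 0" "0 \<le> s"
  shows "flow d s = (x, v, 0) \<Longrightarrow> d = v" and "U v s = v" "B v s = 0"
proof -
  note d = constant_solution[OF assms(1)]
  have c: "continuous_on Y (\<lambda>t. (x + (t - s), v, 0::real))" for Y :: "real set" and x s
    by (intro continuous_intros)
  show "d = v" if "flow d s = (x, v, 0)"
    using solution_unique[of 0 s "\<lambda>t. (x + (t - s), v, 0)", OF d c assms(2), of d] that by (simp add: flow)
  have "(0 + (s - 0), v, 0) = flow v s"
    using solution_unique[of 0 s "\<lambda>t. (0 + (t - 0), v, 0)", OF d c assms(2), of v] by (simp add: flow)
  then show "U v s = v" "B v s = 0" by (simp_all add: flow_eq)
qed

lemma not_stationary:
  assumes "0 < d" "d \<noteq> u0" "0 \<le> s" shows "\<not> (G (U d s) = 0 \<and> B d s = 0)"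
proof
  assume h: "G (U d s) = 0 \<and> B d s = 0"
  then have "d = U d s" using stationary(1)[of "U d s" s d "X d s"] assms by (simp add: flow_eq)
  then have "G d = 0" using h by simp
  then show False using assms G_neg[of d] G_pos[of d] by (cases "d < u0") auto
qed

lemma nondegenerate:
  assumes "d \<noteq> u0" "0 \<le> s" shows "U d s - u0 \<noteq> 0 \<or> B d s \<noteq> 0"
  using stationary(1)[of u0 s d "X d s"] assms G_zero by (auto simp: flow_eq)

text \<open>At a first zero of \<open>U\<close> the curve is not horizontal, since it would be at
  rest, and not rising, since it comes from above; so it descends. Below 0 the angle no longer
  changes, the curve follows a descending line for ever, and a later horizontal point such as
  \<open>s1\<close> is impossible.\<close>

lemma U_pos_before:
  assumes d: "0 < d" "d \<noteq> u0" and s1: "B d s1 = 0" "0 \<le> s" "s \<le> s1"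
  shows "0 < U d s"
proof (rule ccontr)
  assume neg: "\<not> 0 < U d s"
  define Z where "Z = {0..s1} \<inter> U d -` {..0}"
  have "closed Z" unfolding Z_def by (intro continuous_closed_preimage continuous_XUB) auto
  moreover have "s \<in> Z" using neg s1 by (auto simp: Z_def)
  moreover have bZ: "bdd_below Z" by (rule bdd_belowI[of _ 0]) (auto simp: Z_def)
  ultimately have m: "Inf Z \<in> Z" by (intro closed_contains_Inf) auto
  define t where "t = Inf Z"
  have t: "0 \<le> t" "t \<le> s1" "U d t \<le> 0" using m by (auto simp: Z_def t_def)
  then have t0: "0 < t" using d by (cases "t = 0") auto
  have before: "0 < U d r" if "0 \<le> r" "r < t" for r
  proof (rule ccontr)
    assume "\<not> 0 < U d r"
    then have "r \<in> Z" using that t by (auto simp: Z_def)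
    then show False using cInf_lower[OF _ bZ] that by (force simp: t_def)
  qed
  have Ut: "U d t = 0"
  proof (rule ccontr)
    assume "U d t \<noteq> 0"
    then have "U d t < 0" using t by simp
    then obtain r where "0 \<le> r" "r \<le> t" "U d r = 0"
      using IVT2'[of "U d" t 0 0] t d continuous_XUB by auto
    then show False using before[of r] \<open>U d t < 0\<close> by (cases "r = t") auto
  qed
  have "B d t \<noteq> 0" using not_stationary[OF d t(1)] Ut G_zero by auto
  moreover have "\<not> B d t > 0"
  proof
    assume "B d t > 0"
    then obtain e where e: "e > 0" "\<And>h. 0 < h \<Longrightarrow> h < e \<Longrightarrow> U d (t - h) < U d t"
      using DERIV_pos_inc_left[OF deriv_U S_pos] by blast
    define h where "h = min (e/2) t"
    have "0 < h" "h < e" "h \<le> t" using e t0 by (auto simp: h_def)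
    then show False using e(2)[of h] before[of "t - h"] Ut by auto
  qed
  ultimately have neg: "B d t < 0" by simp
  let ?\<beta> = "B d t"
  let ?y = "\<lambda>r. (X d t + C ?\<beta> * (r - t), S ?\<beta> * (r - t), ?\<beta>)"
  have "?y t = flow d t \<longleftrightarrow> ?y s1 = flow d s1"
  proof (rule solution_unique)
    fix r assume r: "t < r" "r < s1"
    have "G (S ?\<beta> * (r - t)) = 0"
      using r S_neg[OF neg] by (intro G_zero) (simp add: mult_nonpos_nonneg)
    then have "V (?y r) = (C ?\<beta>, S ?\<beta>, 0)" by (simp add: V_def)
    then show "(?y has_vector_derivative V (?y r)) (at r)"
      by (auto intro!: has_vector_derivative_Pair derivative_eq_intros
          simp: has_real_derivative_iff_has_vector_derivative[symmetric])
  qed (use t in \<open>auto intro!: continuous_intros\<close>)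
  moreover have "?y t = flow d t" by (simp add: flow_eq Ut)
  ultimately have "?y s1 = flow d s1" by blast
  then have "B d s1 = ?\<beta>" by (simp add: B_def) (metis snd_conv)
  then show False using neg s1 by simp
qed

section \<open>The clockwise winding angle around the equilibrium\<close>

definition \<omega> :: "real \<Rightarrow> real \<Rightarrow> real" where
  "\<omega> d s = (A (X d s) * G (U d s) * (U d s - u0) + B d s * S (B d s)) / ((U d s - u0)\<^sup>2 + (B d s)\<^sup>2)"

definition \<Theta> :: "real \<Rightarrow> real \<Rightarrow> real" where "\<Theta> d s = integral {0..s} (\<omega> d)"

lemma G_sign: "G u * (u - u0) \<ge> 0"
proof -
  consider "u \<le> 0" | "0 < u" "u < u0" | "u = u0" | "u0 < u" by linarith
  then show ?thesis
    using G_neg[of u] G_pos[of u] G_zero by cases (auto intro: mult_nonpos_nonpos)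
qed

lemma G_sign_pos: "G u \<noteq> 0 \<Longrightarrow> G u * (u - u0) > 0"
  using G_sign[of u] G_zero(2) by (cases "u = u0") (auto simp: less_le)

lemma BS_nonneg: "\<beta> * S \<beta> \<ge> 0"
  using S_pos[of \<beta>] S_neg[of \<beta>] by (cases \<beta> "0::real" rule: linorder_cases) (auto intro: mult_nonpos_nonpos)

lemma BS_pos: "\<beta> \<noteq> 0 \<Longrightarrow> \<beta> * S \<beta> > 0"
  using S_pos[of \<beta>] S_neg[of \<beta>] by (cases \<beta> "0::real" rule: linorder_cases) (auto intro: mult_neg_neg)

lemma denom_pos: "d \<noteq> u0 \<Longrightarrow> 0 \<le> s \<Longrightarrow> (U d s - u0)\<^sup>2 + (B d s)\<^sup>2 > 0"
  using nondegenerate[of d s] by (auto simp: sum_power2_gt_zero_iff)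

lemma \<omega>_nonneg: "d \<noteq> u0 \<Longrightarrow> 0 \<le> s \<Longrightarrow> \<omega> d s \<ge> 0"
  unfolding \<omega>_def using denom_pos[of d s] G_sign[of "U d s"] BS_nonneg[of "B d s"] A_bd(1)[of "X d s"]
  by (auto simp: mult.assoc intro!: divide_nonneg_pos add_nonneg_nonneg)

text \<open>Both terms of the numerator are nonnegative, because \<open>G u\<close> never has the
  sign opposite to \<open>u - u0\<close> and \<open>S\<close> has the sign of its argument. They
  vanish together only at rest states, and a start with \<open>0 < d \<noteq> u0\<close> never meets
  one.\<close>

lemma \<omega>_pos:
  assumes "0 < d" "d \<noteq> u0" "0 \<le> s" shows "\<omega> d s > 0"
proof -
  have "A (X d s) * (G (U d s) * (U d s - u0)) + B d s * S (B d s) > 0"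
  proof (cases "B d s = 0")
    case True
    then show ?thesis using not_stationary[OF assms] G_sign_pos[of "U d s"] A_bd(1) by simp
  next
    case False
    have "A (X d s) * (G (U d s) * (U d s - u0)) \<ge> 0"
      using A_bd(1)[of "X d s"] G_sign[of "U d s"] by simp
    then show ?thesis using BS_pos[OF False] by simp
  qed
  then show ?thesis unfolding \<omega>_def using denom_pos[OF assms(2,3)] by (simp add: mult.assoc)
qed

lemma continuous_\<omega>: "d \<noteq> u0 \<Longrightarrow> continuous_on {0..T} (\<omega> d)"
  unfolding \<omega>_def using denom_pos[of d] by (intro continuous_intros) force+

lemma \<Theta>_0 [simp]: "\<Theta> d 0 = 0" by (simp add: \<Theta>_def)

lemma continuous_\<Theta>: "d \<noteq> u0 \<Longrightarrow> Y \<subseteq> {0..} \<Longrightarrow> bounded Y \<Longrightarrow> continuous_on Y (\<Theta> d)"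
proof -
  assume d: "d \<noteq> u0" and Y: "Y \<subseteq> {0..}" "bounded Y"
  obtain T where "\<And>y. y \<in> Y \<Longrightarrow> \<bar>y\<bar> \<le> T" using Y(2) by (auto simp: bounded_iff)
  then have "Y \<subseteq> {0..T}" using Y(1) by force
  moreover have "continuous_on {0..T} (\<Theta> d)"
    unfolding \<Theta>_def by (intro indefinite_integral_continuous_1 integrable_continuous_real continuous_\<omega> d)
  ultimately show ?thesis by (rule continuous_on_subset[rotated])
qed

lemma deriv_\<Theta>: "d \<noteq> u0 \<Longrightarrow> 0 < s \<Longrightarrow> (\<Theta> d has_real_derivative \<omega> d s) (at s)"
proof -
  assume d: "d \<noteq> u0" and s: "0 < s"
  have "(\<Theta> d has_real_derivative \<omega> d s) (at s within {0..s+1})"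
    unfolding \<Theta>_def[abs_def] using continuous_\<omega>[OF d] s by (intro integral_has_real_derivative) auto
  then show ?thesis using s at_within_interior[of s "{0..s+1}"] by simp
qed

lemma \<Theta>_mono:
  assumes "d \<noteq> u0" "0 \<le> s" "s \<le> t"
  shows "\<Theta> d s \<le> \<Theta> d t"
proof (rule DERIV_nonneg_imp_increasing_open[of s t "\<Theta> d"])
  fix r assume "s < r" "r < t"
  then have r: "0 < r" using \<open>0 \<le> s\<close> by simp
  have "0 \<le> \<omega> d r" using \<omega>_nonneg[OF \<open>d \<noteq> u0\<close>] r by simp
  then show "\<exists>y. (\<Theta> d has_real_derivative y) (at r) \<and> 0 \<le> y"
    using deriv_\<Theta>[OF \<open>d \<noteq> u0\<close> r] by blast
next
  show "continuous_on {s..t} (\<Theta> d)" using \<open>0 \<le> s\<close> \<open>d \<noteq> u0\<close> by (intro continuous_\<Theta>) auto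
qed (use assms in auto)

lemma \<Theta>_strict_mono:
  assumes "0 < d" "d \<noteq> u0" "0 \<le> s" "s < t"
  shows "\<Theta> d s < \<Theta> d t"
proof (rule DERIV_pos_imp_increasing_open[of s t "\<Theta> d"])
  fix r assume "s < r" "r < t"
  then have r: "0 < r" using \<open>0 \<le> s\<close> by simp
  have "0 < \<omega> d r" using \<omega>_pos[OF \<open>0 < d\<close> \<open>d \<noteq> u0\<close>] r by simp
  then show "\<exists>y. (\<Theta> d has_real_derivative y) (at r) \<and> 0 < y"
    using deriv_\<Theta>[OF \<open>d \<noteq> u0\<close> r] by blast
next
  show "continuous_on {s..t} (\<Theta> d)" using \<open>0 \<le> s\<close> \<open>d \<noteq> u0\<close> by (intro continuous_\<Theta>) auto
qed (use assms in auto)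

lemma polar:
  assumes "d \<noteq> u0"
  obtains P where "\<And>s. 0 \<le> s \<Longrightarrow> s \<le> T \<Longrightarrow> U d s - u0 = P s * cos (\<Theta> d s)"
    "\<And>s. 0 \<le> s \<Longrightarrow> s \<le> T \<Longrightarrow> B d s = - P s * sin (\<Theta> d s)"
    "\<And>s. 0 \<le> s \<Longrightarrow> s \<le> T \<Longrightarrow> (d - u0) * P s > 0"
proof (rule polar_form[of T "\<lambda>s. U d s - u0" "\<lambda>s. S (B d s)" "B d" "\<lambda>s. - (A (X d s) * G (U d s))" "\<Theta> d"])
  fix s assume s: "0 < s" "s < T"
  show "((\<lambda>s. U d s - u0) has_real_derivative S (B d s)) (at s)"
    by (auto intro!: derivative_eq_intros deriv_U)
  show "(B d has_real_derivative - (A (X d s) * G (U d s))) (at s)" by (rule deriv_B)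
  show "(\<Theta> d has_real_derivative (B d s * S (B d s) - (U d s - u0) * - (A (X d s) * G (U d s))) /
      ((U d s - u0)\<^sup>2 + (B d s)\<^sup>2)) (at s)"
    using deriv_\<Theta>[OF assms s(1)] by (simp add: \<omega>_def algebra_simps)
next
  fix s assume "s \<in> {0..T}"
  then show "U d s - u0 \<noteq> 0 \<or> B d s \<noteq> 0" using nondegenerate[OF assms] by simp
qed (use assms in \<open>auto intro!: continuous_intros continuous_\<Theta> that\<close>)

lemma B_zero_angle: "d \<noteq> u0 \<Longrightarrow> 0 \<le> s \<Longrightarrow> \<Theta> d s = real n * pi \<Longrightarrow> B d s = 0"
  by (rule polar[of d s]) auto

lemma continuous_in_d:
  assumes D: "u0 \<notin> D" and s: "0 \<le> s"
  shows "continuous_on D (\<lambda>d. X d s)" "continuous_on D (\<lambda>d. \<Theta> d s)"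
proof -
  have "continuous_on D (\<lambda>d. flow d s)"
    by (rule lipschitz_on_continuous_on[of "exp (L * s)"])
       (use flow_lipschitz[of s s] s in \<open>auto simp: lipschitz_on_def dist_norm\<close>)
  then show "continuous_on D (\<lambda>d. X d s)" unfolding X_def by (intro continuous_intros)
  have c: "continuous_on (D \<times> {0..s}) (\<lambda>p. flow (fst p) (snd p))"
    using continuous_flow2[of D s] by (simp add: case_prod_beta)
  have "continuous_on D (\<lambda>d. integral (cbox 0 s) (\<omega> d))"
  proof (rule integral_continuous_on_param)
    have "(U d r - u0)\<^sup>2 + (B d r)\<^sup>2 \<noteq> 0" if "d \<in> D" "r \<in> {0..s}" for d r
      using denom_pos[of d r] that D by force
    then show "continuous_on (D \<times> cbox 0 s) (\<lambda>(d, t). \<omega> d t)"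
      unfolding \<omega>_def case_prod_beta
      by (intro continuous_intros) (use c in \<open>auto simp: U_def X_def B_def intro!: continuous_intros\<close>)
  qed
  then show "continuous_on D (\<lambda>d. \<Theta> d s)" by (simp add: \<Theta>_def)
qed

lemma angle_zero: "0 \<le> s \<Longrightarrow> \<Theta> 0 s = 0"
proof -
  assume s: "0 \<le> s"
  have "\<omega> 0 t = 0" if "t \<in> {0..s}" for t
    using stationary(2,3)[of 0 t] G_zero(1)[of 0] that by (simp add: \<omega>_def)
  then have "integral {0..s} (\<omega> 0) = integral {0..s} (\<lambda>_. 0)" by (intro integral_cong) auto
  then show ?thesis by (simp add: \<Theta>_def)
qed

text \<open>Shooting: the initial values whose curve makes \<open>n\<close> half turns before reaching
  \<open>x = 1\<close>, and those whose curve does not, form disjoint relatively open sets if no curve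
  completes the \<open>n\<close>-th half turn exactly at \<open>x = 1\<close>.\<close>

lemma shooting:
  assumes D: "connected D" "D \<subseteq> {0..}" "u0 \<notin> D" and n: "n \<ge> 1"
    and d1: "d1 \<in> D" "s1 \<ge> 0" "X d1 s1 < 1" "\<Theta> d1 s1 > real n * pi"
    and d2: "d2 \<in> D" "\<And>s. s \<ge> 0 \<Longrightarrow> X d2 s \<le> 1 \<Longrightarrow> \<Theta> d2 s < real n * pi"
    and bd: "\<And>d s. d \<in> D \<Longrightarrow> s \<ge> 0 \<Longrightarrow> B d s = 0 \<Longrightarrow> X d s \<le> 1 \<Longrightarrow> s \<le> K"
  obtains d s where "d \<in> D" "0 < d" "s > 0" "X d s = 1" "\<Theta> d s = real n * pi"
proof (rule ccontr)
  assume no: "\<not> thesis"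
  let ?N = "real n * pi"
  have N: "?N > 0" using n by simp
  define O1 where "O1 = (\<Union>s\<in>{0..}. (D \<inter> (\<lambda>d. X d s) -` {..<1}) \<inter> (D \<inter> (\<lambda>d. \<Theta> d s) -` {?N<..}))"
  \<comment> \<open>A curve may also stay behind by running vertically without ever passing
    \<open>x = 1\<close>. It is then recognised at a late time: after \<open>K\<close> there is no
    horizontal point with \<open>x \<le> 1\<close>, whereas completing a half turn produces a
    horizontal point.\<close>
  define O2 where "O2 = (\<Union>s\<in>{0..}. (D \<inter> (\<lambda>d. X d s) -` {1<..}) \<inter> (D \<inter> (\<lambda>d. \<Theta> d s) -` {..<?N}))
     \<union> (\<Union>s\<in>{s. s \<ge> 0 \<and> s > K}. D \<inter> (\<lambda>d. \<Theta> d s) -` {..<?N})"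
  have oX: "openin (top_of_set D) (D \<inter> (\<lambda>d. X d s) -` W)" if "0 \<le> s" "open W" for s W
    by (rule continuous_openin_preimage_gen[OF continuous_in_d(1)[OF D(3) that(1)] that(2)])
  have o\<Theta>: "openin (top_of_set D) (D \<inter> (\<lambda>d. \<Theta> d s) -` W)" if "0 \<le> s" "open W" for s W
    by (rule continuous_openin_preimage_gen[OF continuous_in_d(2)[OF D(3) that(1)] that(2)])
  have o1: "openin (top_of_set D) O1"
    unfolding O1_def by (rule openin_Union, clarify, intro openin_Int oX o\<Theta>) auto
  have o2: "openin (top_of_set D) O2"
    unfolding O2_def
    by (rule openin_Un; rule openin_Union, clarify; intro openin_Int oX o\<Theta>) auto
  have u0D: "d \<noteq> u0" if "d \<in> D" for d using D that by auto
  have hit: "\<exists>t. 0 \<le> t \<and> t \<le> s \<and> \<Theta> d t = ?N" if "d \<in> D" "0 \<le> s" "?N \<le> \<Theta> d s" for d s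
  proof -
    have "continuous_on {0..s} (\<Theta> d)" by (rule continuous_\<Theta>[OF u0D[OF that(1)]]) auto
    then show ?thesis using IVT'[of "\<Theta> d" 0 ?N s] that N by simp
  qed
  have cover: "D \<subseteq> O1 \<union> O2"
  proof
    fix d assume d: "d \<in> D"
    define S' where "S' = max 0 K + 1"
    show "d \<in> O1 \<union> O2"
    proof (cases "\<Theta> d S' < ?N")
      case True
      then have "d \<in> O2" unfolding O2_def using d
        by (intro UnI2 UN_I[of S']) (auto simp: S'_def)
      then show ?thesis by simp
    next
      case False
      then obtain t where t: "0 \<le> t" "\<Theta> d t = ?N" using hit[OF d, of S'] by (auto simp: S'_def)
      have "d \<ge> 0" using D(2) d by auto
      moreover have "d \<noteq> 0" using angle_zero[OF t(1)] t(2) N by force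
      ultimately have d0: "d > 0" by simp
      have t0: "t > 0" using t N by (cases "t = 0") auto
      \<comment> \<open>At the time \<open>t\<close> of the \<open>n\<close>-th half turn the curve
        is strictly on one side of \<open>x = 1\<close>. Moving \<open>t\<close> slightly forward if
        it is still before 1, or slightly backward if it is beyond, keeps the side and makes the
        inequality for the angle strict.\<close>
      have "X d t \<noteq> 1" using no that[OF d d0 t0 _ t(2)] by blast
      then consider "X d t < 1" | "X d t > 1" by linarith
      then show ?thesis
      proof cases
        case 1
        have "continuous (at t) (X d)" using deriv_X DERIV_isCont by blast
        then have "\<forall>\<^sub>F r in at t. X d r < 1" using 1 by (auto simp: isCont_def intro: order_tendstoD)
        then obtain e where e: "e > 0" "\<And>r. r \<noteq> t \<Longrightarrow> dist r t < e \<Longrightarrow> X d r < 1"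
          by (auto simp: eventually_at)
        have "X d (t + e/2) < 1" using e by (intro e(2)) (auto simp: dist_real_def)
        moreover have "\<Theta> d (t + e/2) > ?N"
          using \<Theta>_strict_mono[OF d0 u0D[OF d] t(1), of "t + e/2"] e t by simp
        ultimately have "d \<in> O1" unfolding O1_def using d t e
          by (intro UN_I[of "t + e/2"]) auto
        then show ?thesis by simp
      next
        case 2
        have "continuous (at t) (X d)" using deriv_X DERIV_isCont by blast
        then have "\<forall>\<^sub>F r in at t. 1 < X d r" using 2 by (auto simp: isCont_def intro: order_tendstoD)
        then obtain e where e: "e > 0" "\<And>r. r \<noteq> t \<Longrightarrow> dist r t < e \<Longrightarrow> 1 < X d r"
          by (auto simp: eventually_at)
        define r where "r = max (t/2) (t - e/2)"
        have r: "0 \<le> r" "r < t" "dist r t < e" using e t0 by (auto simp: r_def dist_real_def)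
        have "1 < X d r" using e r by auto
        moreover have "\<Theta> d r < ?N"
          using \<Theta>_strict_mono[OF d0 u0D[OF d] r(1,2)] t by simp
        ultimately have "d \<in> O2" unfolding O2_def using d r
          by (intro UnI1 UN_I[of r]) auto
        then show ?thesis by simp
      qed
    qed
  qed
  have disj: "O1 \<inter> O2 = {}"
  proof (rule ccontr)
    assume "O1 \<inter> O2 \<noteq> {}"
    then obtain d s r where d: "d \<in> D" and s: "s \<ge> 0" "X d s < 1" "\<Theta> d s > ?N"
      and r: "r \<ge> 0" "\<Theta> d r < ?N" "X d r > 1 \<or> r > K"
      by (auto simp: O1_def O2_def)
    \<comment> \<open>The angle is monotone, so the witness \<open>r\<close> of \<open>O2\<close>
      precedes the witness \<open>s\<close> of \<open>O1\<close>. Its abscissa is then below 1, so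
      it must be a late one; but the half turn in between happens before \<open>K\<close>, hence
      before \<open>r\<close>.\<close>
    have rs: "r < s" using \<Theta>_mono[OF u0D[OF d] s(1), of r] s r by (cases "r < s") auto
    then have "r > K" using X_mono[of r s d] s r by auto
    obtain t where t: "0 \<le> t" "t \<le> s" "\<Theta> d t = ?N" using hit[OF d s(1)] s by auto
    have "B d t = 0" using B_zero_angle[OF u0D[OF d] t(1,3)] .
    moreover have "X d t \<le> 1" using X_mono[OF t(2), of d] s by simp
    ultimately have "t \<le> K" using bd[OF d t(1)] by simp
    then have "\<Theta> d t \<le> \<Theta> d r" using \<Theta>_mono[OF u0D[OF d] t(1)] \<open>r > K\<close> by simp
    then show False using t r by simp
  qed
  have ne1: "O1 \<noteq> {}" using d1 by (auto simp: O1_def)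
  have ne2: "O2 \<noteq> {}"
  proof -
    have "d2 \<notin> O1" using d2(2) by (force simp: O1_def)
    then show ?thesis using cover d2(1) by auto
  qed
  have "O1 \<subseteq> D" "O2 \<subseteq> D" by (auto simp: O1_def O2_def)
  then show False using D(1) o1 o2 cover disj ne1 ne2 unfolding connected_openin by blast
qed

end

section \<open>Rotation near the equilibrium and energy\<close>

lemma x_cos_le_sin: "0 \<le> x \<Longrightarrow> x \<le> pi \<Longrightarrow> x * cos x \<le> sin (x::real)"
proof -
  assume x: "0 \<le> x" "x \<le> pi"
  have "sin 0 - 0 * cos 0 \<le> sin x - x * cos x"
  proof (rule DERIV_nonneg_imp_nondecreasing[OF x(1)])
    fix t assume "0 \<le> t" "t \<le> x"
    then have "0 \<le> t * sin t" using x by (intro mult_nonneg_nonneg sin_ge_zero) auto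
    then show "\<exists>y. ((\<lambda>x. sin x - x * cos x) has_real_derivative y) (at t) \<and> 0 \<le> y"
      by (intro exI[of _ "t * sin t"]) (auto intro!: derivative_eq_intros)
  qed
  then show ?thesis by simp
qed

text \<open>This bounds the term \<open>B * S B\<close> of the angular speed from below by
  \<open>C B * B\<^sup>2\<close>, the form that it has in the linearised problem when time is
  arclength.\<close>

lemma x_sin_ge: "\<bar>x\<bar> \<le> pi \<Longrightarrow> x * sin x \<ge> cos x * (x::real)\<^sup>2"
proof -
  assume x: "\<bar>x\<bar> \<le> pi"
  have "\<bar>x\<bar> * (\<bar>x\<bar> * cos \<bar>x\<bar>) \<le> \<bar>x\<bar> * sin \<bar>x\<bar>"
    using x_cos_le_sin[of "\<bar>x\<bar>"] x by (intro mult_left_mono) auto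
  then show ?thesis by (cases "x \<ge> 0") (auto simp: power2_eq_square algebra_simps)
qed

context curvature_flow
begin

lemma flow_near_u0:
  assumes "0 \<le> s" "s \<le> T" "\<bar>d - u0\<bar> * exp (L * T) < e"
  shows "\<bar>U d s - u0\<bar> < e" "\<bar>B d s\<bar> < e"
proof -
  have "flow d s - flow u0 s = (X d s - X u0 s, U d s - u0, B d s)"
    using stationary(2,3)[OF G_zero(2) assms(1)] by (simp add: flow_eq)
  then have n: "norm (X d s - X u0 s, U d s - u0, B d s) < e"
    using flow_lipschitz[OF assms(1,2), of d u0] assms(3) by (simp add: mult.commute)
  have "norm (U d s - u0, B d s) \<le> norm (X d s - X u0 s, U d s - u0, B d s)" by (rule norm_snd_le)
  moreover have "norm (U d s - u0) \<le> norm (U d s - u0, B d s)" by (rule norm_fst_le)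
  moreover have "norm (B d s) \<le> norm (U d s - u0, B d s)" by (rule norm_snd_le)
  ultimately show "\<bar>U d s - u0\<bar> < e" "\<bar>B d s\<bar> < e" using n by auto
qed

text \<open>The angle of the eigenfunction, read along the curve as \<open>\<theta> (X d s)\<close>,
  turns at \<open>C (B d s)\<close> times its speed in \<open>x\<close>. Near \<open>u0\<close> the
  curve turns faster, because \<open>G u / (u - u0)\<close> exceeds \<open>\<mu> > lam\<close>
  there, and the comparison of angles applies in arclength.\<close>

lemma rotation_near_u0:
  assumes lam: "lam \<ge> 0"
    and \<theta>: "\<theta> 0 = 0" "continuous_on {0..1} \<theta>" "\<theta> 1 \<ge> real k * pi"
      "\<And>x. x \<in> {0<..<1} \<Longrightarrow> (\<theta> has_real_derivative lam * A x * (cos (\<theta> x))\<^sup>2 + (sin (\<theta> x))\<^sup>2) (at x)"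
    and g: "(G has_real_derivative g) (at u0)" "lam < g"
  obtains \<delta> where "\<delta> > 0"
    "\<And>d. d \<noteq> u0 \<Longrightarrow> \<bar>d - u0\<bar> < \<delta> \<Longrightarrow> \<exists>s\<ge>0. X d s < 1 \<and> \<Theta> d s > real k * pi"
proof -
  define \<mu> where "\<mu> = (lam + g) / 2"
  have \<mu>: "lam < \<mu>" "\<mu> < g" using g(2) by (auto simp: \<mu>_def)
  have "((\<lambda>u. (G u - G u0) / (u - u0)) \<longlongrightarrow> g) (at u0)" using g(1) by (simp add: has_field_derivative_iff)
  then have "\<forall>\<^sub>F u in at u0. \<mu> < (G u - G u0) / (u - u0)" using \<mu>(2) by (rule order_tendstoD)
  then obtain e where e: "e > 0" "\<And>u. u \<noteq> u0 \<Longrightarrow> dist u u0 < e \<Longrightarrow> \<mu> < (G u - G u0) / (u - u0)"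
    by (auto simp: eventually_at)
  have Gmu: "G u * (u - u0) \<ge> \<mu> * (u - u0)\<^sup>2" if "\<bar>u - u0\<bar> < e" for u
  proof (cases "u = u0")
    case False
    then have "\<mu> < G u / (u - u0)" using e(2)[OF False] that G_zero by (simp add: dist_real_def)
    then have "\<mu> * (u - u0)\<^sup>2 \<le> G u / (u - u0) * (u - u0)\<^sup>2" by (intro mult_right_mono) auto
    then show ?thesis using False by (simp add: power2_eq_square)
  qed auto
  have "continuous_on {0..1} A" by (intro continuous_intros)
  then obtain x0 where x0: "x0 \<in> {0..1}" "\<And>x. x \<in> {0..1} \<Longrightarrow> A x0 \<le> A x"
    using continuous_attains_inf[of "{0..1::real}" A] by auto
  \<comment> \<open>Within this distance of the equilibrium the slope bound for \<open>G\<close>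
    holds, the angle is not clamped, and \<open>C \<ge> 1/2\<close>, so that \<open>x = 1\<close> is
    reached by time 2. The definition of \<open>\<delta>\<close> divides by the growth factor of the
    flow up to that time.\<close>
  define e' where "e' = min e (min b (pi/3))"
  have e': "e' > 0" "e' \<le> e" "e' \<le> b" "e' \<le> pi/3" using e b by (auto simp: e'_def)
  define \<delta> where "\<delta> = e' * exp (- (L * 2))"
  have "\<exists>s\<ge>0. X d s < 1 \<and> \<Theta> d s > real k * pi" if d: "d \<noteq> u0" "\<bar>d - u0\<bar> < \<delta>" for d
  proof -
    have "\<bar>d - u0\<bar> * exp (L * 2) < \<delta> * exp (L * 2)" using d by simp
    also have "\<dots> = e'" by (simp add: \<delta>_def mult.assoc exp_add[symmetric])
    finally have dd: "\<bar>d - u0\<bar> * exp (L * 2) < e'" .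
    have UB: "\<bar>U d s - u0\<bar> < e'" "\<bar>B d s\<bar> < e'" if "0 \<le> s" "s \<le> 2" for s
      using flow_near_u0[OF that dd] by auto
    have CB: "C (B d s) = cos (B d s)" "C (B d s) \<ge> 1/2" "S (B d s) = sin (B d s)" if "0 \<le> s" "s \<le> 2" for s
    proof -
      have 1: "\<bar>B d s\<bar> < e'" using UB(2)[OF that] .
      then have 2: "cl (B d s) = B d s" using e' by (intro cl_id) auto
      show "C (B d s) = cos (B d s)" "S (B d s) = sin (B d s)" by (simp_all add: C_def S_def 2)
      have "cos (pi/3) \<le> cos \<bar>B d s\<bar>" using 1 e' by (subst cos_mono_le_eq) auto
      then show "C (B d s) \<ge> 1/2" by (simp add: C_def 2 cos_60)
    qed
    have Xinc: "X d s - X d r \<ge> (s - r) / 2" if "0 \<le> r" "r \<le> s" "s \<le> 2" for r s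
    proof -
      have "X d r - r / 2 \<le> X d s - s / 2"
      proof (rule DERIV_nonneg_imp_nondecreasing[OF that(2)])
        fix t assume "r \<le> t" "t \<le> s"
        then have "C (B d t) \<ge> 1/2" using that by (intro CB) auto
        then show "\<exists>y. ((\<lambda>s. X d s - s / 2) has_real_derivative y) (at t) \<and> 0 \<le> y"
          by (intro exI[of _ "C (B d t) - 1/2"]) (auto intro!: derivative_eq_intros deriv_X)
      qed
      then show ?thesis by (simp add: diff_divide_distrib)
    qed
    obtain s1 where s1: "0 \<le> s1" "s1 \<le> 2" "X d s1 = 1"
      using IVT'[of "X d" 0 1 2] Xinc[of 0 2] continuous_XUB(1) by auto
    have s1p: "0 < s1" using s1 by (cases "s1 = 0") auto
    have X01: "0 < X d s \<and> X d s < 1" if "0 < s" "s < s1" for s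
      using Xinc[of 0 s] Xinc[of s s1] that s1 by auto
    obtain P where P: "\<And>s. 0 \<le> s \<Longrightarrow> s \<le> s1 \<Longrightarrow> U d s - u0 = P s * cos (\<Theta> d s)"
      "\<And>s. 0 \<le> s \<Longrightarrow> s \<le> s1 \<Longrightarrow> B d s = - P s * sin (\<Theta> d s)"
      "\<And>s. 0 \<le> s \<Longrightarrow> s \<le> s1 \<Longrightarrow> (d - u0) * P s > 0"
      using polar[OF d(1), of s1] by metis
    have "\<Theta> d s1 > \<theta> (X d s1)"
    proof (rule angle_comparison[where ?\<theta>1.0="\<Theta> d" and ?\<theta>2.0="\<lambda>s. \<theta> (X d s)" and ?d1.0="\<omega> d"
          and g="\<lambda>s. C (B d s) * (lam * A (X d s))" and h="\<lambda>s. C (B d s)" and \<kappa>="(\<mu> - lam) * A x0"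
          and M="max 1 (lam * MA)"])
      fix s assume s: "0 < s" "s < s1"
      show "(\<Theta> d has_real_derivative \<omega> d s) (at s)" by (rule deriv_\<Theta>[OF d(1) s(1)])
      have "(\<theta> has_real_derivative lam * A (X d s) * (cos (\<theta> (X d s)))\<^sup>2 + (sin (\<theta> (X d s)))\<^sup>2) (at (X d s))"
        using X01[OF s] by (intro \<theta>(4)) auto
      from DERIV_chain2[OF this deriv_X]
      show "((\<lambda>s. \<theta> (X d s)) has_real_derivative C (B d s) * (lam * A (X d s)) * (cos (\<theta> (X d s)))\<^sup>2
          + C (B d s) * (sin (\<theta> (X d s)))\<^sup>2) (at s)"
        by (simp add: algebra_simps)
      have la: "0 \<le> lam * A (X d s)" "lam * A (X d s) \<le> lam * MA"
        using lam A_bd[of "X d s"] by (auto intro!: mult_left_mono)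
      show "\<bar>C (B d s) * (lam * A (X d s))\<bar> \<le> max 1 (lam * MA)"
        using mult_mono[OF C_bd(2)[of "B d s"] la(2)] la(1) abs_of_nonneg[OF mult_nonneg_nonneg[OF C_bd(1)[of "B d s"] la(1)]]
        by simp
      show "\<bar>C (B d s)\<bar> \<le> max 1 (lam * MA)" using C_bd[of "B d s"] by simp
      have ss: "0 \<le> s" "s \<le> s1" "s \<le> 2" using s s1 by auto
      have Pn: "(P s)\<^sup>2 > 0" using P(3)[OF ss(1,2)] by auto
      let ?c = "(cos (\<Theta> d s))\<^sup>2" and ?s = "(sin (\<Theta> d s))\<^sup>2"
      have "\<mu> * (U d s - u0)\<^sup>2 \<le> G (U d s) * (U d s - u0)"
        using UB(1)[OF ss(1,3)] e' by (intro Gmu) simp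
      then have "A (X d s) * (\<mu> * (U d s - u0)\<^sup>2) \<le> A (X d s) * (G (U d s) * (U d s - u0))"
        using A_bd(1) by (simp add: less_imp_le)
      moreover have "(U d s - u0)\<^sup>2 = (P s)\<^sup>2 * ?c" "(B d s)\<^sup>2 = (P s)\<^sup>2 * ?s"
        by (simp_all add: P(1,2)[OF ss(1,2)] power_mult_distrib)
      moreover have "C (B d s) * (B d s)\<^sup>2 \<le> B d s * S (B d s)"
        unfolding CB(1,3)[OF ss(1,3)] using UB(2)[OF ss(1,3)] e' pi_gt_zero by (intro x_sin_ge) linarith
      ultimately have num: "(P s)\<^sup>2 * (A (X d s) * \<mu> * ?c + C (B d s) * ?s)
          \<le> A (X d s) * G (U d s) * (U d s - u0) + B d s * S (B d s)"
        by (simp add: algebra_simps)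
      have den: "(U d s - u0)\<^sup>2 + (B d s)\<^sup>2 = (P s)\<^sup>2"
      proof -
        have "(U d s - u0)\<^sup>2 + (B d s)\<^sup>2 = (P s)\<^sup>2 * ?c + (P s)\<^sup>2 * ?s"
          by (simp add: P(1,2)[OF ss(1,2)] power_mult_distrib)
        also have "\<dots> = (P s)\<^sup>2" unfolding distrib_left[symmetric] by simp
        finally show ?thesis .
      qed
      have om: "A (X d s) * \<mu> * ?c + C (B d s) * ?s \<le> \<omega> d s"
        unfolding \<omega>_def den using num Pn by (simp add: pos_le_divide_eq mult.commute)
      \<comment> \<open>Using \<open>C \<le> 1\<close> in the term with \<open>lam\<close> leaves
        the whole excess of \<open>\<mu>\<close> over \<open>lam\<close> for the constant
        \<open>\<kappa>\<close>.\<close>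
      have "C (B d s) * (lam * A (X d s)) \<le> 1 * (lam * A (X d s))"
        using la C_bd by (intro mult_right_mono) auto
      moreover have "(\<mu> - lam) * A x0 \<le> (\<mu> - lam) * A (X d s)"
        using \<mu> x0(2)[of "X d s"] X01[OF s] by (intro mult_left_mono) auto
      ultimately have "C (B d s) * (lam * A (X d s)) + (\<mu> - lam) * A x0 \<le> A (X d s) * \<mu>"
        by (simp add: algebra_simps)
      then have "(C (B d s) * (lam * A (X d s)) + (\<mu> - lam) * A x0) * ?c \<le> A (X d s) * \<mu> * ?c"
        by (intro mult_right_mono) auto
      then show "\<omega> d s \<ge> C (B d s) * (lam * A (X d s)) * ?c + C (B d s) * ?s + (\<mu> - lam) * A x0 * ?c"
        using om by (simp add: algebra_simps)
    next
      show "continuous_on {0..s1} (\<Theta> d)" by (rule continuous_\<Theta>[OF d(1)]) auto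
      show "continuous_on {0..s1} (\<lambda>s. \<theta> (X d s))"
      proof (rule continuous_on_compose2[OF \<theta>(2) continuous_XUB(1)])
        show "X d ` {0..s1} \<subseteq> {0..1}" using X_mono[of _ s1 d] X_nonneg s1 by auto
      qed
      show "0 < (\<mu> - lam) * A x0" using \<mu> A_bd(1) by simp
      show "0 < s1" by (rule s1p)
      show "\<Theta> d 0 = 0" "\<theta> (X d 0) = 0" using \<theta>(1) by simp_all
    qed
    then have big: "\<Theta> d s1 > real k * pi" using s1 \<theta>(3) by simp
    \<comment> \<open>At \<open>s1\<close> the abscissa is exactly 1. A slightly earlier time
      preserves the inequality for the angle and makes the abscissa strictly smaller.\<close>
    have "isCont (\<Theta> d) s1" using deriv_\<Theta>[OF d(1) s1p] by (rule DERIV_isCont)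
    then have "\<forall>\<^sub>F r in at s1. \<Theta> d r > real k * pi" using big by (auto simp: isCont_def intro: order_tendstoD)
    then obtain h where h: "h > 0" "\<And>r. r \<noteq> s1 \<Longrightarrow> dist r s1 < h \<Longrightarrow> \<Theta> d r > real k * pi"
      by (auto simp: eventually_at)
    define r where "r = max (s1/2) (s1 - h/2)"
    have r: "0 < r" "r < s1" "dist r s1 < h" using h s1p by (auto simp: r_def dist_real_def)
    then show ?thesis using h(2)[of r] X01[of r] by (intro exI[of _ r]) auto
  qed
  moreover have "\<delta> > 0" using e' by (simp add: \<delta>_def)
  ultimately show thesis using that by blast
qed

section \<open>Kinetic and potential energy along the flow\<close>

definition H :: "real \<Rightarrow> real" where "H = (SOME H. H 0 = 0 \<and> (\<forall>x. (H has_real_derivative S x) (at x)))"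
definition F :: "real \<Rightarrow> real" where "F = (SOME F. F u0 = 0 \<and> (\<forall>x. (F has_real_derivative G x) (at x)))"

lemma H: "H 0 = 0" "(H has_real_derivative S x) (at x)"
proof -
  have "continuous_on UNIV S" using continuous_S[of UNIV "\<lambda>x. x"] by simp
  then have "\<exists>H. H 0 = 0 \<and> (\<forall>x. (H has_real_derivative S x) (at x))"
    by (metis antiderivative_real)
  from someI_ex[OF this] show "H 0 = 0" "(H has_real_derivative S x) (at x)" unfolding H_def[symmetric] by auto
qed

lemma F: "F u0 = 0" "(F has_real_derivative G x) (at x)"
proof -
  have "continuous_on UNIV G" using continuous_G[of UNIV "\<lambda>x. x"] by simp
  then have "\<exists>F. F u0 = 0 \<and> (\<forall>x. (F has_real_derivative G x) (at x))"
    by (metis antiderivative_real)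
  from someI_ex[OF this] show "F u0 = 0" "(F has_real_derivative G x) (at x)" unfolding F_def[symmetric] by auto
qed

lemma H_nonneg: "H \<beta> \<ge> 0"
proof (cases "\<beta> \<ge> 0")
  case True
  have "H 0 \<le> H \<beta>"
  proof (rule DERIV_nonneg_imp_nondecreasing[OF True])
    fix x :: real assume "0 \<le> x" "x \<le> \<beta>"
    then have "S x \<ge> 0" using S_pos[of x] by (cases "x = 0") auto
    then show "\<exists>y. (H has_real_derivative y) (at x) \<and> 0 \<le> y" using H by blast
  qed
  then show ?thesis by (simp add: H)
next
  case False
  have "H \<beta> \<ge> H 0"
  proof (rule DERIV_nonpos_imp_nonincreasing[of \<beta> 0 H])
    fix x :: real assume "\<beta> \<le> x" "x \<le> 0"
    then have "S x \<le> 0" using S_neg[of x] by (cases "x = 0") auto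
    then show "\<exists>y. (H has_real_derivative y) (at x) \<and> y \<le> 0" using H by blast
  qed (use False in simp)
  then show ?thesis by (simp add: H)
qed

lemma F_mono: "u0 \<le> u \<Longrightarrow> u < v \<Longrightarrow> F u < F v"
  by (rule DERIV_pos_imp_increasing_open[of u v F])
     (use F(2) G_pos in \<open>force intro: DERIV_continuous_on[OF has_field_derivative_at_within[OF F(2)]]\<close>)+

lemma F_antimono: "0 \<le> u \<Longrightarrow> u < v \<Longrightarrow> v \<le> u0 \<Longrightarrow> F v < F u"
  by (rule DERIV_neg_imp_decreasing_open[of u v F])
     (use F(2) G_neg in \<open>force intro: DERIV_continuous_on[OF has_field_derivative_at_within[OF F(2)]]\<close>)+

lemma F_neg: "u \<le> 0 \<Longrightarrow> F u = F 0"
proof (cases "u = 0")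
  case False
  assume "u \<le> 0"
  with False have "u < 0" by simp
  have "F 0 = F u"
  proof (rule DERIV_isconst_end[OF \<open>u < 0\<close>])
    show "(F has_real_derivative 0) (at x)" if "u < x" "x < 0" for x
      using F(2)[of x] G_zero(1)[of x] that by simp
  qed (rule DERIV_continuous_on[OF has_field_derivative_at_within[OF F(2)]])
  then show ?thesis by simp
qed auto

lemma F_nonneg: "F u \<ge> 0"
proof -
  consider "u < 0" | "0 \<le> u" "u < u0" | "u = u0" | "u > u0" by linarith
  then show ?thesis
    using F_mono[of u0 u] F_antimono[of u u0] F_antimono[of 0 u0] F_neg[of u] F(1) u0
    by cases auto
qed

text \<open>\<open>H\<close> is \<open>1 - cos\<close> up to the clamping angle and grows linearly
  beyond it, so this is the energy of a graph, continued to steeper angles.\<close>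

definition En :: "real \<Rightarrow> real \<Rightarrow> real" where "En d s = H (B d s) + A (X d s) * F (U d s)"

lemma En_ge: "A (X d s) * F (U d s) \<le> En d s" using H_nonneg by (simp add: En_def)

text \<open>The abscissa may rest at 1 during interior times, where \<open>\<phi>\<close> has only a
  one-sided derivative. The chain rule is therefore taken along the image of the curve, which stays
  in \<open>{0..1}\<close>.\<close>

lemma deriv_comp_X:
  assumes \<phi>: "\<And>x. x \<in> {0..1} \<Longrightarrow> (\<phi> has_real_derivative \<phi>' x) (at x within {0..1})"
    and s: "0 < s" "s < T" "X d T \<le> 1"
  shows "((\<lambda>s. \<phi> (X d s)) has_real_derivative \<phi>' (X d s) * C (B d s)) (at s)"
proof -
  have im: "X d ` {0..T} \<subseteq> {0..1}" using X_mono[of _ T d] X_nonneg s(3) by force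
  have "X d s \<in> {0..1}" using X_mono[of s T d] X_nonneg[of s d] s by auto
  then have "(\<phi> has_real_derivative \<phi>' (X d s)) (at (X d s) within X d ` {0..T})"
    by (rule DERIV_subset[OF \<phi> im])
  then have "(\<phi> \<circ> X d has_real_derivative \<phi>' (X d s) * C (B d s)) (at s within {0..T})"
    by (rule DERIV_image_chain[OF _ has_field_derivative_at_within[OF deriv_X]])
  then show ?thesis
    using s at_within_interior[of s "{0..T}"] by (simp add: o_def)
qed

text \<open>The exchange between kinetic and potential energy cancels. Only the explicit dependence
  on \<open>x\<close> through \<open>A\<close> remains, and the factor \<open>C\<close> switches it
  off where the curve moves vertically.\<close>

lemma deriv_En:
  assumes A': "\<And>x. x \<in> {0..1} \<Longrightarrow> (A has_real_derivative a' x) (at x within {0..1})"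
    and s: "0 < s" "s < T" "X d T \<le> 1"
  shows "(En d has_real_derivative a' (X d s) * C (B d s) * F (U d s)) (at s)"
proof -
  have "((\<lambda>s. H (B d s)) has_real_derivative S (B d s) * - (A (X d s) * G (U d s))) (at s)"
    by (rule DERIV_chain2[OF H(2) deriv_B])
  moreover have "((\<lambda>s. F (U d s)) has_real_derivative G (U d s) * S (B d s)) (at s)"
    by (rule DERIV_chain2[OF F(2) deriv_U])
  ultimately show ?thesis
    unfolding En_def using deriv_comp_X[OF assms] by (auto intro!: derivative_eq_intros simp: algebra_simps)
qed

lemma continuous_En: "continuous_on Y (En d)"
  unfolding En_def
  by (intro continuous_intros
      continuous_on_compose2[OF DERIV_continuous_on[OF has_field_derivative_at_within[OF H(2)], of UNIV]]
      continuous_on_compose2[OF DERIV_continuous_on[OF has_field_derivative_at_within[OF F(2)], of UNIV]]) auto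

end

section \<open>Energy weighted by the variation of the logarithm of the coefficient\<close>

lemma pos_neg_part: "pos_part y \<ge> 0" "neg_part y \<ge> 0" "y = pos_part y - neg_part y"
  by (auto simp: pos_part_def neg_part_def)

text \<open>\<open>N\<close> and \<open>P\<close> are the decreasing and the increasing variation of
  \<open>ln A\<close> on \<open>{0..x}\<close>.\<close>

locale curvature_flow_energy = curvature_flow +
  fixes a' N P :: "real \<Rightarrow> real"
  assumes A': "\<And>x. x \<in> {0..1} \<Longrightarrow> (A has_real_derivative a' x) (at x within {0..1})"
    and N0: "N 0 = 0" and P0: "P 0 = 0"
    and N': "\<And>x. x \<in> {0..1} \<Longrightarrow> (N has_real_derivative neg_part (a' x) / A x) (at x within {0..1})"
    and P': "\<And>x. x \<in> {0..1} \<Longrightarrow> (P has_real_derivative pos_part (a' x) / A x) (at x within {0..1})"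
begin

lemma continuous_NP: "continuous_on {0..1} N" "continuous_on {0..1} P"
  by (rule DERIV_continuous_on[OF N'] DERIV_continuous_on[OF P'], assumption)+

lemma inner_deriv:
  assumes "0 < x" "x < 1"
  shows "(A has_real_derivative a' x) (at x)" "(N has_real_derivative neg_part (a' x) / A x) (at x)"
    "(P has_real_derivative pos_part (a' x) / A x) (at x)"
  using A'[of x] N'[of x] P'[of x] assms at_within_interior[of x "{0..1}"] by auto

lemma NP_mono:
  assumes "x \<in> {0..1}" "y \<in> {0..1}" "x \<le> y" shows "N x \<le> N y" "P x \<le> P y"
proof -
  show "N x \<le> N y"
  proof (rule DERIV_nonneg_imp_increasing_open[OF assms(3)])
    fix t assume "x < t" "t < y"
    then have t: "0 < t" "t < 1" using assms by auto
    show "\<exists>z. (N has_real_derivative z) (at t) \<and> 0 \<le> z"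
      by (rule exI, rule conjI, rule inner_deriv(2)[OF t]) (simp add: pos_neg_part A_bd less_imp_le)
  qed (rule continuous_on_subset[OF continuous_NP(1)], use assms in auto)
  show "P x \<le> P y"
  proof (rule DERIV_nonneg_imp_increasing_open[OF assms(3)])
    fix t assume "x < t" "t < y"
    then have t: "0 < t" "t < 1" using assms by auto
    show "\<exists>z. (P has_real_derivative z) (at t) \<and> 0 \<le> z"
      by (rule exI, rule conjI, rule inner_deriv(3)[OF t]) (simp add: pos_neg_part A_bd less_imp_le)
  qed (rule continuous_on_subset[OF continuous_NP(2)], use assms in auto)
qed

lemma A_eq:
  assumes x: "x \<in> {0..1}" shows "A x = A 0 * exp (P x - N x)"
proof -
  have "A x * exp (N x - P x) = A 0 * exp (N 0 - P 0)"
  proof (cases "x = 0")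
    case False
    show ?thesis
    proof (rule DERIV_isconst_end[of 0 x "\<lambda>x. A x * exp (N x - P x)"])
      show "continuous_on {0..x} (\<lambda>x. A x * exp (N x - P x))"
        by (intro continuous_intros continuous_on_subset[OF continuous_NP(1)] continuous_on_subset[OF continuous_NP(2)])
           (use x in auto)
      fix t assume "0 < t" "t < x"
      then have t: "0 < t" "t < 1" using x by auto
      have "A t \<noteq> 0" using A_bd(1)[of t] by simp
      then have e: "(neg_part (a' t) / A t - pos_part (a' t) / A t) * A t = neg_part (a' t) - pos_part (a' t)"
        by (simp add: left_diff_distrib)
      have "a' t * exp (N t - P t) + exp (N t - P t) * (neg_part (a' t) / A t - pos_part (a' t) / A t) * A t
          = exp (N t - P t) * (a' t - (pos_part (a' t) - neg_part (a' t)))"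
        unfolding mult.assoc e by (simp add: algebra_simps)
      also have "\<dots> = 0" using pos_neg_part(3)[of "a' t"] by simp
      finally have e0: "a' t * exp (N t - P t) + exp (N t - P t) * (neg_part (a' t) / A t - pos_part (a' t) / A t) * A t = 0" .
      note dd = inner_deriv[OF t]
      have "((\<lambda>x. A x * exp (N x - P x)) has_real_derivative
          a' t * exp (N t - P t) + exp (N t - P t) * (neg_part (a' t) / A t - pos_part (a' t) / A t) * A t) (at t)"
        by (intro DERIV_mult dd(1) DERIV_chain2[OF DERIV_exp] DERIV_diff dd(2,3))
      then show "((\<lambda>x. A x * exp (N x - P x)) has_real_derivative 0) (at t)" unfolding e0 .
    qed (use x False in auto)
  qed auto
  then have "A x * exp (N x - P x) * exp (P x - N x) = A 0 * exp (P x - N x)" by (simp add: N0 P0)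
  then show ?thesis by (simp add: mult.assoc exp_add[symmetric])
qed

lemma continuous_comp_X:
  assumes "continuous_on {0..1} \<phi>" "0 \<le> s1" "X d s2 \<le> 1"
  shows "continuous_on {s1..s2} (\<lambda>s. \<phi> (X d s))"
  by (rule continuous_on_compose2[OF assms(1) continuous_XUB(1)])
     (use assms X_nonneg[of _ d] X_mono[of _ s2 d] in force)

text \<open>In \<open>En' = a' C F\<close> the loss is at most \<open>neg_part a' * C * F\<close>,
  and \<open>A * F \<le> En\<close> bounds it by \<open>(neg_part a' / A) * C * En\<close>, which is
  exactly what the weight \<open>exp N\<close> compensates. The upper estimate is the same with the
  positive part.\<close>

lemma energy_lower:
  assumes s: "0 \<le> s1" "s1 \<le> s2" "X d s2 \<le> 1"
  shows "En d s1 * exp (N (X d s1)) \<le> En d s2 * exp (N (X d s2))"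
proof (rule DERIV_nonneg_imp_increasing_open[OF s(2)])
  fix t assume "s1 < t" "t < s2"
  then have t: "0 < t" "t < s2" using s by auto
  let ?x = "X d t" and ?c = "C (B d t)" and ?e = "exp (N (X d t))"
  let ?D = "a' ?x * ?c * F (U d t) * ?e + ?e * (neg_part (a' ?x) / A ?x * ?c) * En d t"
  have "((\<lambda>s. En d s * exp (N (X d s))) has_real_derivative ?D) (at t)"
    using deriv_En[OF A' t s(3)] deriv_comp_X[OF N' t s(3)] by (auto intro!: derivative_eq_intros)
  moreover have "?D \<ge> 0"
  proof -
    have Ap: "A ?x > 0" by (rule A_bd)
    have "neg_part (a' ?x) / A ?x * (A ?x * F (U d t)) \<le> neg_part (a' ?x) / A ?x * En d t"
      using Ap En_ge pos_neg_part(2) by (intro mult_left_mono) auto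
    then have "neg_part (a' ?x) * F (U d t) \<le> neg_part (a' ?x) / A ?x * En d t" using Ap by simp
    moreover have "0 \<le> pos_part (a' ?x) * F (U d t)" using pos_neg_part F_nonneg by simp
    ultimately have "0 \<le> a' ?x * F (U d t) + neg_part (a' ?x) / A ?x * En d t"
      using left_diff_distrib[of "pos_part (a' ?x)" "neg_part (a' ?x)" "F (U d t)", folded pos_neg_part(3)]
      by linarith
    then have "0 \<le> ?e * ?c * (a' ?x * F (U d t) + neg_part (a' ?x) / A ?x * En d t)"
      using C_bd[of "B d t"] by simp
    also have "\<dots> = ?D" by (simp add: algebra_simps)
    finally show ?thesis .
  qed
  ultimately show "\<exists>y. ((\<lambda>s. En d s * exp (N (X d s))) has_real_derivative y) (at t) \<and> 0 \<le> y" by blast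
qed (intro continuous_intros continuous_En continuous_comp_X continuous_NP s)

lemma energy_upper:
  assumes s: "0 \<le> s1" "s1 \<le> s2" "X d s2 \<le> 1"
  shows "En d s2 * exp (- P (X d s2)) \<le> En d s1 * exp (- P (X d s1))"
proof (rule DERIV_nonpos_imp_decreasing_open[OF s(2)])
  fix t assume "s1 < t" "t < s2"
  then have t: "0 < t" "t < s2" using s by auto
  let ?x = "X d t" and ?c = "C (B d t)" and ?e = "exp (- P (X d t))"
  let ?D = "a' ?x * ?c * F (U d t) * ?e - ?e * (pos_part (a' ?x) / A ?x * ?c) * En d t"
  have "((\<lambda>s. En d s * exp (- P (X d s))) has_real_derivative ?D) (at t)"
    using deriv_En[OF A' t s(3)] deriv_comp_X[OF P' t s(3)] by (auto intro!: derivative_eq_intros)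
  moreover have "?D \<le> 0"
  proof -
    have Ap: "A ?x > 0" by (rule A_bd)
    have "pos_part (a' ?x) / A ?x * (A ?x * F (U d t)) \<le> pos_part (a' ?x) / A ?x * En d t"
      using Ap En_ge pos_neg_part(1) by (intro mult_left_mono) auto
    then have "pos_part (a' ?x) * F (U d t) \<le> pos_part (a' ?x) / A ?x * En d t" using Ap by simp
    moreover have "0 \<le> neg_part (a' ?x) * F (U d t)" using pos_neg_part F_nonneg by simp
    ultimately have "0 \<le> pos_part (a' ?x) / A ?x * En d t - a' ?x * F (U d t)"
      using left_diff_distrib[of "pos_part (a' ?x)" "neg_part (a' ?x)" "F (U d t)", folded pos_neg_part(3)]
      by linarith
    then have "0 \<le> ?e * ?c * (pos_part (a' ?x) / A ?x * En d t - a' ?x * F (U d t))"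
      using C_bd[of "B d t"] by simp
    also have "\<dots> = - ?D" by (simp add: algebra_simps)
    finally show ?thesis by simp
  qed
  ultimately show "\<exists>y. ((\<lambda>s. En d s * exp (- P (X d s))) has_real_derivative y) (at t) \<and> y \<le> 0" by blast
qed (intro continuous_intros continuous_En continuous_comp_X continuous_NP s)

text \<open>At a horizontal point with height in \<open>(0, u0)\<close> the energy is purely
  potential and less than \<open>A * F 0\<close>. By \<open>A = A 0 * exp (P - N)\<close> the weight
  \<open>exp (- P)\<close> removes the increasing variation, so from there on \<open>F\<close> grows
  at most by the factor \<open>exp (N 1) \<le> Cc\<close> and stays below
  \<open>F ub\<close>.\<close>

lemma upper_bound_after_minimum:
  assumes d: "0 < d" "d \<noteq> u0" and t: "B d t = 0" "U d t < u0" "0 \<le> t" "t \<le> s" "X d s \<le> 1"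
    and ub: "u0 < ub" "F ub = Cc * F 0" "exp (N 1) \<le> Cc"
  shows "U d s < ub"
proof -
  have xs: "X d s \<in> {0..1}" "X d t \<in> {0..1}"
    using X_nonneg[of s d] X_nonneg[of t d] X_mono[of t s d] t by auto
  have "A (X d s) * F (U d s) * exp (- P (X d s)) \<le> En d s * exp (- P (X d s))"
    using En_ge by (intro mult_right_mono) auto
  also have "\<dots> \<le> En d t * exp (- P (X d t))" by (rule energy_upper[OF t(3,4,5)])
  also have "En d t = A (X d t) * F (U d t)" by (simp add: En_def t H)
  finally have "A 0 * (F (U d s) * exp (P (X d s) - N (X d s)) * exp (- P (X d s)))
      \<le> A 0 * (F (U d t) * exp (P (X d t) - N (X d t)) * exp (- P (X d t)))"
    by (simp only: A_eq[OF xs(1)] A_eq[OF xs(2)] ac_simps)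
  then have "F (U d s) * exp (- N (X d s)) \<le> F (U d t) * exp (- N (X d t))"
    using A_bd(1)[of 0] by (simp add: mult.assoc exp_add[symmetric])
  then have "F (U d s) * exp (- N (X d s)) * exp (N (X d s)) \<le> F (U d t) * exp (- N (X d t)) * exp (N (X d s))"
    by (rule mult_right_mono) simp
  then have "F (U d s) \<le> F (U d t) * exp (N (X d s) - N (X d t))"
    by (simp add: mult.assoc exp_add[symmetric])
  also have "\<dots> \<le> F (U d t) * Cc"
  proof (intro mult_left_mono F_nonneg)
    have "N (X d s) - N (X d t) \<le> N 1" using NP_mono(1)[OF xs(1), of 1] NP_mono(1)[of 0 "X d t"] xs N0 by simp
    then show "exp (N (X d s) - N (X d t)) \<le> Cc" using ub(3) by (meson exp_le_cancel_iff order_trans)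
  qed
  also have "\<dots> < F 0 * Cc"
  proof (rule mult_strict_right_mono)
    have "0 < U d t" using U_pos_before[OF d t(1,3)] by simp
    then show "F (U d t) < F 0" using t by (intro F_antimono) auto
    show "0 < Cc" using ub(3) exp_gt_zero order.strict_trans2 by blast
  qed
  finally have "F (U d s) < F ub" using ub by (simp add: mult.commute)
  then show ?thesis using F_mono[of ub "U d s"] ub(1) by (cases "U d s" ub rule: linorder_cases) auto
qed

lemma half_turn_time:
  assumes "d \<noteq> u0" "0 \<le> s" "c \<le> \<Theta> d s" "0 \<le> c"
  obtains t where "0 \<le> t" "t \<le> s" "\<Theta> d t = c"
proof -
  have "continuous_on {0..s} (\<Theta> d)" by (rule continuous_\<Theta>[OF assms(1)]) auto
  then show thesis using IVT'[of "\<Theta> d" 0 c s] that assms by auto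
qed

text \<open>After a half turn the curve would be horizontal at a height in \<open>(0, u0)\<close>.
  The weighted energy lets \<open>F\<close> shrink at most by the factor
  \<open>exp (P 1) \<le> Cc\<close>, hence from \<open>F ub = Cc * F 0\<close> to no less than
  \<open>F 0\<close>; but on \<open>(0, u0)\<close> it is smaller than \<open>F 0\<close>.\<close>

lemma no_half_turn:
  assumes ub: "u0 < ub" "F ub = Cc * F 0" "exp (P 1) \<le> Cc" and s: "0 \<le> s" "X ub s \<le> 1"
  shows "\<Theta> ub s < pi"
proof (rule ccontr)
  assume "\<not> \<Theta> ub s < pi"
  then obtain t where t: "0 \<le> t" "t \<le> s" "\<Theta> ub t = pi"
    using half_turn_time[of ub s pi] s ub by auto
  obtain R where R: "U ub t - u0 = R t * cos (\<Theta> ub t)" "B ub t = - R t * sin (\<Theta> ub t)" "(ub - u0) * R t > 0"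
    using polar[of ub t] t ub by (metis order_refl less_irrefl)
  have Ut: "U ub t < u0" using R(1,3) t ub by (simp add: zero_less_mult_iff)
  have Bt: "B ub t = 0" using R t by simp
  have Upos: "0 < U ub t" using U_pos_before[of ub t t] Bt t ub u0 by simp
  have Xt: "X ub t \<le> 1" using X_mono[OF t(2), of ub] s by simp
  then have x: "X ub t \<in> {0..1}" using X_nonneg[OF t(1)] by simp
  have "A 0 * F ub \<le> A (X ub t) * F (U ub t) * exp (N (X ub t))"
    using energy_lower[of 0 t ub] t Xt Bt by (simp add: En_def H N0)
  also have "\<dots> = A 0 * (F (U ub t) * (exp (P (X ub t) - N (X ub t)) * exp (N (X ub t))))"
    by (simp only: A_eq[OF x] ac_simps)
  finally have "Cc * F 0 \<le> F (U ub t) * exp (P (X ub t))"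
    using A_bd(1)[of 0] ub by (simp add: exp_add[symmetric])
  also have "\<dots> \<le> F (U ub t) * Cc"
  proof (intro mult_left_mono F_nonneg)
    have "P (X ub t) \<le> P 1" using NP_mono(2)[OF x, of 1] x by simp
    then show "exp (P (X ub t)) \<le> Cc" using ub(3) by (meson exp_le_cancel_iff order_trans)
  qed
  also have "\<dots> < F 0 * Cc"
  proof (rule mult_strict_right_mono)
    show "F (U ub t) < F 0" using Upos Ut by (intro F_antimono) auto
    show "0 < Cc" using ub(3) exp_gt_zero order.strict_trans2 by blast
  qed
  finally show False by simp
qed

end

section \<open>The sine of the clamped angle\<close>

definition clip :: "real \<Rightarrow> real" where "clip y = max (- (pi/2)) (min (pi/2) y)"

lemma clip_regular: "\<bar>y\<bar> \<le> pi/2 \<Longrightarrow> clip y = y" by (auto simp: clip_def)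

lemma clip_bound: "\<bar>clip y\<bar> \<le> pi/2" using pi_gt_zero by (auto simp: clip_def max_def min_def)

lemma clip_frozen: "pi/2 \<le> y \<Longrightarrow> clip y = pi/2" "y \<le> - (pi/2) \<Longrightarrow> clip y = - (pi/2)"
  using pi_gt_zero by (auto simp: clip_def)

lemma continuous_clip: "continuous_on UNIV clip"
  unfolding clip_def by (intro continuous_intros continuous_on_max continuous_on_min)

lemma cos_clip_nonneg: "0 \<le> cos (clip y)"
  using clip_bound[of y] by (intro cos_ge_zero) auto

lemma cos_clip_pos: "\<bar>y\<bar> < pi/2 \<Longrightarrow> 0 < cos (clip y)"
  using clip_regular[of y] by (auto intro!: cos_gt_zero_pi)

text \<open>The clamp freezes the angle exactly where the cosine vanishes, so no corner arises. The
  proof takes an antiderivative of the continuous function \<open>cos (clip y)\<close> and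
  identifies it on the three pieces.\<close>

lemma deriv_sin_clip: "((\<lambda>y. sin (clip y)) has_real_derivative cos (clip y)) (at y)"
proof -
  have "continuous_on UNIV (\<lambda>y. cos (clip y))" by (intro continuous_intros continuous_clip)
  then obtain W where W: "W 0 = 0" "\<And>y. (W has_real_derivative cos (clip y)) (at y)"
    using antiderivative_real[of "\<lambda>y. cos (clip y)" 0] by metis
  have "\<exists>c. \<forall>y\<in>{-(pi/2)..pi/2}. W y - sin y = c"
  proof (rule has_field_derivative_zero_constant)
    fix y assume "y \<in> {-(pi/2)..pi/2}"
    then have "\<bar>y\<bar> \<le> pi/2" by auto
    then have "cos (clip y) = cos y" by (simp only: clip_regular)
    then show "((\<lambda>y. W y - sin y) has_real_derivative 0) (at y within {-(pi/2)..pi/2})"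
      using has_field_derivative_at_within[OF DERIV_diff[OF W(2)[of y] DERIV_sin]] by simp
  qed simp
  then obtain c where c: "\<And>y. y \<in> {-(pi/2)..pi/2} \<Longrightarrow> W y - sin y = c" by blast
  have "c = 0" using c[of 0] W(1) by simp
  then have mid: "W y = sin y" if "\<bar>y\<bar> \<le> pi/2" for y
  proof -
    have "y \<in> {-(pi/2)..pi/2}" unfolding atLeastAtMost_iff using that by linarith
    from c[OF this] \<open>c = 0\<close> show ?thesis by simp
  qed
  have "\<exists>c. \<forall>y\<in>{pi/2..}. W y = c"
  proof (rule has_field_derivative_zero_constant)
    fix y assume "y \<in> {pi/2..}"
    then have "cos (clip y) = 0" by (simp add: clip_frozen)
    then show "(W has_real_derivative 0) (at y within {pi/2..})"
      using has_field_derivative_at_within[OF W(2)[of y]] by simp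
  qed simp
  then have right: "W y = 1" if "pi/2 \<le> y" for y using that mid[of "pi/2"] by force
  have "\<exists>c. \<forall>y\<in>{..-(pi/2)}. W y = c"
  proof (rule has_field_derivative_zero_constant)
    fix y assume "y \<in> {..-(pi/2)}"
    then have "cos (clip y) = 0" by (simp add: clip_frozen)
    then show "(W has_real_derivative 0) (at y within {..-(pi/2)})"
      using has_field_derivative_at_within[OF W(2)[of y]] by simp
  qed simp
  then have left: "W y = - 1" if "y \<le> - (pi/2)" for y using that mid[of "- (pi/2)"] by force
  have "W y = sin (clip y)" for y
  proof -
    consider "\<bar>y\<bar> \<le> pi/2" | "pi/2 \<le> y" | "y \<le> - (pi/2)" by linarith
    then show ?thesis using mid left right by cases (auto simp: clip_regular clip_frozen)
  qed
  then have "W = (\<lambda>y. sin (clip y))" by (rule ext)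
  then show ?thesis using W(2)[of y] by simp
qed

context curvature_flow
begin

text \<open>As a flux this replaces the clamped sine, which has a corner at \<open>b\<close> when
  \<open>b < pi/2\<close>; the two agree up to the angle \<open>b\<close>.\<close>

definition W :: "real \<Rightarrow> real" where "W = (SOME W. W 0 = 0 \<and> (\<forall>x. (W has_real_derivative C x) (at x)))"

lemma W: "W 0 = 0" "(W has_real_derivative C x) (at x)"
proof -
  have "continuous_on UNIV C" using continuous_C[of UNIV "\<lambda>x. x"] by simp
  then have "\<exists>W. W 0 = 0 \<and> (\<forall>x. (W has_real_derivative C x) (at x))"
    by (metis antiderivative_real)
  from someI_ex[OF this] show "W 0 = 0" "(W has_real_derivative C x) (at x)" unfolding W_def[symmetric] by auto
qed

lemma W_sin: "\<bar>x\<bar> \<le> b \<Longrightarrow> W x = sin x"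
proof -
  assume x: "\<bar>x\<bar> \<le> b"
  have "\<exists>c. \<forall>x\<in>{-b..b}. W x - sin x = c"
  proof (rule has_field_derivative_zero_constant)
    fix x assume "x \<in> {-b..b}"
    then have "C x = cos x" using cl_id[of x] by (simp add: C_def abs_le_iff)
    then show "((\<lambda>x. W x - sin x) has_real_derivative 0) (at x within {-b..b})"
      using has_field_derivative_at_within[OF DERIV_diff[OF W(2)[of x] DERIV_sin]] by simp
  qed simp
  then obtain c where c: "\<And>x. x \<in> {-b..b} \<Longrightarrow> W x - sin x = c" by blast
  have "c = 0" using c[of 0] W(1) b by simp
  then show ?thesis using c[of x] x by (simp add: abs_le_iff)
qed

lemma W_mono: "x \<le> y \<Longrightarrow> W x \<le> W y"
  by (rule DERIV_nonneg_imp_nondecreasing[of x y W]) (use W(2) C_bd in blast)+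

lemma deriv_S:
  assumes "b = pi / 2"
  shows "(S has_real_derivative C x) (at x)"
proof -
  have "cl y = clip y" for y unfolding cl_def clip_def by (simp add: assms)
  then have "S = (\<lambda>y. sin (clip y))" "C x = cos (clip x)" unfolding S_def[abs_def] C_def by auto
  then show ?thesis using deriv_sin_clip[of x] by simp
qed

section \<open>A priori bounds on arrival time, slope and arclength\<close>

lemma C_ge: "cos b \<le> C \<beta>"
proof -
  have "cos b \<le> cos \<bar>cl \<beta>\<bar>" using b cl_bd[of \<beta>] by (subst cos_mono_le_eq) auto
  then show ?thesis by (simp add: C_def)
qed

lemma time_le:
  assumes "0 \<le> s" shows "s * cos b \<le> X d s"
proof -
  have "X d 0 - 0 * cos b \<le> X d s - s * cos b"
  proof (rule DERIV_nonneg_imp_nondecreasing[OF assms])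
    fix t show "\<exists>y. ((\<lambda>s. X d s - s * cos b) has_real_derivative y) (at t) \<and> 0 \<le> y"
      by (rule exI[of _ "C (B d t) - cos b"]) (auto intro!: derivative_eq_intros deriv_X simp: C_ge)
  qed
  then show ?thesis by simp
qed

lemma U_lip: assumes "r \<le> s" shows "\<bar>U d s - U d r\<bar> \<le> s - r"
proof -
  have "U d r - r \<ge> U d s - s"
  proof (rule DERIV_nonpos_imp_nonincreasing[OF assms])
    fix t show "\<exists>y. ((\<lambda>s. U d s - s) has_real_derivative y) (at t) \<and> y \<le> 0"
      by (rule exI[of _ "S (B d t) - 1"]) (use S_bd[of "B d t"] in \<open>auto intro!: derivative_eq_intros deriv_U\<close>)
  qed
  moreover have "U d r + r \<le> U d s + s"
  proof (rule DERIV_nonneg_imp_nondecreasing[OF assms])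
    fix t show "\<exists>y. ((\<lambda>s. U d s + s) has_real_derivative y) (at t) \<and> 0 \<le> y"
      by (rule exI[of _ "S (B d t) + 1"]) (use S_bd[of "B d t"] in \<open>auto intro!: derivative_eq_intros deriv_U\<close>)
  qed
  ultimately show ?thesis by linarith
qed

text \<open>At angle \<open>pi\<close> the cosine is \<open>- 1\<close>, so the curve would be on
  the other side of \<open>u0\<close>.\<close>

lemma angle_lt_pi:
  assumes d: "u0 < d" and s: "0 \<le> s" "\<And>t. 0 \<le> t \<Longrightarrow> t \<le> s \<Longrightarrow> u0 < U d t"
  shows "\<Theta> d s < pi"
proof (rule ccontr)
  assume h: "\<not> \<Theta> d s < pi"
  have "continuous_on {0..s} (\<Theta> d)" by (rule continuous_\<Theta>) (use d in auto)
  then obtain t where t: "0 \<le> t" "t \<le> s" "\<Theta> d t = pi"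
    using IVT'[of "\<Theta> d" 0 pi s] h s by auto
  obtain R where R: "U d t - u0 = R t * cos (\<Theta> d t)" "(d - u0) * R t > 0"
    using polar[of d t] t d by (metis order_refl less_irrefl)
  then show False using s(2)[OF t(1,2)] t(3) d by (simp add: zero_less_mult_iff)
qed

text \<open>The flux \<open>W (B d s)\<close> has derivative \<open>- A G\<close> with respect to \<open>x\<close>; integrating from either end,
  where it vanishes, bounds it by the integral of \<open>A G\<^sup>-\<close>.\<close>

lemma small_slope:
  assumes m: "0 \<le> m" "\<And>u. - m \<le> G u"
    and J: "J 0 = 0" "\<And>x. (J has_real_derivative A x) (at x)"
    and sol: "0 \<le> s0" "X d s0 = 1" "B d s0 = 0"
    and small: "m * J 1 < sin b"
    and s: "0 \<le> s" "s \<le> s0"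
  shows "\<bar>B d s\<bar> < b"
proof -
  have dW: "((\<lambda>s. m * J (X d s) - W (B d s)) has_real_derivative
      m * (A (X d t) * C (B d t)) - C (B d t) * - (A (X d t) * G (U d t))) (at t)" for t
    by (intro DERIV_diff DERIV_cmult DERIV_chain2[OF J(2) deriv_X] DERIV_chain2[OF W(2) deriv_B])
  have pos: "m * (A (X d t) * C (B d t)) - C (B d t) * - (A (X d t) * G (U d t)) \<ge> 0" for t
  proof -
    have "0 \<le> C (B d t) * A (X d t) * (m + G (U d t))"
      using m(2)[of "U d t"] C_bd[of "B d t"] A_bd(1)[of "X d t"] by (intro mult_nonneg_nonneg) auto
    then show ?thesis by (simp add: algebra_simps)
  qed
  have mono: "m * J (X d p) - W (B d p) \<le> m * J (X d q) - W (B d q)" if "p \<le> q" for p q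
    by (rule DERIV_nonneg_imp_nondecreasing[OF that]) (use dW pos in blast)
  have Jm: "J x \<le> J y" if "x \<le> y" for x y
    by (rule DERIV_nonneg_imp_nondecreasing[OF that]) (use J(2) A_bd(1) less_imp_le in blast)
  have J01: "0 \<le> J (X d s)" "J (X d s) \<le> J 1"
    using Jm[of 0 "X d s"] Jm[of "X d s" 1] J(1) X_nonneg[OF s(1)] X_mono[OF s(2), of d] sol by auto
  have "W (B d s) \<le> m * J (X d s)" using mono[OF s(1)] W(1) J(1) by simp
  also have "\<dots> \<le> m * J 1" using m J01 by (intro mult_left_mono) auto
  finally have up: "W (B d s) < sin b" using small by simp
  have "- W (B d s) \<le> m * J 1 - m * J (X d s)" using mono[OF s(2)] W(1) sol by simp
  also have "\<dots> \<le> m * J 1" using m J01 by simp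
  finally have lo: "- sin b < W (B d s)" using small by simp
  show ?thesis
  proof (rule ccontr)
    assume "\<not> ?thesis"
    then consider "b \<le> B d s" | "B d s \<le> - b" by linarith
    then show False
      using W_mono[of b "B d s"] W_mono[of "B d s" "- b"] W_sin[of b] W_sin[of "- b"] b up lo by cases auto
  qed
qed

text \<open>Vertical runs make no progress in \<open>x\<close>, but along them
  \<open>S (U - u0)\<close> grows at unit rate: in general its rate is at least
  \<open>S\<^sup>2 - C * MA * K\<close>, and \<open>S\<^sup>2 = 1 - C\<^sup>2 \<ge> 1 - C\<close>.
  So it grows at least as \<open>s - (1 + MA * K) * X\<close>, and at a horizontal point, where
  \<open>S\<close> vanishes, this bounds \<open>s\<close>.\<close>

lemma arclength_bound:
  assumes bpi: "b = pi / 2" and K: "\<And>u. G u * (u - u0) \<le> K" "0 \<le> K"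
    and s: "0 \<le> s" "B d s = 0" "X d s \<le> 1"
  shows "s \<le> 1 + MA * K"
proof -
  note dS = deriv_S[OF bpi]
  define \<phi> where "\<phi> s = S (B d s) * (U d s - u0) - s + (1 + MA * K) * X d s" for s
  have "\<phi> 0 \<le> \<phi> s"
  proof (rule DERIV_nonneg_imp_nondecreasing[OF s(1)])
    fix t
    let ?c = "C (B d t)" and ?s = "S (B d t)"
    let ?D = "?c * - (A (X d t) * G (U d t)) * (U d t - u0) + ?s * ?s - 1 + (1 + MA * K) * ?c"
    have "((\<lambda>s. S (B d s)) has_real_derivative ?c * - (A (X d t) * G (U d t))) (at t)"
      by (rule DERIV_chain2[OF dS deriv_B])
    then have "(\<phi> has_real_derivative ?D) (at t)"
      unfolding \<phi>_def by (auto intro!: derivative_eq_intros deriv_U deriv_X)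
    moreover have "?D \<ge> 0"
    proof -
      have "A (X d t) * (G (U d t) * (U d t - u0)) \<le> MA * K"
        using A_bd[of "X d t"] K G_sign by (intro mult_mono) auto
      then have "?c * (A (X d t) * (G (U d t) * (U d t - u0))) \<le> ?c * (MA * K)"
        using C_bd by (intro mult_left_mono) auto
      moreover have "?c * ?c \<le> ?c * 1" using C_bd by (intro mult_left_mono) auto
      moreover have "?s * ?s + ?c * ?c = 1" using S2_C2[of "B d t"] by (simp add: power2_eq_square)
      ultimately show ?thesis by (simp add: algebra_simps)
    qed
    ultimately show "\<exists>y. (\<phi> has_real_derivative y) (at t) \<and> 0 \<le> y" by blast
  qed
  then have "s \<le> (1 + MA * K) * X d s" using s by (simp add: \<phi>_def)
  also have "\<dots> \<le> (1 + MA * K) * 1" using s K A_bd[of 0] by (intro mult_left_mono) auto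
  finally show ?thesis by simp
qed

text \<open>The heights range over \<open>{0..<u0}\<close> or \<open>{u0<..ub}\<close>. The curve
  that does not turn is the one resting at 0, respectively the one from \<open>ub\<close>; the curve
  that turns enough starts close to \<open>u0\<close>.\<close>

lemma shot:
  assumes ub: "u0 < ub" and n: "1 \<le> n" "n \<le> k"
    and rot: "\<delta> > 0" "\<And>d. d \<noteq> u0 \<Longrightarrow> \<bar>d - u0\<bar> < \<delta> \<Longrightarrow> \<exists>s\<ge>0. X d s < 1 \<and> \<Theta> d s > real k * pi"
    and bd: "\<And>d s. s \<ge> 0 \<Longrightarrow> B d s = 0 \<Longrightarrow> X d s \<le> 1 \<Longrightarrow> s \<le> K"
    and noturn: "\<And>s. 0 \<le> s \<Longrightarrow> X ub s \<le> 1 \<Longrightarrow> \<Theta> ub s < pi"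
    and \<sigma>: "\<sigma> = 1 \<or> \<sigma> = - 1"
  obtains d s where "0 < d" "d \<le> ub" "\<sigma> * (d - u0) < 0" "s > 0" "X d s = 1" "\<Theta> d s = real n * pi"
proof -
  have nk: "real n * pi \<le> real k * pi" "pi \<le> real n * pi" using n by auto
  show thesis
  proof (cases "\<sigma> = 1")
    case True
    define d1 where "d1 = u0 - min \<delta> u0 / 2"
    have d1: "0 < d1" "d1 < u0" "\<bar>d1 - u0\<bar> < \<delta>" using rot(1) u0 by (auto simp: d1_def)
    obtain s1 where s1: "s1 \<ge> 0" "X d1 s1 < 1" "\<Theta> d1 s1 > real k * pi" using rot(2)[of d1] d1 by auto
    show thesis
    proof (rule shooting[of "{0..<u0}" n d1 s1 0 K])
      show "\<Theta> 0 s < real n * pi" if "s \<ge> 0" for s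
        using angle_zero[OF that] nk pi_gt_zero by linarith
      show "real n * pi < \<Theta> d1 s1" using s1 nk by linarith
      fix d s assume "d \<in> {0..<u0}" "0 < d" "0 < s" "X d s = 1" "\<Theta> d s = real n * pi"
      then show thesis using that[of d s] ub True by auto
    qed (use d1 s1 n u0 bd in auto)
  next
    case False
    then have \<sigma>: "\<sigma> = - 1" using \<sigma> by simp
    define d1 where "d1 = u0 + min \<delta> (ub - u0) / 2"
    have d1: "u0 < d1" "d1 \<le> ub" "\<bar>d1 - u0\<bar> < \<delta>" using rot(1) ub by (auto simp: d1_def min_def field_simps)
    obtain s1 where s1: "s1 \<ge> 0" "X d1 s1 < 1" "\<Theta> d1 s1 > real k * pi" using rot(2)[of d1] d1 by auto
    show thesis
    proof (rule shooting[of "{u0<..ub}" n d1 s1 ub K])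
      show "\<Theta> ub s < real n * pi" if "s \<ge> 0" "X ub s \<le> 1" for s
        using noturn[OF that] nk by linarith
      show "real n * pi < \<Theta> d1 s1" using s1 nk by linarith
      fix d s assume "d \<in> {u0<..ub}" "0 < d" "0 < s" "X d s = 1" "\<Theta> d s = real n * pi"
      then show thesis using that[of d s] \<sigma> by auto
    qed (use d1 s1 n u0 bd ub in auto)
  qed
qed

end

section \<open>Existence of solution curves\<close>

text \<open>A BV solution in arclength parametrisation: \<open>\<beta>\<close> is the tangent angle, clamped to
  \<open>[- pi/2, pi/2]\<close>, so that the curve moves vertically where \<open>\<bar>\<beta>\<bar> \<ge> pi/2\<close>. There \<open>x\<close> is constant and the
  energy is conserved, which selects the endpoints of the jump of the solution. The angle \<open>\<theta>\<close>
  of the point \<open>(u - u0, \<beta>)\<close> counts the half turns around \<open>(u0, 0)\<close>.\<close>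

locale solution_curve =
  fixes a f x u \<beta> \<theta> P :: "real \<Rightarrow> real" and u0 s0 \<sigma> :: real and n :: nat
  assumes a_cont: "continuous_on {0..1} a"
    and a_pos: "\<And>t. t \<in> {0..1} \<Longrightarrow> 0 < a t"
    and f_cont: "continuous_on {0..} f"
    and f_u0: "f u0 = 0" and u0_pos: "0 < u0"
    and f_neg: "\<And>s. 0 < s \<Longrightarrow> s < u0 \<Longrightarrow> f s < 0"
    and f_pos: "\<And>s. u0 < s \<Longrightarrow> 0 < f s"
    and s0_pos: "0 < s0" and n_pos: "1 \<le> n" and \<sigma>: "\<sigma> = 1 \<or> \<sigma> = - 1"
    and dx: "\<And>s. s \<in> {0..s0} \<Longrightarrow> (x has_real_derivative cos (max (- (pi/2)) (min (pi/2) (\<beta> s)))) (at s)"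
    and du: "\<And>s. s \<in> {0..s0} \<Longrightarrow> (u has_real_derivative sin (max (- (pi/2)) (min (pi/2) (\<beta> s)))) (at s)"
    and d\<beta>: "\<And>s. s \<in> {0..s0} \<Longrightarrow> (\<beta> has_real_derivative - (a (x s) * f (u s))) (at s)"
    and ends: "x 0 = 0" "x s0 = 1" "\<beta> 0 = 0" "\<beta> s0 = 0"
    and u_pos: "\<And>s. s \<in> {0..s0} \<Longrightarrow> 0 < u s"
    and \<theta>_cont: "continuous_on {0..s0} \<theta>"
    and \<theta>_mono: "\<And>s t. 0 \<le> s \<Longrightarrow> s < t \<Longrightarrow> t \<le> s0 \<Longrightarrow> \<theta> s < \<theta> t"
    and \<theta>_ends: "\<theta> 0 = 0" "\<theta> s0 = real n * pi"
    and polar_u: "\<And>s. s \<in> {0..s0} \<Longrightarrow> u s - u0 = P s * cos (\<theta> s)"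
    and polar_\<beta>: "\<And>s. s \<in> {0..s0} \<Longrightarrow> \<beta> s = - P s * sin (\<theta> s)"
    and P_sign: "\<And>s. s \<in> {0..s0} \<Longrightarrow> \<sigma> * P s < 0"

text \<open>None of the modifications is felt along the curve: its abscissas lie in
  \<open>{0..1}\<close>, its heights in \<open>(0, ub]\<close>, and its angle is either clamped at
  \<open>pi/2\<close> or never reaches \<open>b\<close>.\<close>

lemma (in curvature_flow) solution_curve_of_shot:
  assumes d: "0 < d" "\<sigma> * (d - u0) < 0" and \<sigma>: "\<sigma> = 1 \<or> \<sigma> = - 1"
    and s0: "0 < s0" "X d s0 = 1" "\<Theta> d s0 = real n * pi" and n: "1 \<le> n"
    and ub: "\<And>s. 0 \<le> s \<Longrightarrow> s \<le> s0 \<Longrightarrow> U d s \<le> ub"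
    and slope: "b = pi / 2 \<or> (\<forall>s. 0 \<le> s \<longrightarrow> s \<le> s0 \<longrightarrow> \<bar>B d s\<bar> < b)"
    and Aa: "\<And>x. x \<in> {0..1} \<Longrightarrow> A x = a x" and Gf: "\<And>u. u \<in> {0..ub} \<Longrightarrow> G u = f u"
    and ca: "continuous_on {0..1} a" and cf: "continuous_on {0..} f"
    and f: "f u0 = 0" "\<And>s. 0 < s \<Longrightarrow> s < u0 \<Longrightarrow> f s < 0" "\<And>s. u0 < s \<Longrightarrow> 0 < f s"
  shows "\<exists>P. solution_curve a f (X d) (U d) (B d) (\<Theta> d) P u0 s0 \<sigma> n"
proof -
  have du0: "d \<noteq> u0" using d(2) by auto
  obtain P where P: "\<And>s. 0 \<le> s \<Longrightarrow> s \<le> s0 \<Longrightarrow> U d s - u0 = P s * cos (\<Theta> d s)"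
      "\<And>s. 0 \<le> s \<Longrightarrow> s \<le> s0 \<Longrightarrow> B d s = - P s * sin (\<Theta> d s)"
      "\<And>s. 0 \<le> s \<Longrightarrow> s \<le> s0 \<Longrightarrow> (d - u0) * P s > 0"
    using polar[OF du0, of s0] by metis
  have Bend: "B d s0 = 0" using B_zero_angle[OF du0 _ s0(3)] s0 by simp
  have Upos: "0 < U d s" if "s \<in> {0..s0}" for s
    using U_pos_before[OF d(1) du0 Bend, of s] that by simp
  have cl: "cl (B d s) = max (- (pi/2)) (min (pi/2) (B d s))" if "s \<in> {0..s0}" for s
  proof (cases "b = pi/2")
    case False
    then have "\<bar>B d s\<bar> < b" using slope that by auto
    then show ?thesis using b(2) by (auto simp: cl_def)
  qed (simp add: cl_def)
  have ags: "A (X d s) * G (U d s) = a (X d s) * f (U d s)" if "s \<in> {0..s0}" for s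
    using Aa[of "X d s"] Gf[of "U d s"] X_nonneg[of s d] X_mono[of s s0 d] s0 Upos[OF that] ub[of s] that by auto
  have "solution_curve a f (X d) (U d) (B d) (\<Theta> d) P u0 s0 \<sigma> n"
  proof
    fix s assume s: "s \<in> {0..s0}"
    show "(X d has_real_derivative cos (max (- (pi/2)) (min (pi/2) (B d s)))) (at s)"
      using deriv_X[of d s] by (simp add: C_def cl[OF s])
    show "(U d has_real_derivative sin (max (- (pi/2)) (min (pi/2) (B d s)))) (at s)"
      using deriv_U[of d s] by (simp add: S_def cl[OF s])
    show "(B d has_real_derivative - (a (X d s) * f (U d s))) (at s)"
      using deriv_B[of d s] by (simp add: ags[OF s])
    show "U d s - u0 = P s * cos (\<Theta> d s)" "B d s = - P s * sin (\<Theta> d s)" using P s by auto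
    have "(d - u0) * P s > 0" using P(3)[of s] s by auto
    then show "\<sigma> * P s < 0" using \<sigma> d(2) by (auto simp: zero_less_mult_iff)
  next
    show "0 < a t" if "t \<in> {0..1}" for t using A_bd(1)[of t] Aa[OF that] by simp
    show "continuous_on {0..s0} (\<Theta> d)" by (rule continuous_\<Theta>[OF du0]) auto
    show "\<Theta> d s < \<Theta> d t" if "0 \<le> s" "s < t" for s t by (rule \<Theta>_strict_mono[OF d(1) du0 that])
  qed (use assms Bend Upos u0 in auto)
  then show ?thesis by blast
qed

section \<open>Globally Lipschitz versions of the data\<close>

lemma lipschitz_of_bounded_deriv:
  fixes g :: "real \<Rightarrow> real"
  assumes "\<And>x. x \<in> {c..e} \<Longrightarrow> (g has_real_derivative g' x) (at x within {c..e})" "continuous_on {c..e} g'"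
  obtains K where "K \<ge> 0" "\<And>x y. x \<in> {c..e} \<Longrightarrow> y \<in> {c..e} \<Longrightarrow> \<bar>g x - g y\<bar> \<le> K * \<bar>x - y\<bar>"
proof -
  obtain K where K: "K \<ge> 0" "\<And>x. x \<in> {c..e} \<Longrightarrow> \<bar>g' x\<bar> \<le> K"
    by (rule continuous_on_Icc_abs_bound[OF assms(2)]) blast
  have "norm (g x - g y) \<le> K * norm (x - y)" if "x \<in> {c..e}" "y \<in> {c..e}" for x y
    by (rule field_differentiable_bound[of "{c..e}" g g']) (use assms(1) K that in auto)
  then show thesis using that[OF K(1)] by simp
qed

definition unit_ext :: "(real \<Rightarrow> real) \<Rightarrow> real \<Rightarrow> real" where
  "unit_ext a x = a (max 0 (min 1 x))"

text \<open>The decay beyond \<open>ub\<close> keeps \<open>(u - u0) f u\<close> bounded.\<close>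

definition truncate :: "(real \<Rightarrow> real) \<Rightarrow> real \<Rightarrow> real \<Rightarrow> real \<Rightarrow> real" where
  "truncate f u0 ub u = f (max 0 (min ub u)) * ((ub - u0) / (max u ub - u0))"

lemma unit_ext_eq: "x \<in> {0..1} \<Longrightarrow> unit_ext a x = a x"
  by (simp add: unit_ext_def)

lemma truncate_eq: "u0 < ub \<Longrightarrow> u \<in> {0..ub} \<Longrightarrow> truncate f u0 ub u = f u"
  by (simp add: truncate_def)

lemma truncate_weight: "u0 < ub \<Longrightarrow> 0 < (ub - u0) / (max u ub - u0) \<and> (ub - u0) / (max u ub - u0) \<le> (1::real)"
  by (auto simp: field_simps)

lemma curvature_flow_exists:
  assumes a_C1: "\<And>x. x \<in> {0..1} \<Longrightarrow> (a has_real_derivative a' x) (at x within {0..1})"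
      "continuous_on {0..1} a'"
    and a_pos: "\<And>x. x \<in> {0..1} \<Longrightarrow> a x > 0"
    and u0_pos: "u0 > 0"
    and f_C1: "\<And>s. s \<in> {0..} \<Longrightarrow> (f has_real_derivative f' s) (at s within {0..})"
      "continuous_on {0..} f'"
    and f_zero: "f 0 = 0" "f u0 = 0"
    and f_neg: "\<And>s. s \<in> {0<..<u0} \<Longrightarrow> f s < 0"
    and f_pos: "\<And>s. s \<in> {u0<..} \<Longrightarrow> f s > 0"
    and ub: "u0 < ub" and b: "0 < b" "b \<le> pi / 2"
  obtains LA MA LG MG where "curvature_flow b (unit_ext a) (truncate f u0 ub) u0 LA MA LG MG"
    "0 \<le> MG" "\<And>u. truncate f u0 ub u * (u - u0) \<le> MG * ub"
proof -
  let ?G = "truncate f u0 ub"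
  obtain LA where LA: "LA \<ge> 0" "\<And>x y. x \<in> {0..1} \<Longrightarrow> y \<in> {0..1} \<Longrightarrow> \<bar>a x - a y\<bar> \<le> LA * \<bar>x - y\<bar>"
    by (rule lipschitz_of_bounded_deriv[OF a_C1]) blast+
  have ca: "continuous_on {0..1} a" by (rule DERIV_continuous_on) (use a_C1 in auto)
  obtain MA where MA: "MA \<ge> 0" "\<And>x. x \<in> {0..1} \<Longrightarrow> \<bar>a x\<bar> \<le> MA"
    by (rule continuous_on_Icc_abs_bound[OF ca]) blast
  have sub: "{0..ub} \<subseteq> {0..}" by auto
  have f1: "\<And>s. s \<in> {0..ub} \<Longrightarrow> (f has_real_derivative f' s) (at s within {0..ub})"
    using f_C1(1) by (auto intro: DERIV_subset[OF _ sub])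
  obtain Lf where Lf: "Lf \<ge> 0" "\<And>x y. x \<in> {0..ub} \<Longrightarrow> y \<in> {0..ub} \<Longrightarrow> \<bar>f x - f y\<bar> \<le> Lf * \<bar>x - y\<bar>"
    by (rule lipschitz_of_bounded_deriv[OF f1 continuous_on_subset[OF f_C1(2) sub]]) blast+
  have cf: "continuous_on {0..ub} f" by (rule DERIV_continuous_on) (use f1 in auto)
  obtain M where M: "M \<ge> 0" "\<And>x. x \<in> {0..ub} \<Longrightarrow> \<bar>f x\<bar> \<le> M"
    by (rule continuous_on_Icc_abs_bound[OF cf]) blast
  define c where "c v = max 0 (min ub v)" for v
  define r where "r v = (ub - u0) / (max v ub - u0)" for v
  have c: "c v \<in> {0..ub}" "\<bar>c v - c w\<bar> \<le> \<bar>v - w\<bar>" for v w using ub u0_pos by (auto simp: c_def)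
  have r: "0 < r v" "r v \<le> 1" for v using truncate_weight[OF ub, of v] by (auto simp: r_def)
  have G: "?G v = f (c v) * r v" for v by (simp add: truncate_def c_def r_def)
  have rl: "\<bar>r v - r w\<bar> \<le> \<bar>v - w\<bar> / (ub - u0)" for v w
  proof -
    let ?v = "max v ub - u0" and ?w = "max w ub - u0"
    have p: "?v \<ge> ub - u0" "?w \<ge> ub - u0" "ub - u0 > 0" using ub by auto
    have "r v - r w = (ub - u0) * (?w - ?v) / (?v * ?w)"
      using p by (simp add: r_def field_simps)
    then have "\<bar>r v - r w\<bar> = (ub - u0) * \<bar>?w - ?v\<bar> / (?v * ?w)" using p by (simp add: abs_mult)
    also have "\<dots> \<le> (ub - u0) * \<bar>v - w\<bar> / ((ub - u0) * (ub - u0))"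
      using p by (intro frac_le mult_mono mult_pos_pos) auto
    finally show ?thesis using p by simp
  qed
  have "curvature_flow b (unit_ext a) ?G u0 LA MA (Lf + M / (ub - u0)) M"
  proof
    show "\<bar>unit_ext a x - unit_ext a y\<bar> \<le> LA * \<bar>x - y\<bar>" for x y
    proof -
      have "\<bar>unit_ext a x - unit_ext a y\<bar> \<le> LA * \<bar>max 0 (min 1 x) - max 0 (min 1 y)\<bar>"
        unfolding unit_ext_def by (rule LA(2)) auto
      also have "\<dots> \<le> LA * \<bar>x - y\<bar>" by (intro mult_left_mono LA(1)) auto
      finally show ?thesis .
    qed
    show "0 < unit_ext a x" for x unfolding unit_ext_def by (rule a_pos) auto
    show "unit_ext a x \<le> MA" for x unfolding unit_ext_def by (rule abs_le_D1, rule MA(2)) auto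
    show "\<bar>?G v - ?G w\<bar> \<le> (Lf + M / (ub - u0)) * \<bar>v - w\<bar>" for v w
    proof -
      have "?G v - ?G w = (f (c v) - f (c w)) * r v + f (c w) * (r v - r w)" by (simp add: G algebra_simps)
      then have "\<bar>?G v - ?G w\<bar> \<le> \<bar>f (c v) - f (c w)\<bar> * \<bar>r v\<bar> + \<bar>f (c w)\<bar> * \<bar>r v - r w\<bar>"
        unfolding abs_mult[symmetric] by (simp only: abs_triangle_ineq)
      also have "\<dots> \<le> (Lf * \<bar>v - w\<bar>) * 1 + M * (\<bar>v - w\<bar> / (ub - u0))"
      proof (intro add_mono mult_mono)
        show "\<bar>f (c v) - f (c w)\<bar> \<le> Lf * \<bar>v - w\<bar>"
          using Lf(2)[OF c(1) c(1), of v w] mult_left_mono[OF c(2) Lf(1), of v w] by linarith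
        show "\<bar>r v\<bar> \<le> 1" using r[of v] by simp
        show "\<bar>f (c w)\<bar> \<le> M" by (rule M(2)[OF c(1)])
      qed (use rl Lf M in auto)
      finally show ?thesis by (simp add: algebra_simps)
    qed
    show "\<bar>?G v\<bar> \<le> M" for v
      using mult_mono[OF M(2)[OF c(1)[of v]], of "\<bar>r v\<bar>" 1] r[of v] M(1) by (simp add: G abs_mult)
    show "?G v < 0" if "0 < v" "v < u0" for v
      using truncate_eq[OF ub, of v f] f_neg[of v] that ub by simp
    show "0 < ?G v" if "u0 < v" for v
    proof -
      have "c v > u0" using that ub u0_pos by (auto simp: c_def)
      then show ?thesis unfolding G using f_pos r by (intro mult_pos_pos) auto
    qed
    show "?G v = 0" if "v \<le> 0" for v
    proof -
      have "c v = 0" using that ub u0_pos by (simp add: c_def)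
      then show ?thesis by (simp add: G f_zero)
    qed
    show "?G u0 = 0" using truncate_eq[OF ub, of u0 f] u0_pos ub f_zero by simp
  qed (use b u0_pos in auto)
  moreover have "?G v * (v - u0) \<le> M * ub" for v
  proof -
    consider "v \<le> 0" | "0 < v" "v \<le> ub" | "ub < v" by linarith
    then show ?thesis
    proof cases
      case 1
      then have "c v = 0" using ub u0_pos by (simp add: c_def)
      then show ?thesis using M u0_pos ub by (simp add: G f_zero)
    next
      case 2
      have "f v * (v - u0) \<le> \<bar>f v\<bar> * \<bar>v - u0\<bar>" by (metis abs_ge_self abs_mult)
      also have "\<dots> \<le> M * ub" using M(2)[of v] M(1) 2 u0_pos ub by (intro mult_mono) auto
      finally show ?thesis using truncate_eq[OF ub, of v f] 2 by simp
    next
      case 3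
      then have "?G v * (v - u0) = f ub * (ub - u0)" using ub u0_pos by (simp add: truncate_def)
      also have "\<dots> \<le> \<bar>f ub\<bar> * \<bar>ub - u0\<bar>" by (metis abs_ge_self abs_mult)
      also have "\<dots> \<le> M * ub" using M(2)[of ub] M(1) u0_pos ub by (intro mult_mono) auto
      finally show ?thesis .
    qed
  qed
  ultimately show thesis using that M(1) by blast
qed

text \<open>No order of the limits is assumed, since the primitive based at \<open>u0\<close> is
  also evaluated below \<open>u0\<close>.\<close>

lemma LBINT_eq_diff:
  fixes h \<Phi> :: "real \<Rightarrow> real"
  assumes "continuous_on {min c e..max c e} h"
    "\<And>x. x \<in> {min c e..max c e} \<Longrightarrow> (\<Phi> has_real_derivative h x) (at x within {min c e..max c e})"
  shows "(LBINT x=c..e. h x) = \<Phi> e - \<Phi> c"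
  by (rule interval_integral_FTC_finite)
     (use assms in \<open>auto simp: has_real_derivative_iff_has_vector_derivative[symmetric]\<close>)

lemma truncate_deriv:
  assumes f: "(f has_real_derivative D) (at u0 within {0..})" and u0: "0 < u0" "u0 < ub"
  shows "(truncate f u0 ub has_real_derivative D) (at u0)"
proof -
  have "at u0 within {0..} = at u0" using u0 by (intro at_within_interior) (simp add: interior_Ici)
  then have "(f has_real_derivative D) (at u0)" using f by simp
  then show ?thesis
    by (rule has_field_derivative_transform_within_open[of _ _ _ "{0<..<ub}"]) (use u0 truncate_eq[OF u0(2)] in auto)
qed

lemma unit_ext_deriv:
  assumes "\<And>x. x \<in> {0..1} \<Longrightarrow> (a has_real_derivative a' x) (at x within {0..1})" "x \<in> {0..1}"
  shows "(unit_ext a has_real_derivative a' x) (at x within {0..1})"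
  by (rule has_field_derivative_transform_within[OF assms(1)[OF assms(2)] zero_less_one assms(2)])
     (simp add: unit_ext_eq)

lemma (in curvature_flow) F_truncate:
  assumes G: "G = truncate f u0 ub" and ub: "u0 < ub" and f: "continuous_on {0..} f" and v: "v \<in> {0..ub}"
  shows "(LBINT t=u0..v. f t) = F v"
proof -
  have "(LBINT t=u0..v. f t) = F v - F u0"
  proof (rule LBINT_eq_diff)
    show "continuous_on {min u0 v..max u0 v} f" by (rule continuous_on_subset[OF f]) (use v u0 in auto)
    fix t assume "t \<in> {min u0 v..max u0 v}"
    then have "t \<in> {0..ub}" using v u0 ub by (cases "v \<le> u0") auto
    then have "G t = f t" unfolding G by (rule truncate_eq[OF ub])
    then show "(F has_real_derivative f t) (at t within {min u0 v..max u0 v})"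
      using has_field_derivative_at_within[OF F(2)[of t]] by simp
  qed
  then show ?thesis by (simp add: F)
qed

text \<open>In case (B) the flux of a solution stays below \<open>sin b < 1\<close>, so that clamping the angle at \<open>b < pi/2\<close>
  does not affect it, while every curve then has slope at most \<open>tan b\<close>.\<close>

lemma solution_curve_exists:
  fixes a a' f f' :: "real \<Rightarrow> real" and u0 lam :: real and k :: nat
  assumes a_C1: "\<And>x. x \<in> {0..1} \<Longrightarrow> (a has_real_derivative a' x) (at x within {0..1})"
      "continuous_on {0..1} a'"
    and a_pos: "\<And>x. x \<in> {0..1} \<Longrightarrow> a x > 0"
    and u0_pos: "u0 > 0"
    and f_C1: "\<And>s. s \<in> {0..} \<Longrightarrow> (f has_real_derivative f' s) (at s within {0..})"
      "continuous_on {0..} f'"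
    and f_zero: "f 0 = 0" "f u0 = 0"
    and f_neg: "\<And>s. s \<in> {0<..<u0} \<Longrightarrow> f s < 0"
    and f_pos: "\<And>s. s \<in> {u0<..} \<Longrightarrow> f s > 0"
    and A_or_B:
      "(\<exists>ubar>u0. (LBINT s=u0..ubar. f s) = C_const a a' * (LBINT s=u0..0. f s)) \<or>
       (LBINT x=0..1. \<bar>a x\<bar>) * (SUP s\<in>{0..}. neg_part (f s)) < 1"
    and lam: "is_kth_neumann_eigenvalue a (k + 1) lam"
    and f'_gt: "f' u0 > lam"
    and n: "1 \<le> n" "n \<le> k" and \<sigma>: "\<sigma> = 1 \<or> \<sigma> = - 1"
  shows "\<exists>x u \<beta> \<theta> P s0. solution_curve a f x u \<beta> \<theta> P u0 s0 \<sigma> n"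
proof -
  have ca: "continuous_on {0..1} a" by (rule DERIV_continuous_on) (use a_C1 in auto)
  have cf: "continuous_on {0..} f" by (rule DERIV_continuous_on) (use f_C1 in auto)
  obtain \<psi> where \<psi>: "lam \<ge> 0" "\<psi> 0 = 0" "continuous_on {0..1} \<psi>" "\<psi> 1 \<ge> real k * pi"
    "\<And>s. s \<in> {0<..<1} \<Longrightarrow> (\<psi> has_real_derivative lam * a s * (cos (\<psi> s))\<^sup>2 + (sin (\<psi> s))\<^sup>2) (at s)"
    by (rule kth_eigenvalue_angle[OF ca a_pos lam]) blast+
  have \<psi>': "(\<psi> has_real_derivative lam * unit_ext a s * (cos (\<psi> s))\<^sup>2 + (sin (\<psi> s))\<^sup>2) (at s)" if "s \<in> {0<..<1}" for s
    using \<psi>(5)[OF that] that by (simp add: unit_ext_eq)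
  have f_neg': "\<And>s. 0 < s \<Longrightarrow> s < u0 \<Longrightarrow> f s < 0" and f_pos': "\<And>s. u0 < s \<Longrightarrow> 0 < f s"
    using f_neg f_pos by auto
  show ?thesis
  proof (cases "\<exists>ubar>u0. (LBINT s=u0..ubar. f s) = C_const a a' * (LBINT s=u0..0. f s)")
    case True
    then obtain ub where ub: "u0 < ub" "(LBINT s=u0..ub. f s) = C_const a a' * (LBINT s=u0..0. f s)" by blast
    obtain LA MA LG MG where "curvature_flow (pi/2) (unit_ext a) (truncate f u0 ub) u0 LA MA LG MG"
      and K: "0 \<le> MG" "\<And>u. truncate f u0 ub u * (u - u0) \<le> MG * ub"
      by (rule curvature_flow_exists[OF a_C1 a_pos u0_pos f_C1 f_zero f_neg f_pos ub(1), of "pi/2"]) auto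
    then interpret curvature_flow "pi/2" "unit_ext a" "truncate f u0 ub" u0 LA MA LG MG by simp
    define nn where "nn x = neg_part (a' x) / unit_ext a x" for x
    define pp where "pp x = pos_part (a' x) / unit_ext a x" for x
    have cu: "continuous_on {0..1} (unit_ext a)" using continuous_A[of "{0..1}" "\<lambda>x. x"] by simp
    have A_ne: "unit_ext a x \<noteq> 0" for x using A_bd(1)[of x] by simp
    have cn: "continuous_on {0..1} nn" "continuous_on {0..1} pp"
      unfolding nn_def pp_def neg_part_def pos_part_def
      by (intro continuous_on_divide continuous_on_max continuous_on_minus a_C1(2) continuous_on_const cu ballI A_ne)+
    define N where "N x = integral {0..x} nn" for x
    define P where "P x = integral {0..x} pp" for x
    interpret curvature_flow_energy "pi/2" "unit_ext a" "truncate f u0 ub" u0 LA MA LG MG a' N P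
    proof
      show "(unit_ext a has_real_derivative a' x) (at x within {0..1})" if "x \<in> {0..1}" for x
        by (rule unit_ext_deriv[OF a_C1(1) that])
      show "(N has_real_derivative neg_part (a' x) / unit_ext a x) (at x within {0..1})" if "x \<in> {0..1}" for x
        using integral_has_real_derivative[OF cn(1) that] by (simp add: N_def[abs_def] nn_def)
      show "(P has_real_derivative pos_part (a' x) / unit_ext a x) (at x within {0..1})" if "x \<in> {0..1}" for x
        using integral_has_real_derivative[OF cn(2) that] by (simp add: P_def[abs_def] pp_def)
    qed (simp_all add: N_def P_def)
    have N1: "(LBINT x=0..1. neg_part (a' x) / a x) = N 1"
    proof -
      have "(LBINT x=0..1. neg_part (a' x) / a x) = N 1 - N 0"
        unfolding zero_ereal_def one_ereal_def
      proof (rule LBINT_eq_diff)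
        show "continuous_on {min 0 1..max 0 1} (\<lambda>x. neg_part (a' x) / a x)"
          using continuous_on_eq[OF cn(1), of "\<lambda>x. neg_part (a' x) / a x"] by (simp add: nn_def unit_ext_eq)
        show "(N has_real_derivative neg_part (a' x) / a x) (at x within {min 0 1..max 0 1})"
          if "x \<in> {min 0 1..max 0 1}" for x
          using N'[of x] that by (simp add: unit_ext_eq)
      qed
      then show ?thesis by (simp add: N0)
    qed
    have P1: "(LBINT x=0..1. pos_part (a' x) / a x) = P 1"
    proof -
      have "(LBINT x=0..1. pos_part (a' x) / a x) = P 1 - P 0"
        unfolding zero_ereal_def one_ereal_def
      proof (rule LBINT_eq_diff)
        show "continuous_on {min 0 1..max 0 1} (\<lambda>x. pos_part (a' x) / a x)"
          using continuous_on_eq[OF cn(2), of "\<lambda>x. pos_part (a' x) / a x"] by (simp add: pp_def unit_ext_eq)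
        show "(P has_real_derivative pos_part (a' x) / a x) (at x within {min 0 1..max 0 1})"
          if "x \<in> {min 0 1..max 0 1}" for x
          using P'[of x] that by (simp add: unit_ext_eq)
      qed
      then show ?thesis by (simp add: P0)
    qed
    let ?C = "C_const a a'"
    have a1: "a 1 = a 0 * exp (P 1 - N 1)" using A_eq[of 1] by (simp add: unit_ext_eq)
    have a0: "a 0 > 0" using a_pos[of 0] by simp
    \<comment> \<open>As \<open>a 1 / a 0 = exp (P 1 - N 1)\<close>, the two entries of the maximum
      are \<open>exp (P 1)\<close>, which excludes the half turn, and \<open>exp (N 1)\<close>,
      which gives the upper bound.\<close>
    have "a 1 / a 0 * exp (N 1) = exp (P 1)" "a 0 / a 1 * exp (P 1) = exp (N 1)"
      using a0 by (simp_all add: a1 exp_diff)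
    then have C: "exp (P 1) \<le> ?C" "exp (N 1) \<le> ?C" unfolding C_const_def N1 P1 by simp_all
    have Fub: "F ub = ?C * F 0"
      using ub(2) F_truncate[OF refl ub(1) cf, of ub] F_truncate[OF refl ub(1) cf, of 0] ub(1) u0_pos
      by (simp add: zero_ereal_def)
    obtain \<delta> where \<delta>: "\<delta> > 0" "\<And>d. d \<noteq> u0 \<Longrightarrow> \<bar>d - u0\<bar> < \<delta> \<Longrightarrow> \<exists>s\<ge>0. X d s < 1 \<and> \<Theta> d s > real k * pi"
      by (rule rotation_near_u0[OF \<psi>(1-4) \<psi>' truncate_deriv[OF f_C1(1) u0_pos ub(1)] f'_gt])
         (use u0_pos in auto)
    obtain d s where d: "0 < d" "d \<le> ub" "\<sigma> * (d - u0) < 0" and s: "s > 0" "X d s = 1" "\<Theta> d s = real n * pi"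
    proof (rule shot[OF ub(1) n \<delta>(1) \<delta>(2) _ _ \<sigma>])
      fix d s assume "s \<ge> 0" "B d s = 0" "X d s \<le> 1"
      then show "s \<le> 1 + MA * (MG * ub)"
        using K ub(1) u0_pos by (intro arclength_bound) auto
    next
      fix s assume "0 \<le> s" "X ub s \<le> 1"
      then show "\<Theta> ub s < pi" by (intro no_half_turn[OF ub(1) Fub C(1)])
    qed blast+
    have du0: "d \<noteq> u0" using d(3) by auto
    \<comment> \<open>A curve started below \<open>u0\<close> has a horizontal point below
      \<open>u0\<close> at time 0. A curve started above \<open>u0\<close> descends from
      \<open>d \<le> ub\<close> until its first half turn, which is such a point.\<close>
    have "U d r \<le> ub" if r: "0 \<le> r" "r \<le> s" for r
    proof -
      have Xr: "X d r \<le> 1" using X_mono[OF r(2), of d] s by simp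
      show ?thesis
      proof (cases "d < u0")
        case True
        then show ?thesis
          using upper_bound_after_minimum[OF d(1) du0, of 0 r ub ?C] r Xr ub(1) Fub C(2) by simp
      next
        case False
        then have du: "u0 < d" using du0 by simp
        have "pi \<le> \<Theta> d s" using s(3) n by simp
        then obtain t where t: "0 \<le> t" "t \<le> s" "\<Theta> d t = pi"
          using half_turn_time[OF du0, of s pi] s(1) by auto
        obtain R where R: "\<And>q. 0 \<le> q \<Longrightarrow> q \<le> t \<Longrightarrow> U d q - u0 = R q * cos (\<Theta> d q)"
          "\<And>q. 0 \<le> q \<Longrightarrow> q \<le> t \<Longrightarrow> B d q = - R q * sin (\<Theta> d q)"
          "\<And>q. 0 \<le> q \<Longrightarrow> q \<le> t \<Longrightarrow> (d - u0) * R q > 0"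
          using polar[OF du0, of t] by metis
        have Rp: "R q > 0" if "0 \<le> q" "q \<le> t" for q
          using R(3)[OF that] du by (simp add: zero_less_mult_iff)
        show ?thesis
        proof (cases "r \<le> t")
          case True
          have "U d r \<le> U d 0"
          proof (rule DERIV_nonpos_imp_nonincreasing[OF r(1)])
            fix q assume "0 \<le> q" "q \<le> r"
            then have q: "0 \<le> q" "q \<le> t" using True by auto
            have "0 \<le> sin (\<Theta> d q)"
              using \<Theta>_mono[OF du0, of 0 q] \<Theta>_mono[OF du0 q] q t by (intro sin_ge_zero) auto
            then have "B d q \<le> 0" using R(2)[OF q] Rp[OF q] by simp
            then have "S (B d q) \<le> 0" using S_neg[of "B d q"] by (cases "B d q = 0") auto
            then show "\<exists>y. (U d has_real_derivative y) (at q) \<and> y \<le> 0" using deriv_U by blast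
          qed
          then show ?thesis using d by simp
        next
          case False
          have "U d t < u0" "B d t = 0" using R(1,2)[of t] Rp[of t] t by auto
          then show ?thesis
            using upper_bound_after_minimum[OF d(1) du0, of t r ub ?C] t False Xr ub(1) Fub C(2) by simp
        qed
      qed
    qed
    then have "\<exists>P. solution_curve a f (X d) (U d) (B d) (\<Theta> d) P u0 s \<sigma> n"
      by (intro solution_curve_of_shot[where ub=ub] d \<sigma> s n ca cf f_zero f_neg' f_pos' unit_ext_eq truncate_eq ub) auto
    then show ?thesis by blast
  next
    case False
    define m where "m = (SUP s\<in>{0..}. neg_part (f s))"
    have Bc: "(LBINT x=0..1. \<bar>a x\<bar>) * m < 1" using A_or_B False by (simp add: m_def)
    obtain M where M: "M \<ge> 0" "\<And>x. x \<in> {0..u0} \<Longrightarrow> \<bar>f x\<bar> \<le> M"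
      by (rule continuous_on_Icc_abs_bound[OF continuous_on_subset[OF cf, of "{0..u0}"]]) auto
    \<comment> \<open>The supremum over the half-line is finite because \<open>f\<close> is positive
      beyond \<open>u0\<close>.\<close>
    have "neg_part (f s) \<le> M" if "s \<in> {0..}" for s
    proof (cases "s \<le> u0")
      case True
      then show ?thesis using M that by (auto simp: neg_part_def abs_le_iff)
    next
      case False
      then show ?thesis using f_pos'[of s] M(1) by (simp add: neg_part_def)
    qed
    then have bdd: "bdd_above ((\<lambda>s. neg_part (f s)) ` {0..})" by (intro bdd_aboveI2)
    have fm: "neg_part (f s) \<le> m" if "s \<ge> 0" for s
      unfolding m_def by (rule cSUP_upper[OF _ bdd]) (use that in auto)
    have m0: "m \<ge> 0" using fm[of 0] by (simp add: neg_part_def f_zero)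
    have f_ge: "f s \<ge> - m" if "s \<ge> 0" for s using fm[OF that] by (simp add: neg_part_def)
    have cu: "continuous_on UNIV (unit_ext a)"
      unfolding unit_ext_def by (intro continuous_on_compose2[OF ca] continuous_intros continuous_on_max continuous_on_min) auto
    obtain J where J: "J 0 = 0" "\<And>x. (J has_real_derivative unit_ext a x) (at x)"
      using antiderivative_real[OF cu, of 0] by metis
    have J1: "(LBINT x=0..1. \<bar>a x\<bar>) = J 1"
    proof -
      have "(LBINT x=0..1. \<bar>a x\<bar>) = J 1 - J 0"
        unfolding zero_ereal_def one_ereal_def
      proof (rule LBINT_eq_diff)
        show "continuous_on {min 0 1..max 0 1} (\<lambda>x. \<bar>a x\<bar>)" using ca by (auto intro!: continuous_intros)
        fix x assume "x \<in> {min 0 1..max (0::real) 1}"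
        then have "\<bar>a x\<bar> = unit_ext a x" using a_pos[of x] by (simp add: unit_ext_eq)
        then show "(J has_real_derivative \<bar>a x\<bar>) (at x within {min 0 1..max 0 1})"
          using has_field_derivative_at_within[OF J(2)[of x]] by simp
      qed
      then show ?thesis by (simp add: J)
    qed
    have J1p: "J 1 \<ge> 0"
    proof -
      have "J 0 \<le> J 1"
      proof (rule DERIV_nonneg_imp_nondecreasing[of 0 1 J])
        fix x :: real assume "0 \<le> x" "x \<le> 1"
        then show "\<exists>y. (J has_real_derivative y) (at x) \<and> 0 \<le> y"
          using J(2)[of x] a_pos[of x] by (intro exI[of _ "unit_ext a x"]) (simp add: unit_ext_eq)
      qed simp
      then show ?thesis by (simp add: J)
    qed
    define q where "q = m * J 1"
    have q: "0 \<le> q" "q < 1" using Bc m0 J1p by (simp_all add: q_def J1 mult.commute)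
    \<comment> \<open>\<open>sin b\<close> is the midpoint between the flux bound \<open>q\<close>
      and 1.\<close>
    define b where "b = arcsin ((1 + q) / 2)"
    have b: "0 < b" "b < pi/2" "sin b = (1 + q) / 2"
      using q arcsin_lt_bounded[of "(1+q)/2"] arcsin_less_mono[of 0 "(1+q)/2"] by (auto simp: b_def)
    have small: "m * J 1 < sin b" using q b by (simp add: q_def)
    have cb: "cos b > 0" using b by (intro cos_gt_zero) auto
    \<comment> \<open>A curve crosses \<open>{0..1}\<close> in time at most \<open>1 / cos b\<close>
      and with vertical speed at most 1. So one that starts at \<open>ub\<close> stays above
      \<open>u0\<close>, and one that meets \<open>u0\<close> stays below \<open>ub\<close>.\<close>
    define ub where "ub = u0 + 1 / cos b + 1"
    have ub: "u0 < ub" using cb by (simp add: ub_def add_pos_pos)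
    have ub1: "1 / cos b + u0 < ub" by (simp add: ub_def)
    obtain LA MA LG MG where "curvature_flow b (unit_ext a) (truncate f u0 ub) u0 LA MA LG MG"
      by (rule curvature_flow_exists[OF a_C1 a_pos u0_pos f_C1 f_zero f_neg f_pos ub b(1)]) (use b in auto)
    then interpret curvature_flow b "unit_ext a" "truncate f u0 ub" u0 LA MA LG MG by simp
    obtain \<delta> where \<delta>: "\<delta> > 0" "\<And>d. d \<noteq> u0 \<Longrightarrow> \<bar>d - u0\<bar> < \<delta> \<Longrightarrow> \<exists>s\<ge>0. X d s < 1 \<and> \<Theta> d s > real k * pi"
      by (rule rotation_near_u0[OF \<psi>(1-4) \<psi>' truncate_deriv[OF f_C1(1) u0_pos ub] f'_gt])
         (use u0_pos in auto)
    have time: "s \<le> 1 / cos b" if "0 \<le> s" "X d s \<le> 1" for d s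
      using time_le[OF that(1), of d] that(2) cb by (simp add: field_simps)
    obtain d s where d: "0 < d" "d \<le> ub" "\<sigma> * (d - u0) < 0" and s: "s > 0" "X d s = 1" "\<Theta> d s = real n * pi"
    proof (rule shot[OF ub n \<delta>(1) \<delta>(2) _ _ \<sigma>])
      fix d s assume "s \<ge> 0" "B d s = 0" "X d s \<le> 1"
      then show "s \<le> 1 / cos b" by (intro time)
    next
      fix s assume s: "0 \<le> s" "X ub s \<le> 1"
      show "\<Theta> ub s < pi"
      proof (rule angle_lt_pi[OF ub s(1)])
        fix t assume t: "0 \<le> t" "t \<le> s"
        have "t \<le> 1 / cos b" using t s time[OF s] by simp
        then show "u0 < U ub t" using U_lip[OF t(1), of ub] ub1 unfolding init abs_le_iff by linarith
      qed
    qed blast+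
    have du0: "d \<noteq> u0" using d(3) by auto
    have Bs: "B d s = 0" using B_zero_angle[OF du0 _ s(3)] s(1) by simp
    have slope: "\<bar>B d r\<bar> < b" if "0 \<le> r" "r \<le> s" for r
    proof (rule small_slope[OF m0 _ J(1,2) _ s(2) Bs small that])
      fix u
      have w: "0 < (ub - u0) / (max u ub - u0)" "(ub - u0) / (max u ub - u0) \<le> 1"
        using truncate_weight[OF ub] by auto
      have "- m * 1 \<le> - m * ((ub - u0) / (max u ub - u0))"
        using w m0 by (intro mult_left_mono_neg) auto
      also have "\<dots> \<le> f (max 0 (min ub u)) * ((ub - u0) / (max u ub - u0))"
        using w f_ge[of "max 0 (min ub u)"] by (intro mult_right_mono) auto
      finally show "- m \<le> truncate f u0 ub u" by (simp add: truncate_def)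
    qed (use s in auto)
    have "pi / 2 \<le> \<Theta> d s"
    proof -
      have "pi / 2 \<le> pi" "1 * pi \<le> real n * pi" using n by (auto intro!: mult_right_mono)
      then show ?thesis using s(3) by simp
    qed
    moreover have "continuous_on {0..s} (\<Theta> d)" by (rule continuous_\<Theta>[OF du0]) auto
    ultimately obtain t where t: "0 \<le> t" "t \<le> s" "\<Theta> d t = pi / 2"
      using IVT'[of "\<Theta> d" 0 "pi/2" s] s(1) by auto
    obtain R where "U d t - u0 = R t * cos (\<Theta> d t)"
      using polar[OF du0, of t] t by (metis order_refl)
    then have Ut: "U d t = u0" using t by simp
    have "U d r \<le> ub" if r: "0 \<le> r" "r \<le> s" for r
    proof -
      have "\<bar>U d r - u0\<bar> \<le> \<bar>r - t\<bar>"
        using U_lip[of r t d] U_lip[of t r d] Ut by (cases "r \<le> t") auto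
      also have "\<dots> \<le> s" using r t by auto
      also have "\<dots> \<le> 1 / cos b" using time[of s d] s by simp
      finally show ?thesis using ub1 unfolding abs_le_iff by linarith
    qed
    then have "\<exists>P. solution_curve a f (X d) (U d) (B d) (\<Theta> d) P u0 s \<sigma> n"
      by (intro solution_curve_of_shot[where ub=ub] d \<sigma> s n ca cf f_zero f_neg' f_pos' unit_ext_eq truncate_eq ub)
         (use slope in auto)
    then show ?thesis by blast
  qed
qed

section \<open>A lower bound for the area\<close>

lemma set_integrable_mult_bounded:
  fixes v g :: "real \<Rightarrow> real"
  assumes v: "set_integrable lebesgue S v" and g: "set_borel_measurable lebesgue S g"
    and K: "\<And>x. x \<in> S \<Longrightarrow> \<bar>g x\<bar> \<le> K"
  shows "set_integrable lebesgue S (\<lambda>x. v x * g x)"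
proof -
  have i: "integrable lebesgue (\<lambda>x. K * norm (indicator S x *\<^sub>R v x))"
    using v unfolding set_integrable_def by (intro integrable_mult_right integrable_norm)
  have "(\<lambda>x. (indicator S x *\<^sub>R v x) * (indicator S x *\<^sub>R g x)) \<in> borel_measurable lebesgue"
    using v g unfolding set_integrable_def set_borel_measurable_def by (intro borel_measurable_times) auto
  moreover have "(indicator S x *\<^sub>R v x) * (indicator S x *\<^sub>R g x) = indicator S x *\<^sub>R (v x * g x)" for x
    by (auto simp: indicator_def)
  ultimately have m: "(\<lambda>x. indicator S x *\<^sub>R (v x * g x)) \<in> borel_measurable lebesgue" by (simp only:)
  have "norm (indicator S x *\<^sub>R (v x * g x)) \<le> norm (K * norm (indicator S x *\<^sub>R v x))" for x
  proof (cases "x \<in> S")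
    case True
    have "\<bar>v x\<bar> * \<bar>g x\<bar> \<le> \<bar>v x\<bar> * \<bar>K\<bar>" using K[OF True] by (intro mult_left_mono) auto
    then show ?thesis using True by (simp add: abs_mult mult.commute)
  qed auto
  then show ?thesis unfolding set_integrable_def by (intro Bochner_Integration.integrable_bound[OF i m]) auto
qed

lemma set_measurable_continuous_lebesgue:
  fixes g :: "real \<Rightarrow> real"
  assumes "continuous_on UNIV g"
  shows "set_borel_measurable lebesgue {0<..<1} g"
  unfolding set_borel_measurable_def
  by (intro borel_measurable_scaleR borel_measurable_indicator borel_measurable_continuous_onI[OF assms, THEN measurable_completion[of _ lborel borel, simplified]])
     (auto intro: measurable_completion)

lemma integrable_unit_indicator: "integrable lebesgue (indicat_real {0<..<1::real})"
  unfolding lmeasurable_iff_integrable[symmetric] by (intro lmeasurable_open) auto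

lemma set_integrable_bounded_lebesgue:
  fixes g :: "real \<Rightarrow> real"
  assumes "set_borel_measurable lebesgue {0<..<1} g" "\<And>x. x \<in> {0<..<1} \<Longrightarrow> \<bar>g x\<bar> \<le> K"
  shows "set_integrable lebesgue {0<..<1} g"
proof -
  have "integrable lebesgue (indicat_real {0<..<1::real})" by (rule integrable_unit_indicator)
  then have "set_integrable lebesgue {0<..<1} (\<lambda>_::real. 1::real)"
    unfolding set_integrable_def by simp
  from set_integrable_mult_bounded[OF this assms] show ?thesis by simp
qed

section \<open>Test functions and the supremum that defines the area\<close>

lemma C1cI:
  assumes "\<And>x. (w has_real_derivative w' x) (at x)" "continuous_on UNIV w'"
    "closure {x. w x \<noteq> 0} \<subseteq> {0<..<1}"
  shows "w \<in> C1c"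
proof -
  have "C_k_on 1 w UNIV" using assms(1,2) by (auto simp: One_nat_def intro!: exI[of _ w'])
  then show ?thesis using assms(3) by (simp add: C1c_def)
qed

lemma C1cD:
  assumes "w \<in> C1c"
  shows "(w has_real_derivative deriv w x) (at x)" "continuous_on UNIV (deriv w)" "continuous_on UNIV w"
    "x \<notin> {0<..<1} \<Longrightarrow> w x = 0"
    "\<exists>K. \<forall>x. \<bar>deriv w x\<bar> \<le> K"
proof -
  obtain w' where w': "\<And>x. (w has_real_derivative w' x) (at x)" "continuous_on UNIV w'"
  proof -
    have "C_k_on 1 w UNIV" using assms by (simp add: C1c_def)
    then show thesis using that by auto
  qed
  have e: "deriv w = w'" by (rule ext, rule DERIV_imp_deriv[OF w'(1)])
  show "(w has_real_derivative deriv w x) (at x)" "continuous_on UNIV (deriv w)" using w' by (auto simp: e)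
  show "continuous_on UNIV w"
    by (rule DERIV_continuous_on[OF has_field_derivative_at_within[OF w'(1)]])
  have supp: "closure {x. w x \<noteq> 0} \<subseteq> {0<..<1}" using assms by (simp add: C1c_def)
  then show "x \<notin> {0<..<1} \<Longrightarrow> w x = 0" using closure_subset[of "{x. w x \<noteq> 0}"] by auto
  obtain K where K: "\<And>x. x \<in> {0..1} \<Longrightarrow> \<bar>w' x\<bar> \<le> K"
    by (rule continuous_on_Icc_abs_bound[OF continuous_on_subset[OF w'(2), of "{0..1}"]]) auto
  have "w' x = 0" if "x \<notin> {0..1}" for x
  proof -
    have op: "open (- closure {x. w x \<noteq> 0})" by auto
    have xin: "x \<in> - closure {x. w x \<noteq> 0}" using supp that by auto
    have out: "w y = 0" if "y \<in> - closure {x. w x \<noteq> 0}" for y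
      using that closure_subset[of "{x. w x \<noteq> 0}"] by auto
    have "((\<lambda>_. 0) has_real_derivative w' x) (at x)"
      by (rule has_field_derivative_transform_within_open[OF w'(1) op xin]) (erule out)
    then show ?thesis by (rule DERIV_unique[OF _ DERIV_const])
  qed
  then have "\<bar>w' x\<bar> \<le> max K 0" for x using K[of x] by (cases "x \<in> {0..1}") auto
  then show "\<exists>K. \<forall>x. \<bar>deriv w x\<bar> \<le> K" by (auto simp: e)
qed

lemma C1c_integrable:
  assumes "w \<in> C1c" "set_integrable lebesgue {0<..<1} v"
  shows "set_integrable lebesgue {0<..<1} (\<lambda>x. v x * deriv w x)"
  using C1cD(2,5)[OF assms(1)] by (auto intro!: set_integrable_mult_bounded[OF assms(2)] set_measurable_continuous_lebesgue)

lemma set_integral_le_1: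
  assumes "set_integrable lebesgue {0<..<1} (g::real \<Rightarrow> real)" "\<And>x. g x \<le> 1"
  shows "(LINT x:{0<..<1}|lebesgue. g x) \<le> 1"
proof -
  have "set_integrable lebesgue {0<..<1} (\<lambda>_::real. 1::real)"
    using integrable_unit_indicator by (simp add: set_integrable_def)
  then have "(LINT x:{0<..<1}|lebesgue. g x) \<le> (LINT x::real:{0<..<1}|lebesgue. 1)"
    by (intro set_integral_mono assms)
  then show ?thesis by (simp add: set_lebesgue_integral_def measure_completion)
qed

lemma area_upper:
  assumes v: "v \<in> BV" and w: "w1 \<in> C1c" "w2 \<in> C1c" "\<And>x. (w1 x)\<^sup>2 + (w2 x)\<^sup>2 \<le> 1"
  shows "(LINT x:{0<..<1}|lebesgue. v x * deriv w1 x + w2 x) \<le> area v"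
  unfolding area_def
proof (rule cSup_upper)
  have vi: "set_integrable lebesgue {0<..<1} v" using v by (simp add: BV_def)
  obtain M where M: "\<And>w. w \<in> C1c \<Longrightarrow> (\<forall>x. \<bar>w x\<bar> \<le> 1) \<Longrightarrow> (LINT x:{0<..<1}|lebesgue. v x * deriv w x) \<le> M"
    using v by (auto simp: BV_def bdd_above_def)
  show "bdd_above {(LINT x:{0<..<1}|lebesgue. v x * deriv w1 x + w2 x) | w1 w2.
      w1 \<in> C1c \<and> w2 \<in> C1c \<and> (\<forall>x. (w1 x)\<^sup>2 + (w2 x)\<^sup>2 \<le> 1)}"
  proof (rule bdd_aboveI[of _ "M + 1"], clarify)
    fix w1 w2 assume w: "w1 \<in> C1c" "w2 \<in> C1c" "\<forall>x. (w1 x)\<^sup>2 + (w2 x)\<^sup>2 \<le> 1"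
    have b: "\<bar>w1 x\<bar> \<le> 1" "\<bar>w2 x\<bar> \<le> 1" for x
    proof -
      have "(w1 x)\<^sup>2 \<le> 1" "(w2 x)\<^sup>2 \<le> 1"
        using w(3) zero_le_power2[of "w1 x"] zero_le_power2[of "w2 x"] by (smt (verit))+
      then show "\<bar>w1 x\<bar> \<le> 1" "\<bar>w2 x\<bar> \<le> 1" by (simp_all add: abs_square_le_1)
    qed
    have i2: "set_integrable lebesgue {0<..<1} w2"
      using b(2) by (intro set_integrable_bounded_lebesgue set_measurable_continuous_lebesgue C1cD(3) w)
    have "(LINT x:{0<..<1}|lebesgue. v x * deriv w1 x + w2 x) =
        (LINT x:{0<..<1}|lebesgue. v x * deriv w1 x) + (LINT x:{0<..<1}|lebesgue. w2 x)"
      by (rule set_integral_add(2)[OF C1c_integrable[OF w(1) vi] i2])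
    also have "\<dots> \<le> M + 1"
      using M[OF w(1)] b set_integral_le_1[OF i2] by (intro add_mono) (auto intro: abs_le_D1)
    finally show "(LINT x:{0<..<1}|lebesgue. v x * deriv w1 x + w2 x) \<le> M + 1" .
  qed
qed (use w in blast)

text \<open>Shrinking all values towards 0 by \<open>e\<close> makes a continuous function vanish
  near its zeros, in particular near the ends, and leaves room below the bound 1, without raising
  the Lipschitz constant. Where the function is nonzero a small \<open>e\<close> only shifts it, so
  that derivatives survive.\<close>

definition soft :: "real \<Rightarrow> real \<Rightarrow> real" where "soft e y = max 0 (y - e) + min 0 (y + e)"

lemma soft:
  assumes "0 < e"
  shows "\<bar>soft e y - soft e z\<bar> \<le> \<bar>y - z\<bar>" "\<bar>soft e y - y\<bar> \<le> e" "\<bar>y\<bar> \<le> e \<Longrightarrow> soft e y = 0"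
    "\<bar>y\<bar> \<le> 1 \<Longrightarrow> e \<le> 1 \<Longrightarrow> \<bar>soft e y\<bar> \<le> 1 - e"
    "e < y \<Longrightarrow> soft e y = y - e" "y < - e \<Longrightarrow> soft e y = y + e"
  using assms by (auto simp: soft_def max_def min_def)

lemma vanish_near_ends:
  fixes w :: "real \<Rightarrow> real"
  assumes lip: "\<And>s t. \<bar>w s - w t\<bar> \<le> K * \<bar>s - t\<bar>" and out: "\<And>t. t \<notin> {0<..<1} \<Longrightarrow> w t = 0"
    and K: "0 < K" and ne: "e < \<bar>w t\<bar>" "0 < e"
  shows "e / K < t" "t < 1 - e / K"
proof -
  have "t \<in> {0<..<1}" using out[of t] ne by fastforce
  moreover have "e < K * \<bar>t - 0\<bar>" "e < K * \<bar>t - 1\<bar>"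
    using lip[of t 0] lip[of t 1] out[of 0] out[of 1] ne by auto
  ultimately show "e / K < t" "t < 1 - e / K" using K by (auto simp: field_simps)
qed

text \<open>The witness is the Steklov average of the soft threshold of \<open>w\<close>.\<close>

lemma test_function:
  fixes w :: "real \<Rightarrow> real"
  assumes lip: "\<And>s t. \<bar>w s - w t\<bar> \<le> K * \<bar>s - t\<bar>" and bd: "\<And>t. \<bar>w t\<bar> \<le> 1"
    and out: "\<And>t. t \<notin> {0<..<1} \<Longrightarrow> w t = 0" and K: "0 < K" and e: "0 < e" "e \<le> 1"
  obtains w1 where "w1 \<in> C1c" "\<And>t. \<bar>w1 t\<bar> \<le> 1 - e" "\<And>t. \<bar>w1 t - w t\<bar> \<le> 2 * e"
    "\<And>t. deriv w1 t = (soft e (w (t + e / (2 * K))) - soft e (w t)) / (e / (2 * K))"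
    "\<And>t. \<bar>deriv w1 t\<bar> \<le> K"
proof -
  \<comment> \<open>The thresholded function vanishes within \<open>e / K = 2 * h\<close> of both
    ends, so its average over \<open>{t..t + h}\<close> vanishes for \<open>t\<close> outside
    \<open>{h..1-h}\<close>.\<close>
  define h where "h = e / (2 * K)"
  have h: "h > 0" "K * h = e / 2" using e K by (auto simp: h_def)
  define z where "z t = soft e (w t)" for t
  have zl: "\<bar>z s - z t\<bar> \<le> K * \<bar>s - t\<bar>" for s t
    unfolding z_def using soft(1)[OF e(1)] lip order_trans by blast
  have cz: "continuous_on UNIV z"
    by (rule lipschitz_on_continuous_on[of K]) (use zl K in \<open>auto simp: lipschitz_on_def dist_real_def\<close>)
  obtain Q where Q: "\<And>x. (Q has_real_derivative z x) (at x)"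
    using antiderivative_real[OF cz, of 0] by metis
  define w1 where "w1 t = (Q (t + h) - Q t) / h" for t
  have d1: "(w1 has_real_derivative (z (t + h) - z t) / h) (at t)" for t
  proof -
    have "((\<lambda>t. Q (t + h)) has_real_derivative z (t + h)) (at t)"
      using Q[of "t + h"] by (simp add: DERIV_shift)
    then show ?thesis unfolding w1_def using Q by (intro DERIV_cdivide DERIV_diff)
  qed
  have mean: "\<bar>(Q (t + h) - Q t) - c * h\<bar> \<le> B * h" if "\<And>s. t \<le> s \<Longrightarrow> s \<le> t + h \<Longrightarrow> \<bar>z s - c\<bar> \<le> B" for t c B
  proof -
    have "norm ((Q (t + h) - c * (t + h)) - (Q t - c * t)) \<le> B * norm (t + h - t)"
    proof (rule field_differentiable_bound[of "{t..t+h}"])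
      show "((\<lambda>s. Q s - c * s) has_real_derivative z s - c) (at s within {t..t + h})" for s
        by (rule has_field_derivative_at_within) (auto intro!: derivative_eq_intros Q)
    qed (use that h(1) in auto)
    then show ?thesis using h(1) by (simp add: algebra_simps)
  qed
  have zb: "\<bar>z s\<bar> \<le> 1 - e" for s unfolding z_def using soft(4)[OF e(1) bd e(2)] .
  have w1b: "\<bar>w1 t\<bar> \<le> 1 - e" for t
    using mean[of t 0 "1 - e"] zb h by (simp add: w1_def field_simps)
  have w1w: "\<bar>w1 t - w t\<bar> \<le> 2 * e" for t
  proof -
    have le: "\<bar>(Q (t + h) - Q t) - w t * h\<bar> \<le> (2 * e) * h"
    proof (rule mean)
      fix s assume s: "t \<le> s" "s \<le> t + h"
      have "\<bar>z s - w s\<bar> \<le> e" unfolding z_def by (rule soft(2)[OF e(1)])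
      moreover have "K * \<bar>s - t\<bar> \<le> K * h" using s K by (intro mult_left_mono) auto
      ultimately show "\<bar>z s - w t\<bar> \<le> 2 * e" using lip[of s t] h e by linarith
    qed
    have "w1 t - w t = ((Q (t + h) - Q t) - w t * h) / h" using h(1) by (simp add: w1_def field_simps)
    then have "\<bar>w1 t - w t\<bar> = \<bar>(Q (t + h) - Q t) - w t * h\<bar> / h" using h(1) by simp
    also have "\<dots> \<le> (2 * e) * h / h" using le h(1) by (intro divide_right_mono) auto
    finally show ?thesis using h(1) by simp
  qed
  have supp: "{t. w1 t \<noteq> 0} \<subseteq> {h..1-h}"
  proof
    fix t assume t: "t \<in> {t. w1 t \<noteq> 0}"
    show "t \<in> {h..1-h}"
    proof (rule ccontr)
      assume nt: "t \<notin> {h..1-h}"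
      have ek: "e / K = 2 * h" by (simp add: h_def)
      have "z s = 0" if s: "t \<le> s" "s \<le> t + h" for s
      proof (rule ccontr)
        assume "z s \<noteq> 0"
        then have "e < \<bar>w s\<bar>" using soft(3)[OF e(1), of "w s"] by (force simp: z_def)
        from vanish_near_ends[OF lip out K this e(1)] show False using nt s h by (auto simp: ek)
      qed
      then have "\<bar>(Q (t + h) - Q t) - 0 * h\<bar> \<le> 0 * h" by (intro mean) auto
      then show False using t by (simp add: w1_def)
    qed
  qed
  have "closure {t. w1 t \<noteq> 0} \<subseteq> {h..1-h}" using supp by (intro closure_minimal) auto
  also have "\<dots> \<subseteq> {0<..<1}" using h by auto
  finally have "closure {t. w1 t \<noteq> 0} \<subseteq> {0<..<1}" .
  moreover have "continuous_on UNIV (\<lambda>t. (z (t + h) - z t) / h)"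
    by (intro continuous_intros continuous_on_compose2[OF cz]) (use h in auto)
  ultimately have "w1 \<in> C1c" using d1 by (intro C1cI)
  moreover have dw: "deriv w1 t = (z (t + h) - z t) / h" for t by (rule DERIV_imp_deriv[OF d1])
  moreover have "\<bar>deriv w1 t\<bar> \<le> K" for t
    unfolding dw using zl[of "t + h" t] h by (simp add: field_simps)
  ultimately show thesis using that[of w1] w1b w1w by (simp add: z_def h_def)
qed

text \<open>The bound \<open>1 - e\<close> keeps the argument of the square root away from 0. The
  factor \<open>q / (e + q)\<close> is a C1 cut-off, zero where \<open>t * (1 - t) \<le> e\<close>,
  which tends to 1 at every point of \<open>(0, 1)\<close> as \<open>e\<close> tends to 0.\<close>

lemma test_function_2:
  fixes w1 :: "real \<Rightarrow> real"
  assumes w1: "w1 \<in> C1c" "\<And>t. \<bar>w1 t\<bar> \<le> 1 - e" and e: "0 < e"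
  defines "q \<equiv> \<lambda>t. (max 0 (t * (1 - t) - e))\<^sup>2"
  shows "(\<lambda>t. q t / (e + q t) * sqrt (1 - (w1 t)\<^sup>2)) \<in> C1c"
proof -
  have pos: "0 < 1 - (w1 t)\<^sup>2" for t
  proof -
    have "\<bar>w1 t\<bar> < 1" using w1(2)[of t] e by simp
    then show ?thesis by (simp add: abs_square_less_1)
  qed
  have eq0: "0 < e + q t" for t using e by (simp add: q_def add_pos_nonneg)
  \<comment> \<open>Squaring smooths the corner of the positive part: at 0 the difference quotient
    is bounded by \<open>\<bar>h\<bar>\<close>.\<close>
  have dsq: "((\<lambda>y. (max 0 y)\<^sup>2) has_real_derivative 2 * max 0 y) (at y)" for y :: real
  proof -
    consider "y > 0" | "y < 0" | "y = 0" by linarith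
    then show ?thesis
    proof cases
      case 1
      have "((\<lambda>y. y\<^sup>2) has_real_derivative 2 * max 0 y) (at y)" using 1 by (auto intro!: derivative_eq_intros)
      then show ?thesis
        by (rule has_field_derivative_transform_within_open[of _ _ _ "{0<..}"]) (use 1 in auto)
    next
      case 2
      have "((\<lambda>y. 0) has_real_derivative 2 * max 0 y) (at y)" using 2 by (auto intro!: derivative_eq_intros)
      then show ?thesis
        by (rule has_field_derivative_transform_within_open[of _ _ _ "{..<0}"]) (use 2 in auto)
    next
      case 3
      have "((\<lambda>h::real. (max 0 h)\<^sup>2 / h) \<longlongrightarrow> 0) (at 0)"
      proof (rule Lim_null_comparison[where g="\<lambda>h::real. \<bar>h\<bar>"])
        show "\<forall>\<^sub>F h::real in at 0. norm ((max 0 h)\<^sup>2 / h) \<le> \<bar>h\<bar>"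
          by (rule always_eventually) (auto simp: max_def power2_eq_square)
      qed (auto intro!: tendsto_eq_intros)
      then show ?thesis using 3 by (simp add: DERIV_def)
    qed
  qed
  define q' where "q' t = 2 * max 0 (t * (1 - t) - e) * (1 - 2 * t)" for t
  have dq: "(q has_real_derivative q' t) (at t)" for t
    unfolding q_def q'_def by (rule DERIV_chain2[OF dsq]) (auto intro!: derivative_eq_intros)
  have cq: "continuous_on UNIV q" "continuous_on UNIV q'"
    unfolding q_def q'_def by (intro continuous_intros continuous_on_max)+
  define D where "D t = (q' t * (e + q t) - q t * q' t) / ((e + q t) * (e + q t)) * sqrt (1 - (w1 t)\<^sup>2)
      + (- (2 * w1 t * deriv w1 t)) * (inverse (sqrt (1 - (w1 t)\<^sup>2)) / 2) * (q t / (e + q t))" for t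
  have d: "((\<lambda>t. q t / (e + q t) * sqrt (1 - (w1 t)\<^sup>2)) has_real_derivative D t) (at t)" for t
  proof -
    have 1: "((\<lambda>t. q t / (e + q t)) has_real_derivative (q' t * (e + q t) - q t * q' t) / ((e + q t) * (e + q t))) (at t)"
      using eq0[of t] by (auto intro!: derivative_eq_intros dq)
    have 2: "((\<lambda>t. 1 - (w1 t)\<^sup>2) has_real_derivative - (2 * w1 t * deriv w1 t)) (at t)"
      using C1cD(1)[OF w1(1)] by (auto intro!: derivative_eq_intros)
    have 3: "((\<lambda>t. sqrt (1 - (w1 t)\<^sup>2)) has_real_derivative (- (2 * w1 t * deriv w1 t)) * (inverse (sqrt (1 - (w1 t)\<^sup>2)) / 2)) (at t)"
      using DERIV_chain2[OF DERIV_real_sqrt[OF pos] 2] by (simp add: mult.commute)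
    show ?thesis unfolding D_def by (rule DERIV_mult[OF 1 3])
  qed
  have "continuous_on UNIV D"
    unfolding D_def using eq0 pos
    by (intro continuous_intros cq C1cD(2,3)[OF w1(1)]) (auto simp: less_imp_neq[THEN not_sym])
  moreover have "closure {t. q t / (e + q t) * sqrt (1 - (w1 t)\<^sup>2) \<noteq> 0} \<subseteq> {0<..<1}"
  proof -
    have "{t. q t / (e + q t) * sqrt (1 - (w1 t)\<^sup>2) \<noteq> 0} \<subseteq> {t. e \<le> t * (1 - t)}"
      by (auto simp: q_def max_def)
    moreover have "closed {t::real. e \<le> t * (1 - t)}"
      by (intro closed_Collect_le continuous_intros)
    ultimately have "closure {t. q t / (e + q t) * sqrt (1 - (w1 t)\<^sup>2) \<noteq> 0} \<subseteq> {t. e \<le> t * (1 - t)}"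
      by (rule closure_minimal)
    also have "\<dots> \<subseteq> {0<..<1}"
    proof
      fix t assume "t \<in> {t. e \<le> t * (1 - t)}"
      then have "0 < t * (1 - t)" using e by simp
      then show "t \<in> {0<..<1}" by (auto simp: zero_less_mult_iff)
    qed
    finally show ?thesis .
  qed
  ultimately show ?thesis using d by (intro C1cI)
qed

lemma area_lower_bound:
  fixes w w' v :: "real \<Rightarrow> real"
  assumes lip: "\<And>s t. \<bar>w s - w t\<bar> \<le> K * \<bar>s - t\<bar>" and bd: "\<And>t. \<bar>w t\<bar> \<le> 1"
    and out: "\<And>t. t \<notin> {0<..<1} \<Longrightarrow> w t = 0" and K: "0 < K"
    and fin: "finite N" "\<And>t. t \<in> {0<..<1} - N \<Longrightarrow> w t \<noteq> 0"
    and d: "\<And>t. t \<in> {0<..<1} - N \<Longrightarrow> (w has_real_derivative w' t) (at t)"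
    and m: "set_borel_measurable lebesgue {0<..<1} w'" and v: "v \<in> BV"
  shows "(LINT t:{0<..<1}|lebesgue. - (v t * w' t) + sqrt (1 - (w t)\<^sup>2)) \<le> area v"
proof -
  define e where "e k = 1 / (real k + 2)" for k
  have e: "0 < e k" "e k \<le> 1" for k by (auto simp: e_def)
  have e0: "e \<longlonglongrightarrow> 0" unfolding e_def by real_asymp
  have "\<exists>w1. w1 \<in> C1c \<and> (\<forall>t. \<bar>w1 t\<bar> \<le> 1 - e k) \<and> (\<forall>t. \<bar>w1 t - w t\<bar> \<le> 2 * e k) \<and>
    (\<forall>t. deriv w1 t = (soft (e k) (w (t + e k / (2 * K))) - soft (e k) (w t)) / (e k / (2 * K))) \<and>
    (\<forall>t. \<bar>deriv w1 t\<bar> \<le> K)" for k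
    by (rule test_function[OF lip bd out K e(1)[of k] e(2)[of k]], assumption, intro exI conjI allI)
  then obtain w1 where w1: "\<And>k. w1 k \<in> C1c" "\<And>k t. \<bar>w1 k t\<bar> \<le> 1 - e k" "\<And>k t. \<bar>w1 k t - w t\<bar> \<le> 2 * e k"
    "\<And>k t. deriv (w1 k) t = (soft (e k) (w (t + e k / (2 * K))) - soft (e k) (w t)) / (e k / (2 * K))"
    "\<And>k t. \<bar>deriv (w1 k) t\<bar> \<le> K"
    by metis
  define q where "q k t = (max 0 (t * (1 - t) - e k))\<^sup>2" for k and t :: real
  define w2 where "w2 k t = q k t / (e k + q k t) * sqrt (1 - (w1 k t)\<^sup>2)" for k t
  have w2: "w2 k \<in> C1c" for k
    using test_function_2[OF w1(1,2) e(1), of k] by (simp add: w2_def[abs_def] q_def)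
  have q: "0 \<le> q k t / (e k + q k t)" "q k t / (e k + q k t) \<le> 1" for k t
    using e(1)[of k] by (auto simp: q_def add_pos_nonneg)
  have w1sq: "(w1 k t)\<^sup>2 \<le> 1" for k t
    using w1(2)[of k t] e(1)[of k] by (simp add: abs_square_le_1)
  have w2b: "(w2 k t)\<^sup>2 \<le> 1 - (w1 k t)\<^sup>2" for k t
  proof -
    have "(w2 k t)\<^sup>2 = (q k t / (e k + q k t))\<^sup>2 * (1 - (w1 k t)\<^sup>2)"
      unfolding w2_def power_mult_distrib using w1sq[of k t] by simp
    also have "\<dots> \<le> 1 * (1 - (w1 k t)\<^sup>2)"
      using q[of k t] w1sq[of k t] by (intro mult_right_mono) (auto simp: power_le_one)
    finally show ?thesis by simp
  qed
  have w2a: "\<bar>w2 k t\<bar> \<le> 1" for k t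
  proof -
    have "(w2 k t)\<^sup>2 \<le> 1" using w2b[of k t] zero_le_power2[of "w1 k t"] by linarith
    then show ?thesis by (simp add: abs_square_le_1)
  qed
  have neg: "(\<lambda>t. - w1 k t) \<in> C1c" "deriv (\<lambda>t. - w1 k t) t = - deriv (w1 k) t" for k t
  proof -
    have dn: "((\<lambda>t. - w1 k t) has_real_derivative - deriv (w1 k) t) (at t)" for t
      by (intro DERIV_minus C1cD(1) w1)
    show "deriv (\<lambda>t. - w1 k t) t = - deriv (w1 k) t" by (rule DERIV_imp_deriv[OF dn])
    have "continuous_on UNIV (\<lambda>t. - deriv (w1 k) t)" by (intro continuous_intros C1cD(2) w1)
    moreover have "closure {t. - w1 k t \<noteq> 0} \<subseteq> {0<..<1}" using w1(1)[of k] by (simp add: C1c_def)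
    ultimately show "(\<lambda>t. - w1 k t) \<in> C1c" using dn by (intro C1cI)
  qed
  have vi: "set_integrable lebesgue {0<..<1} v" using v by (simp add: BV_def)
  have le: "(LINT t:{0<..<1}|lebesgue. - (v t * deriv (w1 k) t) + w2 k t) \<le> area v" for k
  proof -
    have "(LINT t:{0<..<1}|lebesgue. v t * deriv (\<lambda>t. - w1 k t) t + w2 k t) \<le> area v"
      by (rule area_upper[OF v neg(1) w2]) (use w2b in \<open>simp add: algebra_simps\<close>)
    then show ?thesis by (simp add: neg(2))
  qed
  have lim1: "(\<lambda>k. deriv (w1 k) t) \<longlonglongrightarrow> w' t" if t: "t \<in> {0<..<1} - N" for t
  proof -
    define h where "h k = e k / (2 * K)" for k
    have h: "h k > 0" for k using e(1) K by (simp add: h_def)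
    have "h \<longlonglongrightarrow> 0" unfolding h_def using tendsto_divide_zero[OF e0] by simp
    then have "filterlim h (at 0) sequentially"
      using h by (intro filterlim_atI) (auto intro!: always_eventually less_imp_neq[THEN not_sym])
    moreover have "((\<lambda>h. (w (t + h) - w t) / h) \<longlongrightarrow> w' t) (at 0)" using d[OF t] by (simp add: DERIV_def)
    ultimately have l: "(\<lambda>k. (w (t + h k) - w t) / h k) \<longlonglongrightarrow> w' t" by (rule filterlim_compose[rotated])
    \<comment> \<open>As \<open>K * h k = e k / 2\<close>, a threshold below
      \<open>\<bar>w t\<bar> / 2\<close> leaves \<open>w t\<close> and \<open>w (t + h k)\<close>
      beyond it on the same side, where \<open>soft\<close> is a translation and the difference
      quotients agree.\<close>
    have "w t \<noteq> 0" using fin(2)[OF t] .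
    then have "\<forall>\<^sub>F k in sequentially. 2 * e k < \<bar>w t\<bar>"
      using order_tendstoD(2)[OF tendsto_mult_right_zero[OF e0, of 2]] by simp
    then have "\<forall>\<^sub>F k in sequentially. (w (t + h k) - w t) / h k = deriv (w1 k) t"
    proof eventually_elim
      case (elim k)
      have "K * \<bar>t + h k - t\<bar> = e k / 2" using h[of k] K e(1)[of k] by (simp add: h_def)
      then have "\<bar>w (t + h k) - w t\<bar> \<le> e k / 2" using lip[of "t + h k" t] by simp
      then have near: "w t - e k / 2 \<le> w (t + h k)" "w (t + h k) \<le> w t + e k / 2" by linarith+
      have ek: "0 < e k" by (rule e)
      have "soft (e k) (w (t + h k)) - soft (e k) (w t) = w (t + h k) - w t"
      proof (cases "w t > 0")
        case True
        then have "e k < w t" "e k < w (t + h k)" using elim near ek by linarith+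
        then show ?thesis using soft(5)[OF ek] by simp
      next
        case False
        then have "w t < - e k" "w (t + h k) < - e k" using elim near ek by linarith+
        then show ?thesis using soft(6)[OF ek] by simp
      qed
      then show ?case by (simp add: w1(4) h_def)
    qed
    then show ?thesis by (rule Lim_transform_eventually[OF l])
  qed
  have lim2: "(\<lambda>k. w2 k t) \<longlonglongrightarrow> sqrt (1 - (w t)\<^sup>2)" if t: "t \<in> {0<..<1}" for t
  proof -
    have "(\<lambda>k. w1 k t - w t) \<longlonglongrightarrow> 0"
      by (rule Lim_null_comparison[where g="\<lambda>k. 2 * e k"])
         (use w1(3) tendsto_mult_right_zero[OF e0, of 2] in auto)
    then have l1: "(\<lambda>k. w1 k t) \<longlonglongrightarrow> w t" by (simp add: LIM_zero_iff)
    have tt: "t * (1 - t) > 0" using t by simp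
    have lq: "(\<lambda>k. q k t) \<longlonglongrightarrow> (max 0 (t * (1 - t) - 0))\<^sup>2"
      unfolding q_def by (intro tendsto_intros tendsto_max e0)
    have "(\<lambda>k. q k t / (e k + q k t) * sqrt (1 - (w1 k t)\<^sup>2)) \<longlonglongrightarrow>
        (max 0 (t * (1 - t) - 0))\<^sup>2 / (0 + (max 0 (t * (1 - t) - 0))\<^sup>2) * sqrt (1 - (w t)\<^sup>2)"
      using tt by (intro tendsto_intros lq e0 l1) auto
    moreover have "t \<noteq> 0" "t \<noteq> 1" using t by auto
    ultimately show ?thesis using tt by (simp add: w2_def)
  qed
  have "(\<lambda>k. LINT t:{0<..<1}|lebesgue. - (v t * deriv (w1 k) t) + w2 k t) \<longlonglongrightarrow>
      (LINT t:{0<..<1}|lebesgue. - (v t * w' t) + sqrt (1 - (w t)\<^sup>2))"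
    unfolding set_lebesgue_integral_def
  proof (rule integral_dominated_convergence[where w="\<lambda>t. norm (indicator {0<..<1} t *\<^sub>R v t) * K + indicator {0<..<1} t"])
    have mw: "set_borel_measurable lebesgue {0<..<1} (\<lambda>t. sqrt (1 - (w t)\<^sup>2))"
    proof (rule set_measurable_continuous_lebesgue)
      have "continuous_on UNIV w"
        by (rule lipschitz_on_continuous_on[of K]) (use lip K in \<open>auto simp: lipschitz_on_def dist_real_def\<close>)
      then show "continuous_on UNIV (\<lambda>t. sqrt (1 - (w t)\<^sup>2))" by (intro continuous_intros)
    qed
    have meas: "(\<lambda>t. indicator {0<..<1} t *\<^sub>R (- (v t * g t) + p t)) \<in> borel_measurable lebesgue"
      if "set_borel_measurable lebesgue {0<..<1} g" "set_borel_measurable lebesgue {0<..<1} p" for g p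
    proof -
      have "(\<lambda>t. - ((indicator {0<..<1} t *\<^sub>R v t) * (indicator {0<..<1} t *\<^sub>R g t)) + indicator {0<..<1} t *\<^sub>R p t)
          \<in> borel_measurable lebesgue"
        using vi that unfolding set_integrable_def set_borel_measurable_def
        by (intro borel_measurable_add borel_measurable_uminus borel_measurable_times) auto
      moreover have "- ((indicator {0<..<1} t *\<^sub>R v t) * (indicator {0<..<1} t *\<^sub>R g t)) + indicator {0<..<1} t *\<^sub>R p t
          = indicator {0<..<1} t *\<^sub>R (- (v t * g t) + p t)" for t
        by (auto simp: indicator_def)
      ultimately show ?thesis by simp
    qed
    show "(\<lambda>t. indicator {0<..<1} t *\<^sub>R (- (v t * w' t) + sqrt (1 - (w t)\<^sup>2))) \<in> borel_measurable lebesgue"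
      by (rule meas[OF m mw])
    show "(\<lambda>t. indicator {0<..<1} t *\<^sub>R (- (v t * deriv (w1 k) t) + w2 k t)) \<in> borel_measurable lebesgue" for k
      by (intro meas set_measurable_continuous_lebesgue C1cD w1 w2)
    show "integrable lebesgue (\<lambda>t. norm (indicator {0<..<1} t *\<^sub>R v t) * K + indicator {0<..<1} t)"
      using vi unfolding set_integrable_def
      by (intro Bochner_Integration.integrable_add integrable_mult_left integrable_norm) (auto simp: integrable_completion)
    have "AE t in lebesgue. t \<notin> N"
      using fin(1) by (intro AE_not_in) (simp add: countable_finite countable_imp_null_set_lborel null_sets_completionI)
    then show "AE t in lebesgue. (\<lambda>k. indicator {0<..<1} t *\<^sub>R (- (v t * deriv (w1 k) t) + w2 k t)) \<longlonglongrightarrow>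
        indicator {0<..<1} t *\<^sub>R (- (v t * w' t) + sqrt (1 - (w t)\<^sup>2))"
    proof eventually_elim
      case (elim t)
      show ?case
      proof (cases "t \<in> {0<..<1}")
        case True
        then show ?thesis using elim by (intro tendsto_intros lim1 lim2) auto
      qed auto
    qed
    show "AE t in lebesgue. norm (indicator {0<..<1} t *\<^sub>R (- (v t * deriv (w1 k) t) + w2 k t)) \<le>
        norm (indicator {0<..<1} t *\<^sub>R v t) * K + indicator {0<..<1} t" for k
    proof (rule AE_I2)
      fix t
      have "\<bar>- (v t * deriv (w1 k) t) + w2 k t\<bar> \<le> \<bar>v t\<bar> * \<bar>deriv (w1 k) t\<bar> + \<bar>w2 k t\<bar>"
        unfolding abs_mult[symmetric] by linarith
      also have "\<dots> \<le> \<bar>v t\<bar> * K + 1" by (intro add_mono mult_left_mono w1 w2a) auto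
      finally show "norm (indicator {0<..<1} t *\<^sub>R (- (v t * deriv (w1 k) t) + w2 k t)) \<le>
        norm (indicator {0<..<1} t *\<^sub>R v t) * K + indicator {0<..<1} t"
        by (auto simp: indicator_def)
    qed
  qed
  then show ?thesis by (rule LIMSEQ_le_const2) (use le in auto)
qed

section \<open>The function described by a solution curve\<close>

text \<open>The slope of \<open>u\<close> against \<open>x\<close> is the quotient of two difference
  quotients in \<open>s\<close>, of which the upper one tends to \<open>e\<close> and the lower one
  to 0 from above.\<close>

lemma quotient_blowup:
  fixes u x :: "real \<Rightarrow> real"
  assumes u: "(u has_real_derivative e) (at s)" and e: "e = 1 \<or> e = - 1"
    and x: "(x has_real_derivative 0) (at s)" and F: "F \<le> at s"
    and pos: "\<forall>\<^sub>F y in F. 0 < (x y - x s) / (y - s)"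
  shows "filterlim (\<lambda>y. e * ((u y - u s) / (x y - x s))) at_top F"
proof -
  have 1: "((\<lambda>y. e * ((u y - u s) / (y - s))) \<longlongrightarrow> e * e) F"
    by (intro tendsto_mult tendsto_const tendsto_mono[OF F]) (use u in \<open>simp add: has_field_derivative_iff\<close>)
  have "((\<lambda>y. (x y - x s) / (y - s)) \<longlongrightarrow> 0) F"
    by (rule tendsto_mono[OF F]) (use x in \<open>simp add: has_field_derivative_iff\<close>)
  from filterlim_inverse_at_top[OF this pos]
  have "LIM y F. e * ((u y - u s) / (y - s)) * inverse ((x y - x s) / (y - s)) :> at_top"
    by (rule filterlim_tendsto_pos_mult_at_top[OF 1, rotated]) (use e in auto)
  moreover have "\<forall>\<^sub>F y in F. e * ((u y - u s) / (y - s)) * inverse ((x y - x s) / (y - s)) = e * ((u y - u s) / (x y - x s))"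
    using pos
  proof eventually_elim
    case (elim y)
    have "d \<noteq> 0 \<Longrightarrow> e * (A / d) * inverse (B / d) = e * (A / B)" for A B d :: real by (simp add: field_simps)
    then show ?case using elim by (cases "y = s") auto
  qed
  ultimately show ?thesis by (subst (asm) filterlim_cong[OF refl refl]) auto
qed

lemma Dini_of_blowup:
  fixes q :: "real \<Rightarrow> real"
  assumes "filterlim (\<lambda>y. e * q y) at_top F" "F \<noteq> bot"
  shows "e = 1 \<Longrightarrow> Limsup F (\<lambda>y. ereal (q y)) = \<infinity> \<and> Liminf F (\<lambda>y. ereal (q y)) = \<infinity>"
    and "e = - 1 \<Longrightarrow> Limsup F (\<lambda>y. ereal (q y)) = - \<infinity> \<and> Liminf F (\<lambda>y. ereal (q y)) = - \<infinity>"
proof -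
  show "Limsup F (\<lambda>y. ereal (q y)) = \<infinity> \<and> Liminf F (\<lambda>y. ereal (q y)) = \<infinity>" if "e = 1"
  proof -
    have "((\<lambda>y. ereal (q y)) \<longlongrightarrow> \<infinity>) F" using assms(1) that by (simp add: tendsto_PInfty_eq_at_top)
    then show ?thesis using assms(2) by (simp add: lim_imp_Limsup lim_imp_Liminf)
  qed
  show "Limsup F (\<lambda>y. ereal (q y)) = - \<infinity> \<and> Liminf F (\<lambda>y. ereal (q y)) = - \<infinity>" if "e = - 1"
  proof -
    have "((\<lambda>y. ereal (- q y)) \<longlongrightarrow> \<infinity>) F" using assms(1) that by (simp add: tendsto_PInfty_eq_at_top)
    then have "((\<lambda>y. - ereal (- q y)) \<longlongrightarrow> - \<infinity>) F" by (rule tendsto_uminus_ereal)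
    then have "((\<lambda>y. ereal (q y)) \<longlongrightarrow> - \<infinity>) F" by simp
    then show ?thesis using assms(2) by (simp add: lim_imp_Limsup lim_imp_Liminf)
  qed
qed

lemma cos_sin_half_turns:
  "cos t = (- 1) ^ i * cos (t - real i * pi)" "sin t = (- 1) ^ i * sin (t - real i * pi)"
proof -
  have "cos ((t - real i * pi) + real i * pi) = (- 1) ^ i * cos (t - real i * pi)"
    unfolding cos_add by simp
  then show "cos t = (- 1) ^ i * cos (t - real i * pi)" by simp
  have "sin ((t - real i * pi) + real i * pi) = (- 1) ^ i * sin (t - real i * pi)"
    unfolding sin_add by simp
  then show "sin t = (- 1) ^ i * sin (t - real i * pi)" by simp
qed

context solution_curve
begin

lemma dx': "s \<in> {0..s0} \<Longrightarrow> (x has_real_derivative cos (clip (\<beta> s))) (at s)"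
  and du': "s \<in> {0..s0} \<Longrightarrow> (u has_real_derivative sin (clip (\<beta> s))) (at s)"
  using dx du by (simp_all add: clip_def)

lemma cont: "continuous_on {0..s0} x" "continuous_on {0..s0} u" "continuous_on {0..s0} \<beta>"
  by (rule DERIV_continuous_on[OF has_field_derivative_at_within[OF dx']]
      DERIV_continuous_on[OF has_field_derivative_at_within[OF du']]
      DERIV_continuous_on[OF has_field_derivative_at_within[OF d\<beta>]], assumption)+

lemma x_mono: "0 \<le> s \<Longrightarrow> s \<le> t \<Longrightarrow> t \<le> s0 \<Longrightarrow> x s \<le> x t"
proof (rule DERIV_nonneg_imp_nondecreasing[of s t x])
  fix r assume "0 \<le> s" "t \<le> s0" "s \<le> r" "r \<le> t"
  then have "r \<in> {0..s0}" by auto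
  from dx'[OF this] cos_clip_nonneg show "\<exists>y. (x has_real_derivative y) (at r) \<and> 0 \<le> y" by blast
qed

lemma x_range: "s \<in> {0..s0} \<Longrightarrow> x s \<in> {0..1}"
  using x_mono[of 0 s] x_mono[of s s0] ends by auto

lemma x_strict_right:
  assumes "0 \<le> s" "s < t" "t \<le> s0" "\<bar>\<beta> s\<bar> < pi/2" shows "x s < x t"
proof -
  have "s \<in> {0..s0}" using assms by auto
  from DERIV_pos_inc_right[OF dx'[OF this] cos_clip_pos[OF assms(4)]]
  obtain d where d: "d > 0" "\<And>h. 0 < h \<Longrightarrow> h < d \<Longrightarrow> x s < x (s + h)" by blast
  define h where "h = min (d/2) (t - s)"
  have "0 < h" "h < d" "s + h \<le> t" using d assms by (auto simp: h_def)
  then show ?thesis using d(2)[of h] x_mono[of "s + h" t] assms by auto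
qed

lemma x_strict_left:
  assumes "0 \<le> t" "t < s" "s \<le> s0" "\<bar>\<beta> s\<bar> < pi/2" shows "x t < x s"
proof -
  have "s \<in> {0..s0}" using assms by auto
  from DERIV_pos_inc_left[OF dx'[OF this] cos_clip_pos[OF assms(4)]]
  obtain d where d: "d > 0" "\<And>h. 0 < h \<Longrightarrow> h < d \<Longrightarrow> x (s - h) < x s" by blast
  define h where "h = min (d/2) (s - t)"
  have "0 < h" "h < d" "t \<le> s - h" using d assms by (auto simp: h_def)
  then show ?thesis using d(2)[of h] x_mono[of t "s - h"] assms by auto
qed

text \<open>\<open>x\<close> is only weakly increasing. Over a vertical piece \<open>g\<close> picks
  an arbitrary time, so that \<open>U\<close> takes there some value between its one-sided
  limits.\<close>

definition g :: "real \<Rightarrow> real" where "g t = (SOME s. s \<in> {0..s0} \<and> x s = t)"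
definition U :: "real \<Rightarrow> real" where "U t = u (g t)"

lemma g: assumes "t \<in> {0..1}" shows "g t \<in> {0..s0}" "x (g t) = t"
proof -
  have "\<exists>s. s \<in> {0..s0} \<and> x s = t"
    using IVT'[of x 0 t s0] assms ends s0_pos cont(1) by auto
  from someI_ex[OF this] show "g t \<in> {0..s0}" "x (g t) = t" unfolding g_def by auto
qed

lemma regular_unique:
  assumes "s \<in> {0..s0}" "r \<in> {0..s0}" "x r = x s" "\<bar>\<beta> s\<bar> < pi/2" shows "r = s"
  using x_strict_left[of r s] x_strict_right[of s r] assms by (cases r s rule: linorder_cases) auto

lemma g_x: "s \<in> {0..s0} \<Longrightarrow> \<bar>\<beta> s\<bar> < pi/2 \<Longrightarrow> g (x s) = s"
  using regular_unique[of s "g (x s)"] g[OF x_range] by auto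

lemma g_ends: "g 0 = 0" "g 1 = s0"
  using g_x[of 0] g_x[of s0] ends s0_pos pi_gt_zero by auto

definition regular :: "real set" where "regular = {t \<in> {0..1}. \<bar>\<beta> (g t)\<bar> < pi/2}"

text \<open>At a nonvertical point \<open>x\<close> is strictly smaller before and strictly larger
  after, and monotonicity of \<open>x\<close> carries these inequalities over to its
  inverse.\<close>

lemma g_tendsto:
  assumes t: "t \<in> regular" shows "(g \<longlongrightarrow> g t) (at t within {0..1})"
proof -
  have t1: "t \<in> {0..1}" "\<bar>\<beta> (g t)\<bar> < pi/2" using t by (auto simp: regular_def)
  note gt = g[OF t1(1)]
  have in01: "\<forall>\<^sub>F y in at t within {0..1}. y \<in> {0..1}" by (simp add: eventually_at_filter)
  show ?thesis
  proof (rule order_tendstoI)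
    fix r assume r: "r < g t"
    show "\<forall>\<^sub>F y in at t within {0..1}. r < g y"
    proof (cases "r < 0")
      case True
      show ?thesis using in01 by eventually_elim (use g(1) True in force)
    next
      case False
      then have "x r < t" using x_strict_left[of r "g t"] r gt t1 by auto
      then have "\<forall>\<^sub>F y in at t within {0..1}. x r < y" by (rule order_tendstoD(1)[OF tendsto_ident_at])
      with in01 show ?thesis
      proof eventually_elim
        case (elim y)
        then show ?case using g[OF elim(1)] x_mono[of "g y" r] r gt by (cases "r < g y") auto
      qed
    qed
  next
    fix r assume r: "g t < r"
    show "\<forall>\<^sub>F y in at t within {0..1}. g y < r"
    proof (cases "r > s0")
      case True
      show ?thesis using in01 by eventually_elim (use g(1) True in force)
    next
      case False
      then have "t < x r" using x_strict_right[of "g t" r] r gt t1 by auto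
      then have "\<forall>\<^sub>F y in at t within {0..1}. y < x r" by (rule order_tendstoD(2)[OF tendsto_ident_at])
      with in01 show ?thesis
      proof eventually_elim
        case (elim y)
        then show ?case using g[OF elim(1)] x_mono[of r "g y"] r gt by (cases "g y < r") auto
      qed
    qed
  qed
qed

lemma deriv_g:
  assumes t: "t \<in> regular" shows "(g has_real_derivative inverse (cos (clip (\<beta> (g t))))) (at t within {0..1})"
proof -
  have t1: "t \<in> {0..1}" "\<bar>\<beta> (g t)\<bar> < pi/2" using t by (auto simp: regular_def)
  note gt = g[OF t1(1)]
  have in01: "\<forall>\<^sub>F y in at t within {0..1}. y \<in> {0..1} \<and> y \<noteq> t" by (simp add: eventually_at_filter)
  have "((\<lambda>s. (x s - x (g t)) / (s - g t)) \<longlongrightarrow> cos (clip (\<beta> (g t)))) (at (g t))"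
    using dx'[OF gt(1)] by (simp add: has_field_derivative_iff)
  then have 1: "((\<lambda>s. inverse ((x s - x (g t)) / (s - g t))) \<longlongrightarrow> inverse (cos (clip (\<beta> (g t))))) (at (g t))"
    using cos_clip_pos[OF t1(2)] by (intro tendsto_inverse) auto
  have "filterlim g (at (g t)) (at t within {0..1})"
  proof (rule filterlim_atI[OF g_tendsto[OF t]])
    show "\<forall>\<^sub>F y in at t within {0..1}. g y \<noteq> g t"
      using in01
    proof eventually_elim
      case (elim y)
      then show ?case using g(2)[of y] gt(2) by auto
    qed
  qed
  from filterlim_compose[OF 1 this]
  have "((\<lambda>y. inverse ((x (g y) - x (g t)) / (g y - g t))) \<longlongrightarrow> inverse (cos (clip (\<beta> (g t))))) (at t within {0..1})" .
  moreover have "\<forall>\<^sub>F y in at t within {0..1}. inverse ((x (g y) - x (g t)) / (g y - g t)) = (g y - g t) / (y - t)"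
    using in01
  proof eventually_elim
    case (elim y)
    then show ?case using g(2)[of y] gt(2) by simp
  qed
  ultimately show ?thesis unfolding has_field_derivative_iff by (rule Lim_transform_eventually)
qed

lemma deriv_U:
  assumes t: "t \<in> regular" shows "(U has_real_derivative tan (\<beta> (g t))) (at t within {0..1})"
proof -
  have t1: "t \<in> {0..1}" "\<bar>\<beta> (g t)\<bar> < pi/2" using t by (auto simp: regular_def)
  have "((\<lambda>t. u (g t)) has_real_derivative sin (clip (\<beta> (g t))) * inverse (cos (clip (\<beta> (g t))))) (at t within {0..1})"
    by (rule DERIV_chain2[OF du'[OF g(1)[OF t1(1)]] deriv_g[OF t]])
  moreover have "clip (\<beta> (g t)) = \<beta> (g t)" using t1(2) by (intro clip_regular) simp
  ultimately show ?thesis by (simp only: U_def[abs_def] tan_def divide_inverse)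
qed

text \<open>As \<open>tan \<beta>\<close> is \<open>U'\<close>, this is the equation in
  nondivergence form,
  \<open>U'' = - a f(U) (1 + U'\<^sup>2)\<^sup>3\<^sup>/\<^sup>2\<close>.\<close>

lemma deriv_tan_\<beta>:
  assumes t: "t \<in> regular"
  shows "((\<lambda>t. tan (\<beta> (g t))) has_real_derivative - (a t * f (U t)) / cos (\<beta> (g t)) ^ 3) (at t within {0..1})"
proof -
  have t1: "t \<in> {0..1}" "\<bar>\<beta> (g t)\<bar> < pi/2" using t by (auto simp: regular_def)
  note gt = g[OF t1(1)]
  have clipe: "clip (\<beta> (g t)) = \<beta> (g t)" using t1(2) by (intro clip_regular) simp
  have c: "cos (\<beta> (g t)) > 0" using cos_clip_pos[OF t1(2)] by (simp only: clipe)
  have b: "((\<lambda>t. \<beta> (g t)) has_real_derivative - (a t * f (U t)) * inverse (cos (\<beta> (g t)))) (at t within {0..1})"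
    using DERIV_chain2[OF d\<beta>[OF gt(1)] deriv_g[OF t]] by (simp only: gt(2) U_def clipe)
  have "((\<lambda>t. tan (\<beta> (g t))) has_real_derivative
      inverse ((cos (\<beta> (g t)))\<^sup>2) * (- (a t * f (U t)) * inverse (cos (\<beta> (g t))))) (at t within {0..1})"
    by (rule DERIV_chain2[OF DERIV_tan b]) (use c in simp)
  moreover have "inverse ((cos (\<beta> (g t)))\<^sup>2) * (- (a t * f (U t)) * inverse (cos (\<beta> (g t)))) = - (a t * f (U t)) / cos (\<beta> (g t)) ^ 3"
    by (simp add: power3_eq_cube power2_eq_square divide_inverse mult_ac)
  ultimately show ?thesis by (simp only:)
qed

lemma continuous_g:
  assumes "S \<subseteq> regular" shows "continuous_on S g"
proof (rule DERIV_continuous_on)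
  fix t assume "t \<in> S"
  then have "t \<in> regular" using assms by auto
  moreover have "S \<subseteq> {0..1}" using assms by (auto simp: regular_def)
  ultimately show "(g has_real_derivative inverse (cos (clip (\<beta> (g t))))) (at t within S)"
    by (intro DERIV_subset[OF deriv_g])
qed

lemma C2_regular:
  assumes S: "S \<subseteq> regular" shows "C_k_on 2 U S"
proof -
  have S01: "S \<subseteq> {0..1}" using S by (auto simp: regular_def)
  have gS: "g ` S \<subseteq> {0..s0}" using g(1) S01 by auto
  have cg: "continuous_on S g" by (rule continuous_g[OF S])
  have cU: "continuous_on S U" unfolding U_def[abs_def] by (rule continuous_on_compose2[OF cont(2) cg gS])
  have cb: "continuous_on S (\<lambda>t. \<beta> (g t))" by (rule continuous_on_compose2[OF cont(3) cg gS])
  have cfU: "continuous_on S (\<lambda>t. f (U t))"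
    by (rule continuous_on_compose2[OF f_cont cU]) (use gS u_pos in \<open>force simp: U_def less_imp_le\<close>)
  have nz: "cos (\<beta> (g t)) \<noteq> 0" if "t \<in> S" for t
    using cos_clip_pos[of "\<beta> (g t)"] S that by (force simp: regular_def clip_regular)
  have "continuous_on S (\<lambda>t. - (a t * f (U t)) / cos (\<beta> (g t)) ^ 3)"
    using nz by (intro continuous_intros continuous_on_subset[OF a_cont S01] cfU cb) auto
  moreover have "\<forall>t\<in>S. (U has_real_derivative tan (\<beta> (g t))) (at t within S)"
    using deriv_U S S01 by (blast intro: DERIV_subset)
  moreover have "\<forall>t\<in>S. ((\<lambda>t. tan (\<beta> (g t))) has_real_derivative - (a t * f (U t)) / cos (\<beta> (g t)) ^ 3) (at t within S)"
    using deriv_tan_\<beta> S S01 by (blast intro: DERIV_subset)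
  ultimately show ?thesis unfolding numeral_2_eq_2 C_k_on.simps
    by - (rule exI, rule conjI, assumption, rule exI, rule conjI)
qed

text \<open>The nodes are the times with \<open>u = u0\<close>, where the angle is an odd multiple
  of \<open>pi/2\<close>. Index 0 and the indices above \<open>n\<close> denote the two ends of the
  curve.\<close>

definition \<tau> :: "nat \<Rightarrow> real" where
  "\<tau> i = (if i = 0 then 0 else if n < i then s0 else SOME s. s \<in> {0..s0} \<and> \<theta> s = (real i - 1/2) * pi)"
definition p :: "nat \<Rightarrow> real" where "p i = x (\<tau> i)"

lemma angle_time:
  assumes "0 \<le> c" "c \<le> real n * pi"
  shows "\<exists>s. s \<in> {0..s0} \<and> \<theta> s = c"
proof -
  have "\<exists>s\<ge>0. s \<le> s0 \<and> \<theta> s = c"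
    by (rule IVT') (use assms \<theta>_ends \<theta>_cont s0_pos in simp_all)
  then show ?thesis by auto
qed

lemma \<tau>: "\<tau> i \<in> {0..s0}" "1 \<le> i \<Longrightarrow> i \<le> n \<Longrightarrow> \<theta> (\<tau> i) = (real i - 1/2) * pi"
  "\<tau> 0 = 0" "\<tau> (n + 1) = s0"
proof -
  have "\<exists>s. s \<in> {0..s0} \<and> \<theta> s = (real i - 1/2) * pi" if "1 \<le> i" "i \<le> n"
    by (rule angle_time) (use that in \<open>auto intro!: mult_right_mono\<close>)
  from someI_ex[OF this] show "\<tau> i \<in> {0..s0}" "1 \<le> i \<Longrightarrow> i \<le> n \<Longrightarrow> \<theta> (\<tau> i) = (real i - 1/2) * pi"
    using s0_pos by (auto simp: \<tau>_def)
  show "\<tau> 0 = 0" "\<tau> (n + 1) = s0" by (auto simp: \<tau>_def)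
qed

lemma \<theta>_less_iff:
  assumes "s \<in> {0..s0}" "t \<in> {0..s0}" shows "\<theta> s < \<theta> t \<longleftrightarrow> s < t"
proof (cases s t rule: linorder_cases)
  case less
  then show ?thesis using \<theta>_mono[of s t] assms by simp
next
  case greater
  then have "\<theta> t < \<theta> s" using \<theta>_mono[of t s] assms by simp
  then show ?thesis using greater by simp
qed simp

text \<open>Between two nodes the angle stays within \<open>pi/2\<close> of \<open>i * pi\<close>.
  For \<open>i = 0\<close> and \<open>i = n\<close> one end of the curve sits at
  \<open>i * pi\<close> itself, and the inequalities are stated so as to include these
  cases.\<close>

lemma \<theta>_\<tau>_bounds:
  assumes "i \<le> n" shows "(real i - 1/2) * pi \<le> \<theta> (\<tau> i)" "\<theta> (\<tau> i) \<le> real i * pi"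
    "real i * pi \<le> \<theta> (\<tau> (i + 1))" "\<theta> (\<tau> (i + 1)) \<le> (real i + 1/2) * pi"
proof -
  have e: "(real i - 1/2) * pi = real i * pi - pi / 2" "(real i + 1/2) * pi = real i * pi + pi / 2"
    by (simp_all only: left_diff_distrib distrib_right)
  have "\<theta> (\<tau> i) = real i * pi - pi / 2 \<or> i = 0 \<and> \<theta> (\<tau> i) = 0"
  proof (cases "i = 0")
    case True
    then show ?thesis using \<tau>(3) \<theta>_ends(1) by simp
  next
    case False
    then show ?thesis using \<tau>(2)[of i] assms unfolding e by simp
  qed
  then show "(real i - 1/2) * pi \<le> \<theta> (\<tau> i)" "\<theta> (\<tau> i) \<le> real i * pi"
    unfolding e using pi_gt_zero by auto
  have "\<theta> (\<tau> (i + 1)) = real i * pi + pi / 2 \<or> \<theta> (\<tau> (i + 1)) = real i * pi"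
  proof (cases "i = n")
    case True
    then show ?thesis unfolding True \<tau>(4) using \<theta>_ends(2) by simp
  next
    case False
    then have "\<theta> (\<tau> (i + 1)) = (real (i + 1) - 1/2) * pi" using assms by (intro \<tau>(2)) auto
    also have "\<dots> = (real i + 1/2) * pi" by simp
    finally show ?thesis unfolding e by simp
  qed
  then show "real i * pi \<le> \<theta> (\<tau> (i + 1))" "\<theta> (\<tau> (i + 1)) \<le> (real i + 1/2) * pi"
    unfolding e using pi_gt_zero by auto
qed

lemma \<tau>_mono:
  assumes "i \<le> n" shows "\<tau> i < \<tau> (i + 1)"
proof -
  have "\<theta> (\<tau> i) < \<theta> (\<tau> (i + 1))"
  proof (cases "i = 0")
    case True
    then have "\<theta> (\<tau> (i + 1)) = pi / 2" using \<tau>(2)[of 1] n_pos by simp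
    moreover have "\<theta> (\<tau> i) = 0" using True \<tau>(3) \<theta>_ends(1) by simp
    ultimately show ?thesis using pi_gt_zero by linarith
  next
    case False
    then have "\<theta> (\<tau> i) = real i * pi - pi / 2" using \<tau>(2)[of i] assms by (simp add: left_diff_distrib)
    then show ?thesis using \<theta>_\<tau>_bounds(3)[OF assms] pi_gt_zero by linarith
  qed
  then show ?thesis using \<theta>_less_iff[OF \<tau>(1) \<tau>(1)] by simp
qed

lemma p_ends: "p 0 = 0" "p (n + 1) = 1" using \<tau>(3,4) ends by (auto simp: p_def)

lemma \<beta>_zero: "s \<in> {0..s0} \<Longrightarrow> \<theta> s = real i * pi \<Longrightarrow> \<beta> s = 0"
  using polar_\<beta>[of s] by simp

text \<open>Between the two times, or at one of them if it is an end of the curve, the angle is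
  \<open>i * pi\<close>; there the curve is horizontal and \<open>x\<close> increases
  strictly.\<close>

lemma p_mono:
  assumes "i \<le> n" shows "p i < p (i + 1)"
proof -
  obtain s where s: "s \<in> {0..s0}" "\<theta> s = real i * pi"
    using angle_time[of "real i * pi"] assms by auto
  have b: "\<bar>\<beta> s\<bar> < pi/2" using \<beta>_zero[OF s] by simp
  have "\<tau> i \<le> s" "s \<le> \<tau> (i + 1)"
    using \<theta>_\<tau>_bounds(2,3)[OF assms] s \<theta>_less_iff[OF s(1) \<tau>(1)] \<theta>_less_iff[OF \<tau>(1) s(1)] by (smt (verit))+
  moreover have "0 \<le> \<tau> i" "\<tau> (i + 1) \<le> s0" using \<tau>(1)[of i] \<tau>(1)[of "i + 1"] by auto
  ultimately have "x (\<tau> i) \<le> x s" "x s \<le> x (\<tau> (i + 1))"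
    "\<tau> i < s \<Longrightarrow> x (\<tau> i) < x s" "s < \<tau> (i + 1) \<Longrightarrow> x s < x (\<tau> (i + 1))"
    using x_mono x_strict_left x_strict_right s(1) b by auto
  then show ?thesis using \<tau>_mono[OF assms] unfolding p_def by (cases "\<tau> i < s") linarith+
qed

lemma sign_u:
  assumes s: "s \<in> {0..s0}" and \<theta>: "(real i - 1/2) * pi < \<theta> s" "\<theta> s < (real i + 1/2) * pi"
  shows "0 < \<sigma> * (- 1) ^ (i + 1) * (u s - u0)"
proof -
  have "0 < cos (\<theta> s - real i * pi)" using \<theta> by (intro cos_gt_zero_pi) (auto simp: algebra_simps)
  then have "0 < - (\<sigma> * P s) * cos (\<theta> s - real i * pi)" using P_sign[OF s] by (intro mult_pos_pos) auto
  also have "\<dots> = \<sigma> * (- 1) ^ (i + 1) * (u s - u0)"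
    unfolding polar_u[OF s] cos_sin_half_turns(1)[of "\<theta> s" i] by (cases "even i") auto
  finally show ?thesis .
qed

lemma sign_u_between:
  assumes i: "i \<le> n" and s: "\<tau> i < s" "s < \<tau> (i + 1)"
  shows "0 < \<sigma> * (- 1) ^ (i + 1) * (u s - u0)"
proof -
  have s0: "s \<in> {0..s0}" using s \<tau>(1)[of i] \<tau>(1)[of "i + 1"] by auto
  show ?thesis
    using \<theta>_less_iff[OF \<tau>(1) s0, of i] \<theta>_less_iff[OF s0 \<tau>(1), of "i + 1"] \<theta>_\<tau>_bounds(1,4)[OF i] s
    by (intro sign_u[OF s0]) auto
qed

lemma unit_sign: "\<sigma> * (- 1) ^ (i + 1) = 1 \<or> \<sigma> * (- 1) ^ (i + 1) = - 1"
  using \<sigma> by (cases "even i") auto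

lemma x_const:
  assumes "0 \<le> r" "r \<le> s" "s \<le> s0" "\<And>q. r \<le> q \<Longrightarrow> q \<le> s \<Longrightarrow> pi/2 \<le> \<bar>\<beta> q\<bar>"
  shows "x r = x s"
proof (cases "r = s")
  case False
  have c: "cos (clip y) = 0" if "pi/2 \<le> \<bar>y\<bar>" for y
  proof -
    from that have "pi/2 \<le> y \<or> y \<le> - (pi/2)" by linarith
    then have "clip y = pi/2 \<or> clip y = - (pi/2)" using clip_frozen by blast
    then show ?thesis by (metis cos_pi_half cos_minus)
  qed
  have "x s = x r"
  proof (rule DERIV_isconst_end[of r s x])
    show "continuous_on {r..s} x" by (rule continuous_on_subset[OF cont(1)]) (use assms in auto)
    show "(x has_real_derivative 0) (at q)" if "r < q" "q < s" for q
      using dx'[of q] c[OF assms(4)[of q]] that assms by simp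
  qed (use assms False in auto)
  then show ?thesis by simp
qed auto

text \<open>Between nodes \<open>f (u s)\<close> has constant sign, so \<open>e * \<beta>\<close> is
  monotone. A steep point is therefore preceded by steep points back to the previous node or
  followed by them up to the next one, and \<open>x\<close> is constant in between: vertical pieces
  lie over nodes only.\<close>

lemma frozen_between:
  assumes i: "i \<le> n" and s: "\<tau> i < s" "s < \<tau> (i + 1)" and b: "pi/2 \<le> \<bar>\<beta> s\<bar>"
  shows "x s = p i \<or> x s = p (i + 1)"
proof -
  define e where "e = \<sigma> * (- 1) ^ (i + 1)"
  have e: "e = 1 \<or> e = - 1" unfolding e_def by (rule unit_sign)
  have rng: "0 \<le> \<tau> i" "\<tau> (i + 1) \<le> s0" using \<tau>(1)[of i] \<tau>(1)[of "i + 1"] by auto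
  have dec: "e * \<beta> r \<ge> e * \<beta> q" if "\<tau> i \<le> r" "r \<le> q" "q \<le> \<tau> (i + 1)" for r q
  proof (rule DERIV_nonpos_imp_decreasing_open[OF that(2), of "\<lambda>s. e * \<beta> s"])
    show "continuous_on {r..q} (\<lambda>s. e * \<beta> s)"
      by (intro continuous_intros continuous_on_subset[OF cont(3)]) (use that rng in auto)
    fix z assume z: "r < z" "z < q"
    then have z0: "z \<in> {0..s0}" using that rng by auto
    have "0 < e * (u z - u0)" unfolding e_def by (rule sign_u_between[OF i]) (use z that in auto)
    then have "0 < e * f (u z)" using e f_pos[of "u z"] f_neg[of "u z"] u_pos[OF z0] by auto
    then have "e * - (a (x z) * f (u z)) \<le> 0"
      using a_pos[OF x_range[OF z0]] by (simp add: mult_nonneg_nonneg mult.left_commute[of e])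
    then show "\<exists>y. ((\<lambda>s. e * \<beta> s) has_real_derivative y) (at z) \<and> y \<le> 0"
      using DERIV_cmult[OF d\<beta>[OF z0], of e] by blast
  qed
  have ab: "\<bar>e * \<beta> q\<bar> = \<bar>\<beta> q\<bar>" for q using e by auto
  from b have "pi/2 \<le> e * \<beta> s \<or> e * \<beta> s \<le> - (pi/2)" using ab[of s] by linarith
  then show ?thesis
  proof
    assume h: "pi/2 \<le> e * \<beta> s"
    have "x (\<tau> i) = x s"
    proof (rule x_const)
      fix q assume "\<tau> i \<le> q" "q \<le> s"
      then have "pi/2 \<le> e * \<beta> q" using dec[of q s] s h by linarith
      then show "pi/2 \<le> \<bar>\<beta> q\<bar>" using ab[of q] by linarith
    qed (use s rng in auto)
    then show ?thesis by (simp add: p_def)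
  next
    assume h: "e * \<beta> s \<le> - (pi/2)"
    have "x s = x (\<tau> (i + 1))"
    proof (rule x_const)
      fix q assume "s \<le> q" "q \<le> \<tau> (i + 1)"
      then have "e * \<beta> q \<le> - (pi/2)" using dec[of s q] s h by linarith
      then show "pi/2 \<le> \<bar>\<beta> q\<bar>" using ab[of q] by linarith
    qed (use s rng in auto)
    then show ?thesis by (simp add: p_def)
  qed
qed

lemma p_range: "p i \<in> {0..1}" unfolding p_def by (rule x_range[OF \<tau>(1)])

lemma between:
  assumes i: "i \<le> n" and t: "p i < t" "t < p (i + 1)"
  shows "\<tau> i < g t" "g t < \<tau> (i + 1)" "t \<in> regular"
proof -
  have t01: "t \<in> {0..1}" using t p_range[of i] p_range[of "i + 1"] by auto
  note gt = g[OF t01]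
  show 1: "\<tau> i < g t"
    using x_mono[of "g t" "\<tau> i"] gt \<tau>(1)[of i] t by (cases "\<tau> i < g t") (auto simp: p_def)
  show 2: "g t < \<tau> (i + 1)"
    using x_mono[of "\<tau> (i + 1)" "g t"] gt \<tau>(1)[of "i + 1"] t by (cases "g t < \<tau> (i + 1)") (auto simp: p_def)
  have "\<not> pi/2 \<le> \<bar>\<beta> (g t)\<bar>" using frozen_between[OF i 1 2] gt t by auto
  then show "t \<in> regular" using t01 by (simp add: regular_def)
qed

lemma ends_regular: "0 \<in> regular" "1 \<in> regular"
  using g_ends ends by (auto simp: regular_def)

lemma locate:
  assumes "t \<in> {0..1}" "t \<notin> p ` {..n+1}"
  obtains i where "i \<le> n" "p i < t" "t < p (i + 1)"
proof -
  have "\<exists>i<m. p i \<le> t \<and> t < p (i + 1)" if "m \<le> n + 1" "t < p m" for m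
    using that
  proof (induction m)
    case 0
    then show ?case using p_ends assms by auto
  next
    case (Suc m)
    then show ?case by (cases "t < p m") (auto intro: less_SucI)
  qed
  moreover have "t < p (n + 1)" using assms p_ends by (cases "t = 1") auto
  ultimately obtain i where i: "i < n + 1" "p i \<le> t" "t < p (i + 1)" by auto
  moreover have "t \<noteq> p i" using assms(2) i(1) by auto
  ultimately show thesis using that[of i] by auto
qed

lemma nonregular_finite: "{0..1} - regular \<subseteq> p ` {..n+1}"
  using locate between(3) by blast

lemma U_pos: "t \<in> {0..1} \<Longrightarrow> 0 < U t"
  using u_pos g(1) by (simp add: U_def)

lemma u_\<tau>: "1 \<le> i \<Longrightarrow> i \<le> n \<Longrightarrow> u (\<tau> i) = u0"
  and \<beta>_\<tau>: "1 \<le> i \<Longrightarrow> i \<le> n \<Longrightarrow> 0 < \<sigma> * (- 1) ^ (i + 1) * \<beta> (\<tau> i)"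
proof -
  assume i: "1 \<le> i" "i \<le> n"
  have th: "\<theta> (\<tau> i) - real i * pi = - (pi/2)" using \<tau>(2)[OF i] by (simp add: algebra_simps)
  show "u (\<tau> i) = u0"
    using polar_u[OF \<tau>(1)[of i]] cos_sin_half_turns(1)[of "\<theta> (\<tau> i)" i] by (simp add: th)
  have "\<beta> (\<tau> i) = P (\<tau> i) * (- 1) ^ i"
    using polar_\<beta>[OF \<tau>(1)[of i]] cos_sin_half_turns(2)[of "\<theta> (\<tau> i)" i] by (simp add: th)
  then have "\<sigma> * (- 1) ^ (i + 1) * \<beta> (\<tau> i) = - (\<sigma> * P (\<tau> i))"
    by (cases "even i") auto
  then show "0 < \<sigma> * (- 1) ^ (i + 1) * \<beta> (\<tau> i)" using P_sign[OF \<tau>(1)[of i]] by linarith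
qed


text \<open>Over a singular abscissa \<open>t\<close> the curve is vertical: it climbs (\<open>e = 1\<close>) or descends
  (\<open>e = - 1\<close>) at unit speed during the whole fiber \<open>[first t, last t]\<close>, possibly a single time.\<close>

definition first :: "real \<Rightarrow> real" where "first t = Inf ({0..s0} \<inter> x -` {t})"
definition last :: "real \<Rightarrow> real" where "last t = Sup ({0..s0} \<inter> x -` {t})"

lemma fiber:
  assumes t: "t \<in> {0..1}"
  shows "first t \<in> {0..s0}" "x (first t) = t" "last t \<in> {0..s0}" "x (last t) = t"
    "\<And>s. s \<in> {0..s0} \<Longrightarrow> x s = t \<Longrightarrow> first t \<le> s \<and> s \<le> last t"
    "\<And>s. first t \<le> s \<Longrightarrow> s \<le> last t \<Longrightarrow> s \<in> {0..s0} \<and> x s = t"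
proof -
  let ?Z = "{0..s0} \<inter> x -` {t}"
  have cl: "closed ?Z" by (intro continuous_closed_preimage cont) auto
  have ne: "?Z \<noteq> {}" using g[OF t] by auto
  have bb: "bdd_below ?Z" "bdd_above ?Z" by (auto intro: bdd_belowI[of _ 0] bdd_aboveI[of _ s0])
  have "first t \<in> ?Z" unfolding first_def by (rule closed_contains_Inf[OF ne bb(1) cl])
  then show 1: "first t \<in> {0..s0}" "x (first t) = t" by auto
  have "last t \<in> ?Z" unfolding last_def by (rule closed_contains_Sup[OF ne bb(2) cl])
  then show 2: "last t \<in> {0..s0}" "x (last t) = t" by auto
  show "first t \<le> s \<and> s \<le> last t" if "s \<in> {0..s0}" "x s = t" for s
    unfolding first_def last_def using that bb by (auto intro: cInf_lower cSup_upper)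
  show "s \<in> {0..s0} \<and> x s = t" if "first t \<le> s" "s \<le> last t" for s
  proof
    show s: "s \<in> {0..s0}" using that 1 2 by auto
    show "x s = t" using x_mono[of "first t" s] x_mono[of s "last t"] that 1 2 by auto
  qed
qed

lemma first_g_last: "t \<in> {0..1} \<Longrightarrow> first t \<le> g t \<and> g t \<le> last t"
  using fiber(5) g by blast

text \<open>A time with \<open>\<bar>\<beta>\<bar> < pi/2\<close> would be the only one with its
  abscissa and would make \<open>t\<close> regular. So \<open>\<beta>\<close> avoids that range on
  the whole fiber and, being continuous, keeps its sign.\<close>

lemma singular_fiber:
  assumes t: "t \<in> {0..1}" "t \<notin> regular"
  obtains e where "e = 1 \<or> e = - 1" "\<And>s. first t \<le> s \<Longrightarrow> s \<le> last t \<Longrightarrow> pi/2 \<le> e * \<beta> s"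
proof -
  have steep: "pi/2 \<le> \<bar>\<beta> s\<bar>" if s: "first t \<le> s" "s \<le> last t" for s
  proof (rule ccontr)
    assume h: "\<not> pi/2 \<le> \<bar>\<beta> s\<bar>"
    then have "g t = s" using regular_unique[of s "g t"] fiber(6)[OF t(1) s] g[OF t(1)] by auto
    then show False using h t by (simp add: regular_def)
  qed
  define e where "e = sgn (\<beta> (first t))"
  have fl: "first t \<le> last t" using first_g_last[OF t(1)] by simp
  have b0: "pi/2 \<le> \<bar>\<beta> (first t)\<bar>" using steep[OF order_refl fl] .
  then have "\<bar>\<beta> (first t)\<bar> > 0" using pi_gt_zero by linarith
  then have e: "e = 1 \<or> e = - 1" "e * \<beta> (first t) = \<bar>\<beta> (first t)\<bar>"
    by (auto simp: e_def sgn_if)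
  have "pi/2 \<le> e * \<beta> s" if s: "first t \<le> s" "s \<le> last t" for s
  proof (rule ccontr)
    assume h: "\<not> pi/2 \<le> e * \<beta> s"
    have "\<bar>e * \<beta> s\<bar> = \<bar>\<beta> s\<bar>" using e(1) by auto
    then have "e * \<beta> s \<le> 0" using steep[OF s] h by linarith
    moreover have "0 \<le> e * \<beta> (first t)" unfolding e(2) by simp
    moreover have "continuous_on {first t..s} (\<lambda>s. e * \<beta> s)"
      by (intro continuous_intros continuous_on_subset[OF cont(3)]) (use fiber(1,3)[OF t(1)] s in auto)
    ultimately obtain r where r: "first t \<le> r" "r \<le> s" "e * \<beta> r = 0"
      using IVT2'[of "\<lambda>s. e * \<beta> s" s 0 "first t"] s by auto
    then have "\<beta> r = 0" using e(1) by auto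
    then have "\<bar>\<beta> r\<bar> = 0" by simp
    then show False using steep[of r] r s pi_gt_zero by linarith
  qed
  then show thesis using that[OF e(1)] by blast
qed

lemma singular_sin_cos:
  assumes "e = 1 \<or> e = - 1" "pi/2 \<le> e * y"
  shows "sin (clip y) = e" "cos (clip y) = 0"
proof -
  have "e = 1 \<and> clip y = pi/2 \<or> e = - 1 \<and> clip y = - (pi/2)" using assms clip_frozen[of y] by auto
  then show "sin (clip y) = e" "cos (clip y) = 0" by (metis sin_pi_half sin_minus, metis cos_pi_half cos_minus)
qed

lemma singular_u:
  assumes t: "t \<in> {0..1}" and e: "e = 1 \<or> e = - 1" "\<And>s. first t \<le> s \<Longrightarrow> s \<le> last t \<Longrightarrow> pi/2 \<le> e * \<beta> s"
    and s: "first t \<le> r" "r \<le> s" "s \<le> last t"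
  shows "u s = u r + e * (s - r)"
proof (cases "r = s")
  case False
  have "u s - e * s = u r - e * r"
  proof (rule DERIV_isconst_end[of r s "\<lambda>s. u s - e * s"])
    show "continuous_on {r..s} (\<lambda>s. u s - e * s)"
      by (intro continuous_intros continuous_on_subset[OF cont(2)]) (use fiber(1,3)[OF t] s in auto)
    fix q assume q: "r < q" "q < s"
    then have "q \<in> {0..s0}" "sin (clip (\<beta> q)) = e"
      using fiber(6)[OF t, of q] singular_sin_cos(1)[OF e(1) e(2)[of q]] s by auto
    then have "(u has_real_derivative e) (at q)" using du'[of q] by simp
    then show "((\<lambda>s. u s - e * s) has_real_derivative 0) (at q)" by (auto intro!: derivative_eq_intros)
  qed (use False s in auto)
  then show ?thesis by (simp add: algebra_simps)
qed auto

text \<open>The target is the punctured one-sided filter, so that limits of difference quotients in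
  \<open>s\<close>, and not only limits of \<open>u\<close>, can be transported to
  \<open>t\<close>.\<close>

lemma g_left:
  assumes t: "0 < t" "t \<le> 1" shows "filterlim g (at_left (first t)) (at_left t)"
proof -
  have t1: "t \<in> {0..1}" using t by auto
  note f = fiber[OF t1]
  have ev: "\<forall>\<^sub>F y in at_left t. 0 < y \<and> y < t"
    using eventually_at_left_real[OF t(1)] by (rule eventually_mono) auto
  have less: "g y < first t" if "0 < y" "y < t" for y
    using g[of y] x_mono[of "first t" "g y"] f(1,2) that t by (cases "g y < first t") auto
  have "(g \<longlongrightarrow> first t) (at_left t)"
  proof (rule order_tendstoI)
    fix r assume r: "r < first t"
    show "\<forall>\<^sub>F y in at_left t. r < g y"
    proof (cases "r < 0")
      case True
      show ?thesis using ev
      proof eventually_elim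
        case (elim y)
        then show ?case using g(1)[of y] t True by auto
      qed
    next
      case False
      have "x r \<noteq> t" using f(5)[of r] r f(1) False by auto
      moreover have "x r \<le> t" using x_mono[of r "first t"] r f(1,2) False by auto
      ultimately have "x r < t" by simp
      then have "\<forall>\<^sub>F y in at_left t. x r < y" by (rule order_tendstoD(1)[OF tendsto_ident_at])
      with ev show ?thesis
      proof eventually_elim
        case (elim y)
        then show ?case using g[of y] x_mono[of "g y" r] r f(1) t by (cases "r < g y") auto
      qed
    qed
  next
    fix r assume r: "first t < r"
    show "\<forall>\<^sub>F y in at_left t. g y < r" using ev
    proof eventually_elim
      case (elim y)
      then show ?case using less[of y] r by simp
    qed
  qed
  moreover have "\<forall>\<^sub>F y in at_left t. g y \<in> {..<first t} \<and> g y \<noteq> first t"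
    using ev
  proof eventually_elim
    case (elim y)
    then show ?case using less[of y] by simp
  qed
  ultimately show ?thesis unfolding filterlim_at by blast
qed

lemma g_right:
  assumes t: "0 \<le> t" "t < 1" shows "filterlim g (at_right (last t)) (at_right t)"
proof -
  have t1: "t \<in> {0..1}" using t by auto
  note f = fiber[OF t1]
  have ev: "\<forall>\<^sub>F y in at_right t. t < y \<and> y < 1"
    using eventually_at_right_real[OF t(2)] by (rule eventually_mono) auto
  have greater: "last t < g y" if "t < y" "y < 1" for y
    using g[of y] x_mono[of "g y" "last t"] f(3,4) that t by (cases "last t < g y") auto
  have "(g \<longlongrightarrow> last t) (at_right t)"
  proof (rule order_tendstoI)
    fix r assume r: "last t < r"
    show "\<forall>\<^sub>F y in at_right t. g y < r"
    proof (cases "s0 < r")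
      case True
      show ?thesis using ev
      proof eventually_elim
        case (elim y)
        then show ?case using g(1)[of y] t True by auto
      qed
    next
      case False
      have "x r \<noteq> t" using f(5)[of r] r f(3) False by auto
      moreover have "t \<le> x r" using x_mono[of "last t" r] r f(3,4) False by auto
      ultimately have "t < x r" by simp
      then have "\<forall>\<^sub>F y in at_right t. y < x r" by (rule order_tendstoD(2)[OF tendsto_ident_at])
      with ev show ?thesis
      proof eventually_elim
        case (elim y)
        then show ?case using g[of y] x_mono[of r "g y"] r f(3) t by (cases "g y < r") auto
      qed
    qed
  next
    fix r assume r: "r < last t"
    show "\<forall>\<^sub>F y in at_right t. r < g y" using ev
    proof eventually_elim
      case (elim y)
      then show ?case using greater[of y] r by simp
    qed
  qed
  moreover have "\<forall>\<^sub>F y in at_right t. g y \<in> {last t<..} \<and> g y \<noteq> last t"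
    using ev
  proof eventually_elim
    case (elim y)
    then show ?case using greater[of y] by simp
  qed
  ultimately show ?thesis unfolding filterlim_at by blast
qed

lemma U_left:
  assumes t: "0 < t" "t \<le> 1" shows "(U \<longlongrightarrow> u (first t)) (at_left t)" "left_lim U t = u (first t)"
proof -
  have "first t \<in> {0..s0}" using fiber(1)[of t] t by auto
  then have "isCont u (first t)" using du' DERIV_isCont by blast
  then have "(u \<longlongrightarrow> u (first t)) (at_left (first t))"
    by (metis isCont_def filterlim_at_split)
  from filterlim_compose[OF this g_left[OF t]]
  show "(U \<longlongrightarrow> u (first t)) (at_left t)" by (simp add: U_def[abs_def])
  then show "left_lim U t = u (first t)" by (intro tendsto_Lim) auto
qed

lemma U_right:
  assumes t: "0 \<le> t" "t < 1" shows "(U \<longlongrightarrow> u (last t)) (at_right t)" "right_lim U t = u (last t)"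
proof -
  have "last t \<in> {0..s0}" using fiber(3)[of t] t by auto
  then have "isCont u (last t)" using du' DERIV_isCont by blast
  then have "(u \<longlongrightarrow> u (last t)) (at_right (last t))"
    by (metis isCont_def filterlim_at_split)
  from filterlim_compose[OF this g_right[OF t]]
  show "(U \<longlongrightarrow> u (last t)) (at_right t)" by (simp add: U_def[abs_def])
  then show "right_lim U t = u (last t)" by (intro tendsto_Lim) auto
qed

lemma regular_fiber:
  assumes "t \<in> regular" shows "first t = g t \<and> last t = g t"
proof -
  have t: "t \<in> {0..1}" "\<bar>\<beta> (g t)\<bar> < pi/2" using assms by (auto simp: regular_def)
  note gt = g[OF t(1)] and f = fiber(1-4)[OF t(1)]
  show ?thesis
    using regular_unique[OF gt(1) f(1) _ t(2)] regular_unique[OF gt(1) f(3) _ t(2)] f gt by simp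
qed

lemma good_representative_U: "good_representative U"
  unfolding good_representative_def
proof (intro ballI conjI)
  fix t :: real assume "t \<in> {0<..<1}"
  then have t: "0 < t" "t < 1" "t \<in> {0..1}" by auto
  show "(U \<longlongrightarrow> left_lim U t) (at_left t)" "(U \<longlongrightarrow> right_lim U t) (at_right t)"
    using U_left[of t] U_right[of t] t by auto
  have lims: "left_lim U t = u (first t)" "right_lim U t = u (last t)"
    using U_left[of t] U_right[of t] t by auto
  have "min (u (first t)) (u (last t)) \<le> U t \<and> U t \<le> max (u (first t)) (u (last t))"
  proof (cases "t \<in> regular")
    case True
    then show ?thesis using regular_fiber[OF True] by (simp add: U_def)
  next
    case False
    obtain e where e: "e = 1 \<or> e = - 1" "\<And>s. first t \<le> s \<Longrightarrow> s \<le> last t \<Longrightarrow> pi/2 \<le> e * \<beta> s"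
      by (rule singular_fiber[OF t(3) False]) blast
    have fg: "first t \<le> g t" "g t \<le> last t" using first_g_last[OF t(3)] by auto
    have "U t = u (first t) + e * (g t - first t)"
      unfolding U_def by (rule singular_u[OF t(3) e order_refl fg])
    moreover have "u (last t) = U t + e * (last t - g t)"
      unfolding U_def by (rule singular_u[OF t(3) e fg order_refl])
    ultimately show ?thesis using e(1) fg by (elim disjE) (simp_all add: min_def max_def)
  qed
  then show "min (left_lim U t) (right_lim U t) \<le> U t" "U t \<le> max (left_lim U t) (right_lim U t)"
    unfolding lims by auto
qed

text \<open>At both ends of the fiber \<open>u\<close> moves with velocity \<open>e\<close> and
  \<open>x\<close> with velocity 0. A fiber of a single time, where \<open>U\<close> is continuous
  with infinite slope, is included.\<close>

lemma singular_quotients: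
  assumes t: "0 < t" "t < 1" and e: "e = 1 \<or> e = - 1" "\<And>s. first t \<le> s \<Longrightarrow> s \<le> last t \<Longrightarrow> pi/2 \<le> e * \<beta> s"
  shows "filterlim (\<lambda>y. e * ((U y - u (first t)) / (y - t))) at_top (at_left t)"
    and "filterlim (\<lambda>y. e * ((U y - u (last t)) / (y - t))) at_top (at_right t)"
proof -
  have t1: "t \<in> {0..1}" using t by auto
  note f = fiber[OF t1]
  have fl: "first t \<le> last t" using first_g_last[OF t1] by simp
  have d: "(u has_real_derivative e) (at s)" "(x has_real_derivative 0) (at s)" if "first t \<le> s" "s \<le> last t" for s
    using du'[of s] dx'[of s] f(6)[OF that] singular_sin_cos[OF e(1) e(2)[OF that]] by auto
  have "first t \<noteq> 0" using f(2) ends t by auto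
  then have f0: "0 < first t" using f(1) by auto
  have "last t \<noteq> s0" using f(4) ends t by auto
  then have l0: "last t < s0" using f(3) by auto
  have "\<forall>\<^sub>F s in at_left (first t). 0 < s \<and> s < first t"
    using eventually_at_left_real[OF f0] by (rule eventually_mono) auto
  then have "\<forall>\<^sub>F s in at_left (first t). 0 < (x s - x (first t)) / (s - first t)"
  proof eventually_elim
    case (elim s)
    have "x s \<noteq> t" using f(5)[of s] elim f(1) by auto
    moreover have "x s \<le> t" using x_mono[of s "first t"] elim f(1,2) by auto
    ultimately show ?case using elim f(2) by (simp add: divide_neg_neg)
  qed
  from quotient_blowup[OF d(1)[OF order_refl fl] e(1) d(2)[OF order_refl fl] _ this]
  have "filterlim (\<lambda>s. e * ((u s - u (first t)) / (x s - x (first t)))) at_top (at_left (first t))"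
    by (simp add: at_le)
  from filterlim_compose[OF this g_left[of t]] t
  have "filterlim (\<lambda>y. e * ((u (g y) - u (first t)) / (x (g y) - x (first t)))) at_top (at_left t)" by simp
  moreover have "\<forall>\<^sub>F y in at_left t. 0 < y \<and> y < t"
    using eventually_at_left_real[OF t(1)] by (rule eventually_mono) auto
  then have "\<forall>\<^sub>F y in at_left t. e * ((u (g y) - u (first t)) / (x (g y) - x (first t))) = e * ((U y - u (first t)) / (y - t))"
  proof eventually_elim
    case (elim y)
    then show ?case using g(2)[of y] f(2) t by (simp add: U_def)
  qed
  ultimately show "filterlim (\<lambda>y. e * ((U y - u (first t)) / (y - t))) at_top (at_left t)"
    by (subst (asm) filterlim_cong[OF refl refl]) auto
  have "\<forall>\<^sub>F s in at_right (last t). last t < s \<and> s < s0"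
    using eventually_at_right_real[OF l0] by (rule eventually_mono) auto
  then have "\<forall>\<^sub>F s in at_right (last t). 0 < (x s - x (last t)) / (s - last t)"
  proof eventually_elim
    case (elim s)
    have "x s \<noteq> t" using f(5)[of s] elim f(3) by auto
    moreover have "t \<le> x s" using x_mono[of "last t" s] elim f(3,4) by auto
    ultimately show ?case using elim f(4) by simp
  qed
  from quotient_blowup[OF d(1)[OF fl order_refl] e(1) d(2)[OF fl order_refl] _ this]
  have "filterlim (\<lambda>s. e * ((u s - u (last t)) / (x s - x (last t)))) at_top (at_right (last t))"
    by (simp add: at_le)
  from filterlim_compose[OF this g_right[of t]] t
  have "filterlim (\<lambda>y. e * ((u (g y) - u (last t)) / (x (g y) - x (last t)))) at_top (at_right t)" by simp
  moreover have "\<forall>\<^sub>F y in at_right t. t < y \<and> y < 1"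
    using eventually_at_right_real[OF t(2)] by (rule eventually_mono) auto
  then have "\<forall>\<^sub>F y in at_right t. e * ((u (g y) - u (last t)) / (x (g y) - x (last t))) = e * ((U y - u (last t)) / (y - t))"
  proof eventually_elim
    case (elim y)
    then show ?case using g(2)[of y] f(4) t by (simp add: U_def)
  qed
  ultimately show "filterlim (\<lambda>y. e * ((U y - u (last t)) / (y - t))) at_top (at_right t)"
    by (subst (asm) filterlim_cong[OF refl refl]) auto
qed

text \<open>The time \<open>s\<close> lies in the fiber, along which \<open>u\<close> is monotone,
  so \<open>u0\<close> lies between the two limits; the sign of \<open>\<beta> s\<close> decides
  between climbing and descending.\<close>

lemma steep_at:
  assumes t: "0 < t" "t < 1" "t \<notin> regular" and \<tau>: "x s = t" "s \<in> {0..s0}" "u s = u0"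
  shows "0 < \<beta> s \<Longrightarrow> steep_up u0 U t" and "\<beta> s < 0 \<Longrightarrow> steep_down u0 U t"
proof -
  have t1: "t \<in> {0..1}" using t by auto
  obtain e where e: "e = 1 \<or> e = - 1" "\<And>s. first t \<le> s \<Longrightarrow> s \<le> last t \<Longrightarrow> pi/2 \<le> e * \<beta> s"
    by (rule singular_fiber[OF t1 t(3)]) blast
  have s: "first t \<le> s" "s \<le> last t" using fiber(5)[OF t1 \<tau>(2,1)] by auto
  have lims: "left_lim U t = u (first t)" "right_lim U t = u (last t)"
    using U_left[of t] U_right[of t] t by auto
  have us: "u (first t) = u0 - e * (s - first t)" "u (last t) = u0 + e * (last t - s)"
    using singular_u[OF t1 e order_refl s(1) s(2)] singular_u[OF t1 e s(1) s(2) order_refl] \<tau> by auto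
  note q = singular_quotients[OF t(1,2) e]
  have nb: "at_left t \<noteq> bot" "at_right t \<noteq> bot" by auto
  show "steep_up u0 U t" if "0 < \<beta> s"
  proof -
    have "e \<noteq> - 1"
    proof
      assume "e = - 1"
      then have "pi/2 \<le> - \<beta> s" using e(2)[OF s] by simp
      then show False using that pi_gt_zero by linarith
    qed
    then have e1: "e = 1" using e(1) by blast
    show ?thesis
      unfolding steep_up_def has_left_Dini_def has_right_Dini_def lims
      using Dini_of_blowup(1)[OF q(1) nb(1) e1] Dini_of_blowup(1)[OF q(2) nb(2) e1] us s by (simp add: e1)
  qed
  show "steep_down u0 U t" if "\<beta> s < 0"
  proof -
    have "e \<noteq> 1"
    proof
      assume "e = 1"
      then have "pi/2 \<le> \<beta> s" using e(2)[OF s] by simp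
      then show False using that pi_gt_zero by linarith
    qed
    then have e1: "e = - 1" using e(1) by blast
    show ?thesis
      unfolding steep_down_def has_left_Dini_def has_right_Dini_def lims
      using Dini_of_blowup(2)[OF q(1) nb(1) e1] Dini_of_blowup(2)[OF q(2) nb(2) e1] us s by (simp add: e1)
  qed
qed

lemma p_strict_mono: "i < j \<Longrightarrow> j \<le> n + 1 \<Longrightarrow> p i < p j"
proof (induction j)
  case (Suc j)
  then show ?case using p_mono[of j] by (cases "i = j") auto
qed auto

lemma between_regular: "i \<le> n \<Longrightarrow> {p i<..<p (i + 1)} \<subseteq> regular"
  using between(3) by auto

lemma node_time_g:
  assumes "p i \<in> regular" shows "g (p i) = \<tau> i"
proof (rule regular_unique[symmetric])
  show "g (p i) \<in> {0..s0}" by (rule g(1)[OF p_range])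
  show "\<tau> i \<in> {0..s0}" by (rule \<tau>(1))
  show "x (\<tau> i) = x (g (p i))" unfolding g(2)[OF p_range] by (simp add: p_def)
  show "\<bar>\<beta> (g (p i))\<bar> < pi / 2" using assms by (simp add: regular_def)
qed

lemma node_alternative:
  assumes i: "1 \<le> i" "i \<le> n"
  shows "U (p i) = u0 \<and> C_k_on 2 U {p (i - 1)<..<p (i + 1)} \<or>
      (if 0 < \<sigma> * (- 1) ^ (i + 1) then steep_up u0 U (p i) else steep_down u0 U (p i))"
proof (cases "p i \<in> regular")
  case True
  have "U (p i) = u0" unfolding U_def node_time_g[OF True] by (rule u_\<tau>[OF i])
  moreover have "{p (i - 1)<..<p (i + 1)} \<subseteq> regular"
  proof
    fix t assume t: "t \<in> {p (i - 1)<..<p (i + 1)}"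
    have i1: "i - 1 \<le> n" "i - 1 + 1 = i" using i by auto
    consider "t < p i" | "t = p i" | "p i < t" by linarith
    then show "t \<in> regular"
    proof cases
      case 1
      then show ?thesis using between(3)[OF i1(1), of t] t i1(2) by simp
    next
      case 3
      then show ?thesis using between(3)[OF i(2), of t] t by simp
    qed (use True in simp)
  qed
  ultimately show ?thesis using C2_regular by blast
next
  case False
  have "p 0 < p i" "p i < p (n + 1)" by (rule p_strict_mono; use i in simp)+
  then have t: "0 < p i" "p i < 1" unfolding p_ends .
  note st = steep_at[OF t False p_def[symmetric] \<tau>(1) u_\<tau>[OF i]]
  from unit_sign[of i] show ?thesis
  proof
    assume e: "\<sigma> * (- 1) ^ (i + 1) = 1"
    then have "0 < \<beta> (\<tau> i)" using \<beta>_\<tau>[OF i] unfolding e by simp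
    then show ?thesis unfolding e using st(1) by simp
  next
    assume e: "\<sigma> * (- 1) ^ (i + 1) = - 1"
    then have "\<beta> (\<tau> i) < 0" using \<beta>_\<tau>[OF i] unfolding e by simp
    then show ?thesis unfolding e using st(2) by simp
  qed
qed

lemma nodal_profile_U: "nodal_profile \<sigma> u0 U n p"
proof -
  have "C_k_on 2 U {0..<p 1}"
  proof (rule C2_regular, rule subsetI)
    fix t assume "t \<in> {0..<p 1}"
    then show "t \<in> regular" using between_regular[of 0] p_ends(1) ends_regular(1) by (cases "t = 0") auto
  qed
  moreover have "C_k_on 2 U {p n<..1}"
  proof (rule C2_regular, rule subsetI)
    fix t assume "t \<in> {p n<..1}"
    then show "t \<in> regular" using between_regular[of n] p_ends(2) ends_regular(2) by (cases "t = 1") auto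
  qed
  moreover have "\<forall>i\<in>{1..<n}. C_k_on 2 U {p i<..<p (i + 1)}"
    by (intro ballI C2_regular between_regular) simp
  moreover have "(U has_real_derivative 0) (at 0 within {0..1})" "(U has_real_derivative 0) (at 1 within {0..1})"
    using deriv_U[OF ends_regular(1)] deriv_U[OF ends_regular(2)] g_ends ends by simp_all
  moreover have "\<forall>i\<le>n. \<forall>t\<in>{p i<..<p (i + 1)}. 0 < \<sigma> * (- 1) ^ (i + 1) * (U t - u0)"
  proof (intro allI impI ballI)
    fix i t assume i: "i \<le> n" and t: "t \<in> {p i<..<p (i + 1)}"
    then have "p i < t" "t < p (i + 1)" by auto
    note b = between(1,2)[OF i this]
    show "0 < \<sigma> * (- 1) ^ (i + 1) * (U t - u0)" unfolding U_def by (rule sign_u_between[OF i b])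
  qed
  moreover have "\<forall>i\<in>{1..n}. U (p i) = u0 \<and> C_k_on 2 U {p (i - 1)<..<p (i + 1)} \<or>
      (if 0 < \<sigma> * (- 1) ^ (i + 1) then steep_up u0 U (p i) else steep_down u0 U (p i))"
    by (intro ballI node_alternative) auto
  moreover have "\<forall>i\<le>n. p i < p (i + 1)" using p_mono by blast
  ultimately show ?thesis
    unfolding nodal_profile_def by (intro conjI p_ends)
qed

end

text \<open>The part of \<open>nodal_profile\<close> that only needs the function up to null sets.\<close>

definition sign_profile :: "real \<Rightarrow> real \<Rightarrow> (real \<Rightarrow> real) \<Rightarrow> nat \<Rightarrow> (nat \<Rightarrow> real) \<Rightarrow> bool" where
  "sign_profile \<sigma> u0 u n p \<longleftrightarrow> p 0 = 0 \<and> p (n + 1) = 1 \<and> (\<forall>i\<le>n. p i < p (i + 1)) \<and>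
     (\<forall>i\<le>n. \<forall>x\<in>{p i<..<p (i + 1)}. 0 < \<sigma> * (- 1) ^ (i + 1) * (u x - u0))"

lemma sign_profile_of_nodal: "nodal_profile \<sigma> u0 u n p \<Longrightarrow> sign_profile \<sigma> u0 u n p"
  by (simp add: nodal_profile_def sign_profile_def)

lemma sign_profileD:
  assumes "sign_profile \<sigma> u0 u n p" "i \<le> n"
  shows "p i < p (i + 1)" "p i < x \<Longrightarrow> x < p (i + 1) \<Longrightarrow> 0 < \<sigma> * (- 1) ^ (i + 1) * (u x - u0)"
proof -
  have 1: "\<forall>i\<le>n. p i < p (i + 1)" "\<forall>i\<le>n. \<forall>x\<in>{p i<..<p (i + 1)}. 0 < \<sigma> * (- 1) ^ (i + 1) * (u x - u0)"
    using assms(1) unfolding sign_profile_def by blast+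
  then show "p i < p (i + 1)" using assms(2) by blast
  show "0 < \<sigma> * (- 1) ^ (i + 1) * (u x - u0)" if "p i < x" "x < p (i + 1)"
    using 1(2) assms(2) that by (meson greaterThanLessThan_iff)
qed

lemma sign_profile_range:
  assumes "sign_profile \<sigma> u0 u n p" "i \<le> n + 1" shows "0 \<le> p i" "p i \<le> 1" "i \<le> n \<Longrightarrow> p i < 1"
proof -
  have step: "p i < p (i + 1)" if "i \<le> n" for i by (rule sign_profileD(1)[OF assms(1) that])
  have "p i \<le> p j" if "i \<le> j" "j \<le> n + 1" for i j
    using that
  proof (induction j)
    case (Suc j)
    then show ?case using step[of j] by (cases "i = Suc j") auto
  qed auto
  from this[of 0 i] this[of i "n + 1"] this[of "i + 1" "n + 1"] step[of i] assms
  show "0 \<le> p i" "p i \<le> 1" "i \<le> n \<Longrightarrow> p i < 1" by (auto simp: sign_profile_def)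
qed

lemma sign_profile_not_AE:
  fixes Q :: "real \<Rightarrow> bool"
  assumes "AE x in lebesgue_on {0<..<1}. Q x" "0 \<le> c" "c < d" "d \<le> 1"
  obtains x where "x \<in> {c<..<d}" "Q x"
proof (rule ccontr)
  assume no: "\<not> thesis"
  have "AE x in lebesgue. x \<in> {0<..<1} \<longrightarrow> Q x"
    using assms(1) by (subst (asm) AE_restrict_space_iff) auto
  then have "AE x in lebesgue. x \<notin> {c<..<d}"
    by eventually_elim (use no that assms in force)
  then have "emeasure lebesgue {c<..<d} = 0"
    by (subst (asm) AE_iff_measurable[of "{c<..<d}"]) auto
  then show False using assms by simp
qed

text \<open>On overlapping intervals the signs agree, since the overlap contains a point where the
  functions coincide. If the first differing node were smaller for \<open>u\<close>, its next
  interval would overlap the current one of \<open>v\<close> with the opposite sign. The form with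
  two functions yields the exactness of the profiles as well as the distinctness of the
  solutions.\<close>

lemma sign_profile_unique:
  assumes u: "sign_profile \<sigma> u0 u n p" and v: "sign_profile \<sigma>' u0 v m q"
    and ae: "AE x in lebesgue_on {0<..<1}. u x = v x" and \<sigma>: "\<sigma> = 1 \<or> \<sigma> = - 1" "\<sigma>' = 1 \<or> \<sigma>' = - 1"
  shows "\<sigma> = \<sigma>'" "n = m" "\<And>i. i \<le> n + 1 \<Longrightarrow> p i = q i"
proof -
  have signs: "\<sigma> * (- 1) ^ (i + 1) * (\<sigma>' * (- 1) ^ (j + 1)) > 0"
    if i: "i \<le> n" and j: "j \<le> m" and lt: "max (p i) (q j) < min (p (i + 1)) (q (j + 1))" for i j
  proof -
    obtain x where x: "x \<in> {max (p i) (q j)<..<min (p (i + 1)) (q (j + 1))}" "u x = v x"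
      by (rule sign_profile_not_AE[OF ae _ lt])
         (use sign_profile_range[OF u, of i] sign_profile_range[OF u, of "i + 1"] i in auto)
    have "p i < x" "x < p (i + 1)" "q j < x" "x < q (j + 1)" using x(1) by auto
    then have "0 < \<sigma> * (- 1) ^ (i + 1) * (u x - u0)" "0 < \<sigma>' * (- 1) ^ (j + 1) * (u x - u0)"
      using sign_profileD(2)[OF u i, of x] sign_profileD(2)[OF v j, of x] x(2) by simp_all
    note 2 = this
    then have "(u x - u0)\<^sup>2 > 0" by (metis mult_zero_right less_irrefl zero_less_power2)
    moreover from mult_pos_pos[OF 2]
    have "0 < \<sigma> * (- 1) ^ (i + 1) * (\<sigma>' * (- 1) ^ (j + 1)) * (u x - u0)\<^sup>2"
      by (simp only: power2_eq_square ac_simps)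
    ultimately show ?thesis by (rule zero_less_mult_pos2[rotated])
  qed
  have "p 0 < p (0 + 1)" "q 0 < q (0 + 1)" by (rule sign_profileD(1)[OF u], simp, rule sign_profileD(1)[OF v], simp)
  moreover have "p 0 = 0" "q 0 = 0" using u v by (simp_all only: sign_profile_def)
  ultimately have "\<sigma> * \<sigma>' > 0" using signs[of 0 0] by simp
  then show eq: "\<sigma> = \<sigma>'" using \<sigma> by auto
  have step: "p (i + 1) = q (i + 1)" if i: "i \<le> n" "i \<le> m" "p i = q i" for i
  proof (rule ccontr)
    assume ne: "p (i + 1) \<noteq> q (i + 1)"
    have pq: "p i < p (i + 1)" "q i < q (i + 1)" using sign_profileD(1)[OF u i(1)] sign_profileD(1)[OF v i(2)] .
    have sq: "\<sigma> * \<sigma> = 1" using \<sigma> by auto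
    show False
    proof (cases "p (i + 1) < q (i + 1)")
      case True
      then have "p (i + 1) \<noteq> 1" using sign_profile_range(2)[OF v, of "i + 1"] i by auto
      then have n: "i + 1 \<le> n" using i u by (cases "i = n") (auto simp: sign_profile_def)
      then have "p (i + 1) < p (i + 1 + 1)" by (rule sign_profileD(1)[OF u])
      then have "\<sigma> * (- 1) ^ (i + 1 + 1) * (\<sigma>' * (- 1) ^ (i + 1)) > 0"
        using True pq i by (intro signs[OF n i(2)]) auto
      then show False using sq by (cases "even i") (auto simp: eq[symmetric])
    next
      case False
      then have lt: "q (i + 1) < p (i + 1)" using ne by simp
      then have "q (i + 1) \<noteq> 1" using sign_profile_range(2)[OF u, of "i + 1"] i by auto
      then have m: "i + 1 \<le> m" using i v by (cases "i = m") (auto simp: sign_profile_def)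
      then have "q (i + 1) < q (i + 1 + 1)" by (rule sign_profileD(1)[OF v])
      then have "\<sigma> * (- 1) ^ (i + 1) * (\<sigma>' * (- 1) ^ (i + 1 + 1)) > 0"
        using lt pq i by (intro signs[OF i(1) m]) auto
      then show False using sq by (cases "even i") (auto simp: eq[symmetric])
    qed
  qed
  have pq: "p i = q i" if "i \<le> n + 1" "i \<le> m + 1" for i
    using that
  proof (induction i)
    case 0
    then show ?case using u v by (simp add: sign_profile_def)
  next
    case (Suc i)
    then show ?case using step[of i] by simp
  qed
  show nm: "n = m"
  proof (rule ccontr)
    assume "n \<noteq> m"
    then consider "n < m" | "m < n" by linarith
    then show False
    proof cases
      case 1
      have "q (n + 1) = 1" using pq[of "n + 1"] 1 u by (simp add: sign_profile_def)
      then show False using sign_profile_range(3)[OF v, of "n + 1"] 1 by simp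
    next
      case 2
      have "p (m + 1) = 1" using pq[of "m + 1"] 2 v by (simp add: sign_profile_def)
      then show False using sign_profile_range(3)[OF u, of "m + 1"] 2 by simp
    qed
  qed
  show "p i = q i" if "i \<le> n + 1" for i using pq[of i] that nm by simp
qed

lemma sign_profile_not_constant:
  assumes u: "sign_profile \<sigma> u0 u n p" and n: "1 \<le> n"
  shows "\<not> (\<exists>c. AE x in lebesgue_on {0<..<1}. u x = c)"
proof
  assume "\<exists>c. AE x in lebesgue_on {0<..<1}. u x = c"
  then obtain c where ae: "AE x in lebesgue_on {0<..<1}. u x = c" by blast
  have lt: "p 0 < p (0 + 1)" "p 1 < p (1 + 1)" by (rule sign_profileD(1)[OF u], simp, rule sign_profileD(1)[OF u n])
  obtain x where x: "x \<in> {p 0<..<p (0 + 1)}" "u x = c"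
    by (rule sign_profile_not_AE[OF ae _ lt(1)])
       (use sign_profile_range[OF u, of 0] sign_profile_range[OF u, of "0 + 1"] in auto)
  obtain y where y: "y \<in> {p 1<..<p (1 + 1)}" "u y = c"
    by (rule sign_profile_not_AE[OF ae _ lt(2)])
       (use sign_profile_range[OF u, of 1] sign_profile_range[OF u, of "1 + 1"] n in auto)
  have s: "0 < \<sigma> * (- 1) ^ (i + 1) * (u x - u0)" if "i \<le> n" "x \<in> {p i<..<p (i + 1)}" for i x
    using sign_profileD(2)[OF u that(1)] that(2) by simp
  have "0 < \<sigma> * (- 1) ^ (0 + 1) * (c - u0)" "0 < \<sigma> * (- 1) ^ (1 + 1) * (c - u0)"
    using s[of 0 x] s[of 1 y] x y n by simp_all
  then show False by simp
qed

section \<open>Minimality\<close>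

lemma piecewise_continuous_measurable:
  fixes G :: "real \<Rightarrow> real"
  assumes X: "finite X" "0 \<in> X" "1 \<in> X" and G: "\<And>t. t \<in> {0<..<1} - X \<Longrightarrow> isCont G t"
  shows "(\<lambda>t. indicator {0..1} t * G t) \<in> borel_measurable borel"
proof (rule borel_measurable_continuous_countable_exceptions)
  show "countable X" using X(1) by (rule countable_finite)
  show "continuous_on (- X) (\<lambda>t. indicator {0..1} t * G t)"
  proof (rule continuous_at_imp_continuous_on, rule ballI)
    fix t assume t: "t \<in> - X"
    then have "t \<noteq> 0" "t \<noteq> 1" using X by auto
    then consider "t \<in> {0<..<1}" | "t \<in> - {0..1}" by fastforce
    then show "isCont (\<lambda>t. indicator {0..1} t * G t) t"
    proof cases
      case 1
      have "\<forall>\<^sub>F s in nhds t. s \<in> {0<..<1}" using 1 by (intro eventually_nhds_in_open) auto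
      then have "\<forall>\<^sub>F s in nhds t. indicator {0..1} s * G s = G s" by eventually_elim auto
      from isCont_cong[OF this] show ?thesis using G[of t] 1 t by simp
    next
      case 2
      have "\<forall>\<^sub>F s in nhds t. s \<in> - {0..1}" using 2 by (intro eventually_nhds_in_open) auto
      then have "\<forall>\<^sub>F s in nhds t. indicator {0..1} s * G s = 0" by eventually_elim auto
      from isCont_cong[OF this] show ?thesis by simp
    qed
  qed
qed

lemma unit_measurable_lebesgue:
  fixes G :: "real \<Rightarrow> real"
  assumes "(\<lambda>t. indicator {0..1} t * G t) \<in> borel_measurable borel"
  shows "set_borel_measurable lebesgue {0<..<1} G"
proof -
  have "(\<lambda>t. indicator {0<..<1} t * (indicator {0..1} t * G t)) \<in> borel_measurable borel"
    by (intro borel_measurable_times borel_measurable_indicator assms) auto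
  moreover have "indicator {0<..<1} t * (indicator {0..1} t * G t) = indicator {0<..<1} t *\<^sub>R G t" for t
    by (auto simp: indicator_def)
  ultimately have "(\<lambda>t. indicator {0<..<1} t *\<^sub>R G t) \<in> borel_measurable lborel" by simp
  then show ?thesis unfolding set_borel_measurable_def by (rule measurable_completion)
qed

lemma abs_le_1_of_squares: "(p::real)\<^sup>2 + q\<^sup>2 \<le> 1 \<Longrightarrow> \<bar>p\<bar> \<le> 1 \<and> \<bar>q\<bar> \<le> 1"
proof -
  assume h: "p\<^sup>2 + q\<^sup>2 \<le> 1"
  then have "p\<^sup>2 \<le> 1" "q\<^sup>2 \<le> 1" using zero_le_power2[of p] zero_le_power2[of q] by linarith+
  then show ?thesis by (simp add: abs_square_le_1)
qed

lemma zero_C1c: "(\<lambda>_. 0) \<in> C1c"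
  by (rule C1cI[of _ "\<lambda>_. 0"]) auto

context solution_curve
begin

lemma singular_cos: "\<not> \<bar>y\<bar> < pi/2 \<Longrightarrow> cos (clip y) = 0"
proof -
  assume "\<not> \<bar>y\<bar> < pi/2"
  then have "pi/2 \<le> 1 * y \<or> pi/2 \<le> - 1 * y" by linarith
  then show ?thesis using singular_sin_cos(2)[of 1 y] singular_sin_cos(2)[of "- 1" y] by auto
qed

text \<open>Off the vertical pieces \<open>g (x s) = s\<close>, and on them the cosine vanishes, so
  the arbitrary choice in \<open>g\<close> disappears from integrals in \<open>s\<close>.\<close>

lemma g_x_cos: "s \<in> {0..s0} \<Longrightarrow> F (g (x s)) * cos (clip (\<beta> s)) = F s * cos (clip (\<beta> s))"
  using g_x[of s] singular_cos[of "\<beta> s"] by (cases "\<bar>\<beta> s\<bar> < pi/2") auto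

lemma cont_clip: "continuous_on {0..s0} (\<lambda>s. clip (\<beta> s))"
  by (rule continuous_on_compose2[OF continuous_clip cont(3)]) auto

lemma cont_a_x: "continuous_on {0..s0} (\<lambda>s. a (x s))"
  by (rule continuous_on_compose2[OF a_cont cont(1)]) (use x_range in auto)

lemma cont_f_u: "continuous_on {0..s0} (\<lambda>s. f (u s))"
  by (rule continuous_on_compose2[OF f_cont cont(2)]) (use u_pos in \<open>auto simp: less_imp_le\<close>)

lemma U_bounded: obtains K where "K \<ge> 0" "\<And>t. t \<in> {0..1} \<Longrightarrow> \<bar>U t\<bar> \<le> K"
proof (rule continuous_on_Icc_abs_bound[OF cont(2)])
  fix K assume K: "K \<ge> 0" "\<And>s. s \<in> {0..s0} \<Longrightarrow> \<bar>u s\<bar> \<le> K"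
  have "\<bar>U t\<bar> \<le> K" if "t \<in> {0..1}" for t unfolding U_def by (rule K(2)[OF g(1)[OF that]])
  then show thesis using that K(1) by blast
qed

lemma nodes_finite: "finite (p ` {..n+1})" "0 \<in> p ` {..n+1}" "1 \<in> p ` {..n+1}"
  using p_ends by (auto intro: image_eqI[of _ _ 0] image_eqI[of _ _ "n + 1"])

lemma off_nodes: "t \<in> {0<..<1} - p ` {..n+1} \<Longrightarrow> t \<in> regular"
  using subsetD[OF nonregular_finite, of t] by auto

lemma deriv_U_at: "t \<in> {0<..<1} - p ` {..n+1} \<Longrightarrow> (U has_real_derivative tan (\<beta> (g t))) (at t)"
  using deriv_U[OF off_nodes, of t] at_within_interior[of t "{0..1}"] by simp

lemma isCont_afU: "t \<in> {0<..<1} - p ` {..n+1} \<Longrightarrow> isCont (\<lambda>t. a t * f (U t)) t"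
proof -
  assume t: "t \<in> {0<..<1} - p ` {..n+1}"
  have "isCont a t" by (rule continuous_on_interior[OF a_cont]) (use t in simp)
  moreover have "isCont f (U t)"
    by (rule continuous_on_interior[OF f_cont]) (use t U_pos[of t] in simp)
  moreover have "isCont U t" using deriv_U_at[OF t] by (rule DERIV_isCont)
  ultimately show ?thesis by (intro continuous_mult isCont_o2[of t U f]) auto
qed

text \<open>The substitution \<open>t = x s\<close> asks of \<open>x\<close> only that it be C1 and
  nondecreasing, so vertical pieces are allowed. The function \<open>k\<close> is an expression for
  the transformed integrand whose continuity can be seen although \<open>G\<close> may jump.\<close>

lemma change_of_variables:
  assumes m: "(\<lambda>t. indicator {0..1} t * G t) \<in> borel_measurable borel"
    and bd: "\<And>t. t \<in> {0..1} \<Longrightarrow> \<bar>G t\<bar> \<le> K"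
    and k: "continuous_on {0..s0} k" "\<And>s. s \<in> {0..s0} \<Longrightarrow> G (x s) * cos (clip (\<beta> s)) = k s"
  shows "(LINT t:{0<..<1}|lebesgue. G t) = integral {0..s0} k"
proof -
  let ?\<phi> = "\<lambda>t. indicator {0..1} t * G t"
  have "(LINT t:{0<..<1}|lebesgue. G t) = (LINT t|lebesgue. ?\<phi> t)"
    unfolding set_lebesgue_integral_def
  proof (rule integral_discrete_difference[where X="{0, 1}"])
    show "indicator {0<..<1} t *\<^sub>R G t = ?\<phi> t" if "t \<notin> {0, 1}" for t
      using that by (auto simp: indicator_def)
  qed auto
  also have "\<dots> = (LINT t|lborel. ?\<phi> t)" by (rule integral_completion) (use m in simp)
  also have "\<dots> = (LINT t|lborel. ?\<phi> t * indicator {x 0..x s0} t)"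
    by (rule Bochner_Integration.integral_cong) (auto simp: ends indicator_def)
  also have "\<dots> = (LINT s|lborel. ?\<phi> (x s) * cos (clip (\<beta> s)) * indicator {0..s0} s)"
  proof (rule integral_substitution(2))
    have "integrable lborel ?\<phi>"
    proof (rule integrableI_bounded_set[where A="{0..1}" and B="\<bar>K\<bar>"])
      show "AE t in lborel. t \<in> {0..1} \<longrightarrow> norm (?\<phi> t) \<le> \<bar>K\<bar>"
        by (rule AE_I2) (use bd in \<open>force simp: indicator_def\<close>)
    qed (use m in auto)
    moreover have "(\<lambda>t. indicator {x 0..x s0} t *\<^sub>R ?\<phi> t) = ?\<phi>" by (auto simp: ends indicator_def)
    ultimately show "set_integrable lborel {x 0..x s0} ?\<phi>" unfolding set_integrable_def by simp
  qed (use dx' cos_clip_nonneg s0_pos in \<open>auto intro!: continuous_intros cont_clip\<close>)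
  also have "\<dots> = (LINT s:{0..s0}|lborel. k s)"
    unfolding set_lebesgue_integral_def
    by (rule Bochner_Integration.integral_cong) (use k(2) x_range in \<open>auto simp: indicator_def\<close>)
  also have "\<dots> = integral {0..s0} k"
    by (intro set_borel_integral_eq_integral(2) borel_integrable_atLeastAtMost' k(1))
  finally show ?thesis .
qed

lemma integral_deriv_zero:
  assumes "\<And>s. s \<in> {0..s0} \<Longrightarrow> (\<Phi> has_real_derivative D s) (at s)" "\<Phi> 0 = 0" "\<Phi> s0 = 0"
  shows "(D has_integral 0) {0..s0}"
proof -
  have "(D has_integral (\<Phi> s0 - \<Phi> 0)) {0..s0}"
    by (rule fundamental_theorem_of_calculus)
       (use assms(1) s0_pos in \<open>auto simp: has_real_derivative_iff_has_vector_derivative[symmetric] intro: has_field_derivative_at_within\<close>)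
  then show ?thesis by (simp add: assms)
qed

text \<open>In arclength, integrating \<open>u * w1 (x s)\<close> by parts turns the integrand into
  the scalar product of \<open>(- w1, w2)\<close> with the unit vector \<open>(sin, cos)\<close> of
  the clamped angle. It is at most 1, so the integral is at most the length
  \<open>s0\<close>.\<close>

lemma test_bound:
  assumes w: "w1 \<in> C1c" "w2 \<in> C1c" "\<And>t. (w1 t)\<^sup>2 + (w2 t)\<^sup>2 \<le> 1"
  shows "(LINT t:{0<..<1}|lebesgue. U t * deriv w1 t + w2 t) \<le> s0"
proof -
  let ?c = "\<lambda>s. cos (clip (\<beta> s))" and ?s = "\<lambda>s. sin (clip (\<beta> s))"
  obtain K1 where K1: "\<And>t. \<bar>deriv w1 t\<bar> \<le> K1" using C1cD(5)[OF w(1)] by blast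
  obtain K0 where K0: "K0 \<ge> 0" "\<And>t. t \<in> {0..1} \<Longrightarrow> \<bar>U t\<bar> \<le> K0" by (rule U_bounded) blast
  have w2b: "\<bar>w2 t\<bar> \<le> 1" for t using abs_le_1_of_squares[OF w(3)[of t]] by simp
  have cw: "continuous_on {0..s0} (\<lambda>s. deriv w1 (x s))" "continuous_on {0..s0} (\<lambda>s. w1 (x s))" "continuous_on {0..s0} (\<lambda>s. w2 (x s))"
    by (rule continuous_on_compose2[OF _ cont(1)], rule C1cD(2,3)[OF w(1)] C1cD(3)[OF w(2)], simp)+
  define k where "k s = (u s * deriv w1 (x s) + w2 (x s)) * ?c s" for s
  have eq: "(LINT t:{0<..<1}|lebesgue. U t * deriv w1 t + w2 t) = integral {0..s0} k"
  proof (rule change_of_variables[where K="K0 * K1 + 1"])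
    show "(\<lambda>t. indicator {0..1} t * (U t * deriv w1 t + w2 t)) \<in> borel_measurable borel"
    proof (rule piecewise_continuous_measurable[OF nodes_finite])
      fix t assume t: "t \<in> {0<..<1} - p ` {..n+1}"
      have "isCont U t" using deriv_U_at[OF t] by (rule DERIV_isCont)
      moreover have "isCont (deriv w1) t" "isCont w2 t"
        using C1cD(2)[OF w(1)] C1cD(3)[OF w(2)] by (simp_all add: continuous_on_eq_continuous_at)
      ultimately show "isCont (\<lambda>t. U t * deriv w1 t + w2 t) t" by (intro continuous_intros)
    qed
    show "\<bar>U t * deriv w1 t + w2 t\<bar> \<le> K0 * K1 + 1" if "t \<in> {0..1}" for t
    proof -
      have "\<bar>U t * deriv w1 t + w2 t\<bar> \<le> \<bar>U t\<bar> * \<bar>deriv w1 t\<bar> + \<bar>w2 t\<bar>"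
        unfolding abs_mult[symmetric] by (rule abs_triangle_ineq)
      also have "\<dots> \<le> K0 * K1 + 1" using K0 K1 w2b that by (intro add_mono mult_mono) auto
      finally show ?thesis .
    qed
    show "continuous_on {0..s0} k" unfolding k_def by (intro continuous_intros cont cont_clip cw)
    show "(U (x s) * deriv w1 (x s) + w2 (x s)) * ?c s = k s" if s: "s \<in> {0..s0}" for s
      using g_x_cos[OF s, of "\<lambda>r. u r * deriv w1 (x s) + w2 (x s)"] unfolding k_def U_def .
  qed
  define D where "D s = ?s s * w1 (x s) + (deriv w1 (x s) * ?c s) * u s" for s
  have D: "(D has_integral 0) {0..s0}"
  proof (rule integral_deriv_zero[where \<Phi>="\<lambda>s. u s * w1 (x s)"])
    fix s assume s: "s \<in> {0..s0}"
    show "((\<lambda>s. u s * w1 (x s)) has_real_derivative D s) (at s)"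
      unfolding D_def by (rule DERIV_mult[OF du'[OF s] DERIV_chain2[OF C1cD(1)[OF w(1)] dx'[OF s]]])
  qed (simp_all add: ends C1cD(4)[OF w(1)])
  define k2 where "k2 s = - (?s s * w1 (x s)) + w2 (x s) * ?c s" for s
  have k2c: "continuous_on {0..s0} k2" unfolding k2_def by (intro continuous_intros cont_clip cw)
  then have k2i: "(k2 has_integral integral {0..s0} k2) {0..s0}"
    by (intro integrable_integral integrable_continuous_real)
  have "((\<lambda>s. D s + k2 s) has_integral 0 + integral {0..s0} k2) {0..s0}" by (rule has_integral_add[OF D k2i])
  moreover have "D s + k2 s = k s" for s by (simp add: D_def k2_def k_def algebra_simps)
  ultimately have "integral {0..s0} k = integral {0..s0} k2" by (simp add: has_integral_iff)
  also have "\<dots> \<le> integral {0..s0} (\<lambda>_. 1)"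
  proof (rule integral_le)
    show "k2 integrable_on {0..s0}" by (rule integrable_continuous_real[OF k2c])
    fix s
    have "0 \<le> (?s s + w1 (x s))\<^sup>2 + (?c s - w2 (x s))\<^sup>2" by simp
    moreover have "(?s s)\<^sup>2 + (?c s)\<^sup>2 = 1" by simp
    ultimately show "k2 s \<le> 1" using w(3)[of "x s"] unfolding k2_def power2_sum power2_diff by argo
  qed auto
  also have "\<dots> = s0" using s0_pos by simp
  finally show ?thesis using eq by simp
qed

lemma U_integrable: "set_integrable lebesgue {0<..<1} U"
proof -
  obtain K0 where K0: "K0 \<ge> 0" "\<And>t. t \<in> {0..1} \<Longrightarrow> \<bar>U t\<bar> \<le> K0" by (rule U_bounded) blast
  have "(\<lambda>t. indicator {0..1} t * U t) \<in> borel_measurable borel"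
    by (rule piecewise_continuous_measurable[OF nodes_finite]) (rule DERIV_isCont[OF deriv_U_at])
  then show ?thesis
    by (intro set_integrable_bounded_lebesgue[where K=K0] unit_measurable_lebesgue) (use K0 in auto)
qed

lemma U_BV: "U \<in> BV"
proof -
  have "bdd_above {(LINT t:{0<..<1}|lebesgue. U t * deriv w t) | w. w \<in> C1c \<and> (\<forall>t. \<bar>w t\<bar> \<le> 1)}"
  proof (rule bdd_aboveI[of _ s0], clarify)
    fix w assume w: "w \<in> C1c" "\<forall>t. \<bar>w t\<bar> \<le> 1"
    have "(w t)\<^sup>2 + 0\<^sup>2 \<le> 1" for t using w(2) by (simp add: abs_square_le_1)
    from test_bound[OF w(1) zero_C1c this]
    show "(LINT t:{0<..<1}|lebesgue. U t * deriv w t) \<le> s0" by simp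
  qed
  then show ?thesis using U_integrable by (simp add: BV_def)
qed

lemma area_U: "area U \<le> s0"
  unfolding area_def
proof (rule cSup_least)
  show "{(LINT t:{0<..<1}|lebesgue. U t * deriv w1 t + w2 t) | w1 w2.
      w1 \<in> C1c \<and> w2 \<in> C1c \<and> (\<forall>t. (w1 t)\<^sup>2 + (w2 t)\<^sup>2 \<le> 1)} \<noteq> {}"
    using zero_C1c by force
qed (use test_bound in blast)

text \<open>The flux \<open>U' / sqrt (1 + U'\<^sup>2)\<close> of the equation; clamping the
  argument to \<open>{0..1}\<close> extends it by its end values, which are 0.\<close>

definition w :: "real \<Rightarrow> real" where "w t = sin (clip (\<beta> (g (max 0 (min 1 t)))))"

lemma w_eq: "t \<in> {0..1} \<Longrightarrow> w t = sin (clip (\<beta> (g t)))" by (simp add: w_def)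

lemma w_outside: "t \<notin> {0<..<1} \<Longrightarrow> w t = 0"
proof -
  assume "t \<notin> {0<..<1}"
  then have "max 0 (min 1 t) = 0 \<or> max 0 (min 1 t) = 1" by auto
  then have "\<beta> (g (max 0 (min 1 t))) = 0" using g_ends ends by (elim disjE) simp_all
  moreover have "clip 0 = 0" by (rule clip_regular) simp
  ultimately show ?thesis unfolding w_def by simp
qed

lemma deriv_sin_\<beta>:
  assumes s: "s \<in> {0..s0}"
  shows "((\<lambda>s. sin (clip (\<beta> s))) has_real_derivative cos (clip (\<beta> s)) * - (a (x s) * f (u s))) (at s)"
  by (rule DERIV_chain2[OF deriv_sin_clip d\<beta>[OF s]])

text \<open>Both \<open>K * x + sin\<close> and \<open>K * x - sin\<close> are nondecreasing in
  \<open>s\<close>, because both terms of each derivative carry the factor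
  \<open>cos (clip (\<beta> s))\<close>. Increments of the flux are thus controlled by increments of
  \<open>x\<close>, also across vertical pieces.\<close>

lemma flux_lipschitz:
  obtains K where "0 < K" "\<And>s t. \<bar>w s - w t\<bar> \<le> K * \<bar>s - t\<bar>" "\<And>t. t \<in> {0..1} \<Longrightarrow> \<bar>a t * f (U t)\<bar> \<le> K"
proof -
  obtain K0 where K0: "K0 \<ge> 0" "\<And>s. s \<in> {0..s0} \<Longrightarrow> \<bar>a (x s) * f (u s)\<bar> \<le> K0"
    by (rule continuous_on_Icc_abs_bound[OF continuous_on_mult[OF cont_a_x cont_f_u]]) blast
  define K where "K = K0 + 1"
  have K: "0 < K" "\<And>s. s \<in> {0..s0} \<Longrightarrow> \<bar>a (x s) * f (u s)\<bar> \<le> K" using K0 by (force simp: K_def)+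
  have "\<bar>a t * f (U t)\<bar> \<le> K" if "t \<in> {0..1}" for t
    using K(2)[OF g(1)[OF that]] g(2)[OF that] by (simp add: U_def)
  moreover have mono: "\<bar>sin (clip (\<beta> s)) - sin (clip (\<beta> r))\<bar> \<le> K * (x s - x r)" if rs: "0 \<le> r" "r \<le> s" "s \<le> s0" for r s
  proof -
    have step: "K * x r + e * sin (clip (\<beta> r)) \<le> K * x s + e * sin (clip (\<beta> s))" if e: "e = 1 \<or> e = - 1" for e
    proof (rule DERIV_nonneg_imp_nondecreasing[OF rs(2)])
      fix q assume "r \<le> q" "q \<le> s"
      then have q: "q \<in> {0..s0}" using rs by auto
      let ?D = "K * cos (clip (\<beta> q)) + e * (cos (clip (\<beta> q)) * - (a (x q) * f (u q)))"
      have "((\<lambda>s. K * x s + e * sin (clip (\<beta> s))) has_real_derivative ?D) (at q)"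
        by (intro DERIV_add DERIV_cmult dx'[OF q] deriv_sin_\<beta>[OF q])
      moreover have "?D \<ge> 0"
      proof -
        have "e * (a (x q) * f (u q)) \<le> K" using K(2)[OF q] e by auto
        then have "0 \<le> cos (clip (\<beta> q)) * (K - e * (a (x q) * f (u q)))"
          by (intro mult_nonneg_nonneg cos_clip_nonneg) simp
        then show ?thesis by (simp add: algebra_simps)
      qed
      ultimately show "\<exists>y. ((\<lambda>s. K * x s + e * sin (clip (\<beta> s))) has_real_derivative y) (at q) \<and> 0 \<le> y" by blast
    qed
    from step[of 1] step[of "- 1"] show ?thesis unfolding abs_le_iff by (simp add: algebra_simps)
  qed
  have lip01: "\<bar>w s - w t\<bar> \<le> K * \<bar>s - t\<bar>" if st: "s \<in> {0..1}" "t \<in> {0..1}" for s t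
  proof -
    note gs = g[OF st(1)] and gt = g[OF st(2)]
    show ?thesis
    proof (cases "g s \<le> g t")
      case True
      then have "s \<le> t" using x_mono[of "g s" "g t"] gs gt by auto
      then show ?thesis using mono[of "g s" "g t"] True gs gt unfolding w_eq[OF st(1)] w_eq[OF st(2)]
        by (simp add: abs_minus_commute)
    next
      case False
      then have "t \<le> s" using x_mono[of "g t" "g s"] gs gt by auto
      then show ?thesis using mono[of "g t" "g s"] False gs gt unfolding w_eq[OF st(1)] w_eq[OF st(2)] by simp
    qed
  qed
  have "\<bar>w s - w t\<bar> \<le> K * \<bar>s - t\<bar>" for s t
  proof -
    let ?c = "\<lambda>t. max 0 (min 1 t) :: real"
    have "w s = w (?c s)" "w t = w (?c t)" by (simp_all add: w_def)
    then have "\<bar>w s - w t\<bar> \<le> K * \<bar>?c s - ?c t\<bar>" using lip01[of "?c s" "?c t"] by simp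
    also have "\<dots> \<le> K * \<bar>s - t\<bar>" using K(1) by (intro mult_left_mono) auto
    finally show ?thesis .
  qed
  ultimately show thesis using that[OF K(1)] by blast
qed

text \<open>At a zero of \<open>\<beta>\<close> the angle \<open>\<theta>\<close> is one of
  \<open>0, pi, ..., n pi\<close>, and \<open>\<theta>\<close> is strictly increasing.\<close>

lemma flux_zeros_finite: "finite {t \<in> {0..1}. \<beta> (g t) = 0}"
proof (rule finite_imageD)
  let ?Z = "{t \<in> {0..1}. \<beta> (g t) = 0}"
  show "inj_on (\<lambda>t. \<theta> (g t)) ?Z"
  proof (rule inj_onI)
    fix s t assume h: "s \<in> ?Z" "t \<in> ?Z" "\<theta> (g s) = \<theta> (g t)"
    then have st: "s \<in> {0..1}" "t \<in> {0..1}" by auto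
    have "g s = g t"
      using \<theta>_less_iff[OF g(1)[OF st(1)] g(1)[OF st(2)]] \<theta>_less_iff[OF g(1)[OF st(2)] g(1)[OF st(1)]] h(3) by simp
    then have "x (g s) = x (g t)" by (rule arg_cong)
    then show "s = t" unfolding g(2)[OF st(1)] g(2)[OF st(2)] .
  qed
  have "(\<lambda>t. \<theta> (g t)) ` ?Z \<subseteq> (\<lambda>j. real_of_int j * pi) ` {0..int n}"
  proof
    fix y assume "y \<in> (\<lambda>t. \<theta> (g t)) ` ?Z"
    then obtain t where t: "t \<in> {0..1}" "\<beta> (g t) = 0" "y = \<theta> (g t)" by auto
    note gt = g(1)[OF t(1)]
    have "sin (\<theta> (g t)) = 0" using polar_\<beta>[OF gt] t(2) P_sign[OF gt] by auto
    then obtain i :: int where i: "\<theta> (g t) = of_int i * pi" by (auto simp: sin_zero_iff_int2)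
    have "0 \<le> \<theta> (g t)" "\<theta> (g t) \<le> real n * pi"
      using \<theta>_mono[of 0 "g t"] \<theta>_mono[of "g t" s0] gt \<theta>_ends by (cases "g t = 0"; cases "g t = s0"; auto)+
    then have "0 * pi \<le> of_int i * pi" "of_int i * pi \<le> real n * pi" using i by simp_all
    then have "0 \<le> (of_int i :: real)" "(of_int i :: real) \<le> real n"
      using mult_le_cancel_right_pos[OF pi_gt_zero] by blast+
    then have "i \<in> {0..int n}" by simp
    then show "y \<in> (\<lambda>j. real_of_int j * pi) ` {0..int n}" using i t(3) by auto
  qed
  then show "finite ((\<lambda>t. \<theta> (g t)) ` ?Z)" by (rule finite_subset) simp
qed

lemma deriv_w:
  assumes t: "t \<in> {0<..<1} - p ` {..n+1}"
  shows "(w has_real_derivative - (a t * f (U t))) (at t)"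
proof -
  have t1: "t \<in> {0..1}" using t by auto
  have r: "t \<in> regular" by (rule off_nodes[OF t])
  have c: "cos (clip (\<beta> (g t))) > 0" using r by (intro cos_clip_pos) (simp add: regular_def)
  have "((\<lambda>t. sin (clip (\<beta> (g t)))) has_real_derivative
      (cos (clip (\<beta> (g t))) * - (a (x (g t)) * f (u (g t)))) * inverse (cos (clip (\<beta> (g t))))) (at t within {0..1})"
    by (rule DERIV_chain2[OF deriv_sin_\<beta>[OF g(1)[OF t1]] deriv_g[OF r]])
  moreover have "(cos (clip (\<beta> (g t))) * - (a (x (g t)) * f (u (g t)))) * inverse (cos (clip (\<beta> (g t)))) = - (a t * f (U t))"
    using c by (simp add: g(2)[OF t1] U_def)
  ultimately have "((\<lambda>t. sin (clip (\<beta> (g t)))) has_real_derivative - (a t * f (U t))) (at t within {0..1})" by (simp only:)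
  then have "((\<lambda>t. sin (clip (\<beta> (g t)))) has_real_derivative - (a t * f (U t))) (at t)"
    using t at_within_interior[of t "{0..1}"] by simp
  then show ?thesis
    by (rule has_field_derivative_transform_within_open[of _ _ _ "{0<..<1}"]) (use t w_eq in auto)
qed

lemma afU_measurable: "set_borel_measurable lebesgue {0<..<1} (\<lambda>t. a t * f (U t))"
  by (intro unit_measurable_lebesgue piecewise_continuous_measurable[OF nodes_finite] isCont_afU)

lemma w_le_1: "\<bar>w t\<bar> \<le> 1" by (simp add: w_def)

lemma lower_bound:
  assumes v: "v \<in> BV"
  shows "(LINT t:{0<..<1}|lebesgue. v t * (a t * f (U t)) + sqrt (1 - (w t)\<^sup>2)) \<le> area v"
proof -
  obtain K where K: "0 < K" "\<And>s t. \<bar>w s - w t\<bar> \<le> K * \<bar>s - t\<bar>"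
    by (rule flux_lipschitz) blast
  \<comment> \<open>The exceptional points are the zeros of the flux and the nodes, where it may
    fail to be differentiable.\<close>
  let ?N = "{t \<in> {0..1}. \<beta> (g t) = 0} \<union> p ` {..n+1}"
  have "(LINT t:{0<..<1}|lebesgue. - (v t * - (a t * f (U t))) + sqrt (1 - (w t)\<^sup>2)) \<le> area v"
  proof (rule area_lower_bound[OF K(2) w_le_1 w_outside K(1)])
    show "finite ?N" using flux_zeros_finite nodes_finite by simp
    show "w t \<noteq> 0" if t: "t \<in> {0<..<1} - ?N" for t
    proof -
      have t1: "t \<in> {0..1}" "\<beta> (g t) \<noteq> 0" using t by auto
      have r: "t \<in> regular" by (rule off_nodes) (use t in auto)
      then have b: "\<bar>\<beta> (g t)\<bar> < pi/2" by (simp add: regular_def)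
      then have "clip (\<beta> (g t)) = \<beta> (g t)" by (intro clip_regular) simp
      moreover have "\<bar>\<beta> (g t)\<bar> < pi" using b pi_gt_zero by linarith
      then have "sin (\<beta> (g t)) \<noteq> 0" using t1(2) sin_eq_0_pi[of "\<beta> (g t)"] by (auto simp: abs_less_iff)
      ultimately show ?thesis by (simp add: w_eq[OF t1(1)])
    qed
    show "(w has_real_derivative - (a t * f (U t))) (at t)" if "t \<in> {0<..<1} - ?N" for t
      by (rule deriv_w) (use that in auto)
    show "set_borel_measurable lebesgue {0<..<1} (\<lambda>t. - (a t * f (U t)))"
      using afU_measurable unfolding set_borel_measurable_def by (simp add: borel_measurable_uminus)
  qed (simp, rule v)
  then show ?thesis by simp
qed

lemma sqrt_w: "t \<in> {0..1} \<Longrightarrow> sqrt (1 - (w t)\<^sup>2) = cos (clip (\<beta> (g t)))"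
  using cos_clip_nonneg[of "\<beta> (g t)"] by (simp add: w_eq cos_squared_eq[symmetric])

text \<open>With \<open>v = U\<close> the lower bound equals the length: in arclength the integrand
  is \<open>1 - D\<close>, where \<open>D\<close> is the derivative of
  \<open>u * sin (clip \<beta>)\<close>, a function that vanishes at both ends.\<close>

lemma flux_identity: "(LINT t:{0<..<1}|lebesgue. U t * (a t * f (U t)) + sqrt (1 - (w t)\<^sup>2)) = s0"
proof -
  let ?c = "\<lambda>s. cos (clip (\<beta> s))" and ?s = "\<lambda>s. sin (clip (\<beta> s))"
  obtain K0 where K0: "K0 \<ge> 0" "\<And>t. t \<in> {0..1} \<Longrightarrow> \<bar>U t\<bar> \<le> K0" by (rule U_bounded) blast
  obtain K where K: "0 < K" "\<And>s t. \<bar>w s - w t\<bar> \<le> K * \<bar>s - t\<bar>" "\<And>t. t \<in> {0..1} \<Longrightarrow> \<bar>a t * f (U t)\<bar> \<le> K"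
    by (rule flux_lipschitz) blast
  define k where "k s = (u s * (a (x s) * f (u s)) + ?c s) * ?c s" for s
  have "continuous_on UNIV w"
    by (rule lipschitz_on_continuous_on[of K]) (use K in \<open>auto simp: lipschitz_on_def dist_real_def\<close>)
  then have cw: "isCont w t" for t by (simp add: continuous_on_eq_continuous_at)
  have eq: "(LINT t:{0<..<1}|lebesgue. U t * (a t * f (U t)) + sqrt (1 - (w t)\<^sup>2)) = integral {0..s0} k"
  proof (rule change_of_variables[where K="K0 * K + 1"])
    show "(\<lambda>t. indicator {0..1} t * (U t * (a t * f (U t)) + sqrt (1 - (w t)\<^sup>2))) \<in> borel_measurable borel"
    proof (rule piecewise_continuous_measurable[OF nodes_finite])
      fix t assume t: "t \<in> {0<..<1} - p ` {..n+1}"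
      have "isCont U t" using deriv_U_at[OF t] by (rule DERIV_isCont)
      moreover have "isCont (\<lambda>t. sqrt (1 - (w t)\<^sup>2)) t"
        by (intro isCont_o2[of t "\<lambda>t. 1 - (w t)\<^sup>2" sqrt] continuous_intros cw isCont_real_sqrt)
      ultimately show "isCont (\<lambda>t. U t * (a t * f (U t)) + sqrt (1 - (w t)\<^sup>2)) t"
        by (intro continuous_add continuous_mult isCont_afU[OF t])
    qed
    show "\<bar>U t * (a t * f (U t)) + sqrt (1 - (w t)\<^sup>2)\<bar> \<le> K0 * K + 1" if t: "t \<in> {0..1}" for t
    proof -
      have "\<bar>U t * (a t * f (U t)) + sqrt (1 - (w t)\<^sup>2)\<bar> \<le> \<bar>U t\<bar> * \<bar>a t * f (U t)\<bar> + \<bar>sqrt (1 - (w t)\<^sup>2)\<bar>"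
        unfolding abs_mult[of "U t", symmetric] by (rule abs_triangle_ineq)
      also have "\<dots> \<le> K0 * K + 1"
        unfolding sqrt_w[OF t] using K0 K(3)[OF t] K0(2)[OF t] by (intro add_mono mult_mono) auto
      finally show ?thesis .
    qed
    show "continuous_on {0..s0} k" unfolding k_def by (intro continuous_intros cont cont_clip cont_a_x cont_f_u)
    show "(U (x s) * (a (x s) * f (U (x s))) + sqrt (1 - (w (x s))\<^sup>2)) * ?c s = k s" if s: "s \<in> {0..s0}" for s
    proof -
      have "U (x s) * (a (x s) * f (U (x s))) + sqrt (1 - (w (x s))\<^sup>2) =
          (\<lambda>r. u r * (a (x r) * f (u r)) + ?c r) (g (x s))"
        using g(2)[OF x_range[OF s]] by (simp add: U_def sqrt_w[OF x_range[OF s]])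
      then show ?thesis using g_x_cos[OF s, of "\<lambda>r. u r * (a (x r) * f (u r)) + ?c r"] by (simp add: k_def)
    qed
  qed
  define D where "D s = ?s s * ?s s + (?c s * - (a (x s) * f (u s))) * u s" for s
  have D: "(D has_integral 0) {0..s0}"
  proof (rule integral_deriv_zero[where \<Phi>="\<lambda>s. u s * ?s s"])
    fix s assume s: "s \<in> {0..s0}"
    show "((\<lambda>s. u s * ?s s) has_real_derivative D s) (at s)"
      unfolding D_def by (rule DERIV_mult[OF du'[OF s] deriv_sin_\<beta>[OF s]])
  qed (simp_all add: ends clip_def)
  have "((\<lambda>s. 1 - D s) has_integral (s0 - 0) - 0) {0..s0}"
    using has_integral_diff[OF has_integral_const_real[of 1 0 s0] D] s0_pos by simp
  moreover have "1 - D s = k s" for s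
  proof -
    have "?s s * ?s s + ?c s * ?c s = 1" using sin_cos_squared_add[of "clip (\<beta> s)"] by (simp add: power2_eq_square)
    then show ?thesis unfolding D_def k_def by (simp add: algebra_simps)
  qed
  ultimately have "integral {0..s0} k = s0" by (simp add: has_integral_iff)
  then show ?thesis using eq by simp
qed

lemma BV_solution_U: "BV_solution a f U"
  unfolding BV_solution_def
proof (intro conjI ballI)
  show "U \<in> BV" by (rule U_BV)
  show "0 < U t" if "t \<in> {0<..<1}" for t using U_pos[of t] that by simp
  fix v assume v: "v \<in> BV"
  obtain K where K: "\<And>t. t \<in> {0..1} \<Longrightarrow> \<bar>a t * f (U t)\<bar> \<le> K" by (rule flux_lipschitz) blast
  have vi: "set_integrable lebesgue {0<..<1} v" using v by (simp add: BV_def)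
  have cw: "continuous_on UNIV (\<lambda>t. sqrt (1 - (w t)\<^sup>2))"
  proof -
    obtain K where K: "0 < K" "\<And>s t. \<bar>w s - w t\<bar> \<le> K * \<bar>s - t\<bar>" by (rule flux_lipschitz) blast
    have "continuous_on UNIV w"
      by (rule lipschitz_on_continuous_on[of K]) (use K in \<open>auto simp: lipschitz_on_def dist_real_def\<close>)
    then show ?thesis by (intro continuous_intros)
  qed
  have si: "set_integrable lebesgue {0<..<1} (\<lambda>t. sqrt (1 - (w t)\<^sup>2))"
    by (intro set_integrable_bounded_lebesgue[where K=1] set_measurable_continuous_lebesgue cw) (simp add: sqrt_w)
  have i: "set_integrable lebesgue {0<..<1} (\<lambda>t. z t * (a t * f (U t)) + sqrt (1 - (w t)\<^sup>2))"
    if "set_integrable lebesgue {0<..<1} z" for z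
    by (intro set_integral_add(1) set_integrable_mult_bounded[OF that afU_measurable, where K=K] si) (use K in auto)
  \<comment> \<open>Adding and subtracting the square root splits the integral into the one bounded
    by the area of \<open>v\<close> and the one equal to \<open>s0\<close>.\<close>
  have "(LINT t:{0<..<1}|lebesgue. a t * f (U t) * (v t - U t)) =
      (LINT t:{0<..<1}|lebesgue. (v t * (a t * f (U t)) + sqrt (1 - (w t)\<^sup>2)) - (U t * (a t * f (U t)) + sqrt (1 - (w t)\<^sup>2)))"
    by (intro arg_cong[where f="set_lebesgue_integral lebesgue {0<..<1}"] ext) (simp add: algebra_simps)
  also have "\<dots> = (LINT t:{0<..<1}|lebesgue. v t * (a t * f (U t)) + sqrt (1 - (w t)\<^sup>2))
      - (LINT t:{0<..<1}|lebesgue. U t * (a t * f (U t)) + sqrt (1 - (w t)\<^sup>2))"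
    by (rule set_integral_diff(2)[OF i[OF vi] i[OF U_integrable]])
  also have "\<dots> \<le> area v - s0" using lower_bound[OF v] flux_identity by simp
  finally show "area U + (LINT t:{0<..<1}|lebesgue. a t * f (U t) * (v t - U t)) \<le> area v"
    using area_U by simp
qed

end

section \<open>Continuity of the energy\<close>

text \<open>The kinetic energy is continued beyond \<open>\<plusminus> pi/2\<close> with slope
  \<open>\<plusminus> 1\<close>. This matches the unit speed of vertical motion and makes the total
  energy constant along vertical pieces.\<close>

lemma arclength_energy:
  obtains h where "\<And>y. (h has_real_derivative sin (clip y)) (at y)" "\<And>y. \<bar>y\<bar> \<le> pi/2 \<Longrightarrow> h y = 1 - cos y"
proof -
  have "continuous_on UNIV (\<lambda>y. sin (clip y))" by (intro continuous_intros continuous_clip)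
  then obtain h where h: "h 0 = 0" "\<And>y. (h has_real_derivative sin (clip y)) (at y)"
    using antiderivative_real[of "\<lambda>y. sin (clip y)" 0] by metis
  have "\<exists>c. \<forall>y\<in>{-(pi/2)..pi/2}. h y - (1 - cos y) = c"
  proof (rule has_field_derivative_zero_constant)
    fix y assume "y \<in> {-(pi/2)..pi/2}"
    then have "\<bar>y\<bar> \<le> pi/2" by auto
    then have "sin (clip y) = sin y" by (simp only: clip_regular)
    then show "((\<lambda>y. h y - (1 - cos y)) has_real_derivative 0) (at y within {-(pi/2)..pi/2})"
      using has_field_derivative_at_within[OF DERIV_diff[OF h(2)[of y] DERIV_diff[OF DERIV_const DERIV_cos]]] by simp
  qed simp
  then obtain c where c: "\<And>y. y \<in> {-(pi/2)..pi/2} \<Longrightarrow> h y - (1 - cos y) = c" by blast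
  have "c = 0" using c[of 0] h(1) by simp
  have "h y = 1 - cos y" if "\<bar>y\<bar> \<le> pi/2" for y
  proof -
    have "y \<in> {-(pi/2)..pi/2}" unfolding atLeastAtMost_iff using that by linarith
    from c[OF this] \<open>c = 0\<close> show ?thesis by simp
  qed
  then show thesis using that h(2) by blast
qed

context solution_curve
begin

lemma primitive_antiderivative:
  obtains Fp where "\<And>v. 0 \<le> v \<Longrightarrow> (Fp has_real_derivative f v) (at v)" "\<And>v. 0 \<le> v \<Longrightarrow> primitive f u0 v = Fp v"
proof -
  have "continuous_on UNIV (\<lambda>v. f (max 0 v))"
    by (rule continuous_on_compose2[OF f_cont]) (auto intro!: continuous_intros)
  then obtain Fp where F: "Fp u0 = 0" "\<And>v. (Fp has_real_derivative f (max 0 v)) (at v)"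
    using antiderivative_real[of "\<lambda>v. f (max 0 v)" u0] by metis
  have d: "(Fp has_real_derivative f v) (at v)" if "0 \<le> v" for v using F(2)[of v] that by (simp add: max_def)
  have "primitive f u0 v = Fp v" if v: "0 \<le> v" for v
  proof -
    have "(LBINT t=u0..v. f t) = Fp v - Fp u0"
    proof (rule LBINT_eq_diff)
      show "continuous_on {min u0 v..max u0 v} f"
        by (rule continuous_on_subset[OF f_cont]) (use v u0_pos in auto)
      fix t assume "t \<in> {min u0 v..max u0 v}"
      then have "0 \<le> t" using v u0_pos by auto
      then show "(Fp has_real_derivative f t) (at t within {min u0 v..max u0 v})"
        by (rule has_field_derivative_at_within[OF d])
    qed
    then show ?thesis using F(1) by (simp add: primitive_def)
  qed
  then show thesis using that d by blast
qed

text \<open>Since \<open>u\<close> moves at unit speed along the fiber, continuity of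
  \<open>U\<close> shrinks the fiber to a single time. An angle strictly beyond \<open>pi/2\<close>
  would keep the curve vertical a little longer.\<close>

lemma deriv_U_singular:
  assumes t: "t \<in> {0..1}" "t \<notin> regular" and c: "continuous (at t within {0..1}) U"
  shows "\<not> U differentiable (at t within {0..1})" "\<bar>\<beta> (g t)\<bar> = pi/2"
proof -
  obtain e where e: "e = 1 \<or> e = - 1" "\<And>s. first t \<le> s \<Longrightarrow> s \<le> last t \<Longrightarrow> pi/2 \<le> e * \<beta> s"
    by (rule singular_fiber[OF t]) blast
  have "t \<noteq> 0" "t \<noteq> 1" using ends_regular t by auto
  then have t01: "0 < t" "t < 1" using t(1) by auto
  note f = fiber[OF t(1)]
  have fgl: "first t \<le> g t" "g t \<le> last t" using first_g_last[OF t(1)] by auto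
  have w: "at t within {0..1} = at t" using t01 by (intro at_within_interior) simp
  have "isCont U t" using c by (simp only: w)
  then have lr: "(U \<longlongrightarrow> U t) (at_left t)" "(U \<longlongrightarrow> U t) (at_right t)"
    unfolding isCont_def filterlim_at_split by blast+
  have ul: "U t = u (first t)"
    using tendsto_unique[OF _ lr(1) U_left(1)[of t]] t01 by simp
  have ur: "U t = u (last t)"
    using tendsto_unique[OF _ lr(2) U_right(1)[of t]] t01 by simp
  have "u (last t) = u (first t) + e * (last t - first t)"
    by (rule singular_u[OF t(1) e order_refl order_trans[OF fgl] order_refl])
  then have fl: "first t = g t" "last t = g t" using ul ur e(1) fgl by auto
  show "\<not> U differentiable (at t within {0..1})"
  proof
    assume "U differentiable (at t within {0..1})"
    then obtain D where "(U has_real_derivative D) (at t)" unfolding w by (auto simp: real_differentiable_def)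
    then have "((\<lambda>y. (U y - U t) / (y - t)) \<longlongrightarrow> D) (at t)" by (simp add: has_field_derivative_iff)
    then have "((\<lambda>y. (U y - U t) / (y - t)) \<longlongrightarrow> D) (at_left t)" unfolding filterlim_at_split by blast
    then have "((\<lambda>y. e * ((U y - U t) / (y - t))) \<longlongrightarrow> e * D) (at_left t)" by (intro tendsto_mult tendsto_const)
    moreover have "filterlim (\<lambda>y. e * ((U y - U t) / (y - t))) at_infinity (at_left t)"
      using singular_quotients(1)[OF t01 e] unfolding ul by (rule filterlim_at_top_imp_at_infinity)
    ultimately show False using not_tendsto_and_filterlim_at_infinity trivial_limit_at_left_real by blast
  qed
  have gt: "g t \<in> {0..s0}" "x (g t) = t" by (rule g[OF t(1)])+
  have ge: "pi/2 \<le> e * \<beta> (g t)" by (rule e(2)[OF fgl])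
  show "\<bar>\<beta> (g t)\<bar> = pi/2"
  proof (rule ccontr)
    assume "\<bar>\<beta> (g t)\<bar> \<noteq> pi/2"
    moreover have "\<bar>e * \<beta> (g t)\<bar> = \<bar>\<beta> (g t)\<bar>" using e(1) by auto
    ultimately have gr: "pi/2 < e * \<beta> (g t)" using ge pi_gt_zero by linarith
    have g0: "g t < s0" using gt ends t01 by (cases "g t = s0") auto
    have "isCont \<beta> (g t)" using d\<beta>[OF gt(1)] by (rule DERIV_isCont)
    then have "isCont (\<lambda>s. e * \<beta> s) (g t)" by (intro continuous_intros)
    then have "((\<lambda>s. e * \<beta> s) \<longlongrightarrow> e * \<beta> (g t)) (at_right (g t))"
      unfolding isCont_def filterlim_at_split by blast
    from order_tendstoD(1)[OF this gr]
    obtain b where b: "g t < b" "\<And>s. g t < s \<Longrightarrow> s < b \<Longrightarrow> pi/2 < e * \<beta> s"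
      unfolding eventually_at_right_field by blast
    define r where "r = (g t + min b s0) / 2"
    have r: "g t < r" "r < b" "r < s0" using b(1) g0 by (auto simp: r_def field_simps min_def)
    have "x r = x (g t)"
    proof (rule DERIV_isconst_end[OF r(1)])
      show "continuous_on {g t..r} x" by (rule continuous_on_subset[OF cont(1)]) (use gt r in auto)
      fix s assume s: "g t < s" "s < r"
      then have "pi/2 \<le> e * \<beta> s" using b(2)[of s] r by simp
      from singular_sin_cos(2)[OF e(1) this] show "(x has_real_derivative 0) (at s)"
        using dx'[of s] s gt r by simp
    qed
    then show False using f(5)[of r] r gt fl by simp
  qed
qed

lemma energy_regular:
  assumes t: "t \<in> regular"
  shows "energy a f u0 U t = 1 - cos (\<beta> (g t)) + a t * primitive f u0 (U t)"
proof -
  have t1: "t \<in> {0..1}" "\<bar>\<beta> (g t)\<bar> < pi/2" using t by (auto simp: regular_def)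
  have d: "(U has_vector_derivative tan (\<beta> (g t))) (at t within {0..1})"
    using deriv_U[OF t] by (simp add: has_real_derivative_iff_has_vector_derivative)
  have diff: "U differentiable (at t within {0..1})"
    using deriv_U[OF t] by (auto simp: real_differentiable_def)
  have vd: "vector_derivative U (at t within {0..1}) = tan (\<beta> (g t))"
    by (rule vector_derivative_within_closed_interval[OF _ t1(1) d]) simp
  have c: "cos (\<beta> (g t)) > 0" using t1(2) by (intro cos_gt_zero_pi) linarith+
  have "sqrt (1 + (tan (\<beta> (g t)))\<^sup>2) = inverse (cos (\<beta> (g t)))"
    using tan_sec[of "\<beta> (g t)"] c by simp
  then show ?thesis using diff unfolding energy_def vd by (simp add: inverse_eq_divide)
qed

text \<open>In arclength the energy is a continuous function \<open>Es\<close>, constant on the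
  fibers of \<open>x\<close>. By compactness \<open>x\<close> is a quotient map from
  \<open>{0..s0}\<close> onto \<open>{0..1}\<close>, so \<open>Es\<close> descends to a continuous
  function of the abscissa.\<close>

lemma energy_U: "energy_extends_continuously a f u0 U"
  unfolding energy_extends_continuously_def
proof (intro conjI)
  have "{t \<in> {0..1}. \<not> continuous (at t within {0..1}) U} \<subseteq> {0..1} - regular"
    using deriv_U DERIV_continuous by blast
  from finite_subset[OF subset_trans[OF this nonregular_finite] nodes_finite(1)]
  show "finite {t \<in> {0..1}. \<not> continuous (at t within {0..1}) U}" .
  obtain h where h: "\<And>y. (h has_real_derivative sin (clip y)) (at y)" "\<And>y. \<bar>y\<bar> \<le> pi/2 \<Longrightarrow> h y = 1 - cos y"
    by (rule arclength_energy) blast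
  obtain Fp where Fp: "\<And>v. 0 \<le> v \<Longrightarrow> (Fp has_real_derivative f v) (at v)" "\<And>v. 0 \<le> v \<Longrightarrow> primitive f u0 v = Fp v"
    by (rule primitive_antiderivative) blast
  define Es where "Es s = h (\<beta> s) + a (x s) * Fp (u s)" for s
  have ch: "continuous_on {0..s0} (\<lambda>s. h (\<beta> s))"
    by (rule continuous_on_compose2[OF DERIV_continuous_on[OF has_field_derivative_at_within[OF h(1)]] cont(3)]) auto
  have cF: "continuous_on {0..s0} (\<lambda>s. Fp (u s))"
    by (rule continuous_on_compose2[OF DERIV_continuous_on[OF has_field_derivative_at_within[OF Fp(1)]] cont(2), of "{0..}"])
       (use u_pos in \<open>auto intro: less_imp_le\<close>)
  have cE: "continuous_on {0..s0} Es"
    unfolding Es_def by (intro continuous_intros ch cF cont_a_x)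
  have Eg: "Es s = Es (g (x s))" if s: "s \<in> {0..s0}" for s
  proof -
    define t where "t = x s"
    have t: "t \<in> {0..1}" using x_range[OF s] by (simp add: t_def)
    note f = fiber[OF t]
    have const: "Es r = Es (first t)" if r: "first t \<le> r" "r \<le> last t" for r
    proof (cases "r = first t")
      case False
      let ?E = "\<lambda>q. h (\<beta> q) + a t * Fp (u q)"
      have "?E r = ?E (first t)"
      proof (rule DERIV_isconst_end[of "first t" r ?E])
        show "first t < r" using False r by simp
        show "continuous_on {first t..r} ?E"
          by (intro continuous_intros continuous_on_subset[OF ch] continuous_on_subset[OF cF])
             (use f(1,3) r in auto)
        fix q assume q: "first t < q" "q < r"
        then have q0: "q \<in> {0..s0}" "x q = t" using f(6)[of q] r by auto
        have "0 \<le> u q" using u_pos[OF q0(1)] by simp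
        then have "(?E has_real_derivative sin (clip (\<beta> q)) * - (a (x q) * f (u q)) + a t * (f (u q) * sin (clip (\<beta> q)))) (at q)"
          by (intro DERIV_add DERIV_cmult DERIV_chain2[OF h(1) d\<beta>[OF q0(1)]] DERIV_chain2[OF Fp(1) du'[OF q0(1)]])
        then show "(?E has_real_derivative 0) (at q)" by (simp add: q0(2) mult_ac)
      qed
      then show ?thesis using f(6)[OF r] f(2) by (simp add: Es_def)
    qed simp
    have "Es s = Es (first t)" by (rule const) (use f(5)[OF s] in \<open>simp_all add: t_def\<close>)
    moreover have "Es (g t) = Es (first t)" by (rule const) (use first_g_last[OF t] in simp_all)
    ultimately show ?thesis by (simp add: t_def)
  qed
  \<comment> \<open>The preimage of a closed set is the image under \<open>x\<close> of a compact
    set, hence closed.\<close>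
  have "continuous_on {0..1} (\<lambda>t. Es (g t))"
    unfolding continuous_on_closed_vimage[OF closed_atLeastAtMost]
  proof (intro allI impI)
    fix B :: "real set" assume B: "closed B"
    have "(\<lambda>t. Es (g t)) -` B \<inter> {0..1} = x ` ({0..s0} \<inter> Es -` B)"
    proof (intro equalityI subsetI)
      fix t assume t: "t \<in> (\<lambda>t. Es (g t)) -` B \<inter> {0..1}"
      then show "t \<in> x ` ({0..s0} \<inter> Es -` B)" using g[of t] by (intro image_eqI[of t x "g t"]) auto
    next
      fix t assume "t \<in> x ` ({0..s0} \<inter> Es -` B)"
      then obtain s where s: "s \<in> {0..s0}" "Es s \<in> B" "t = x s" by auto
      then show "t \<in> (\<lambda>t. Es (g t)) -` B \<inter> {0..1}" using x_range[OF s(1)] Eg[OF s(1)] by simp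
    qed
    moreover have "closed ({0..s0} \<inter> Es -` B)" by (rule continuous_closed_preimage[OF cE _ B]) simp
    then have "compact ({0..s0} \<inter> Es -` B)" by (intro compact_eq_bounded_closed[THEN iffD2] conjI bounded_subset[OF bounded_closed_interval[of 0 s0]]) auto
    then have "compact (x ` ({0..s0} \<inter> Es -` B))"
      by (intro compact_continuous_image continuous_on_subset[OF cont(1)]) auto
    ultimately show "closed ((\<lambda>t. Es (g t)) -` B \<inter> {0..1})" by (simp add: compact_imp_closed)
  qed
  moreover have "Es (g t) = energy a f u0 U t" if t: "t \<in> {0..1}" and c: "continuous (at t within {0..1}) U" for t
  proof -
    note gt = g[OF t]
    have Upos: "0 \<le> U t" using U_pos[OF t] by simp
    have E: "Es (g t) = h (\<beta> (g t)) + a t * primitive f u0 (U t)"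
      unfolding Es_def gt(2) Fp(2)[OF Upos] by (simp add: U_def)
    show ?thesis
    proof (cases "t \<in> regular")
      case True
      then have "\<bar>\<beta> (g t)\<bar> \<le> pi/2" by (simp add: regular_def)
      then show ?thesis unfolding E energy_regular[OF True] by (simp only: h(2))
    next
      case False
      \<comment> \<open>Here \<open>energy\<close> takes its branch for points without a derivative,
        and the kinetic part is 1 because the angle is exactly
        \<open>\<plusminus> pi/2\<close>.\<close>
      note s = deriv_U_singular[OF t False c]
      have "\<beta> (g t) = pi/2 \<or> \<beta> (g t) = - (pi/2)" using s(2) by linarith
      then have "cos (\<beta> (g t)) = 0" by (elim disjE) (simp_all only: cos_minus cos_pi_half)
      then have "h (\<beta> (g t)) = 1" using h(2)[of "\<beta> (g t)"] s(2) by simp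
      then show ?thesis unfolding E energy_def using s(1) by simp
    qed
  qed
  ultimately show "\<exists>E. continuous_on {0..1} E \<and>
      (\<forall>t\<in>{0..1}. continuous (at t within {0..1}) U \<longrightarrow> E t = energy a f u0 U t)" by blast
qed

end

section \<open>The solutions\<close>

lemma exact_nodal_profile:
  assumes "nodal_profile \<sigma> u0 u n p" "\<sigma> = 1 \<or> \<sigma> = - 1"
  shows "has_exact_nodal_profile \<sigma> u0 u n"
  unfolding has_exact_nodal_profile_def
proof (intro exI[of _ p] conjI allI impI)
  show "nodal_profile \<sigma> u0 u n p" by (rule assms(1))
  have ae: "AE x in lebesgue_on {0<..<1}. u x = u x" by simp
  fix m q assume q: "nodal_profile \<sigma> u0 u m q"
  note un = sign_profile_unique[OF sign_profile_of_nodal[OF assms(1)] sign_profile_of_nodal[OF q] ae assms(2,2)]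
  show "m = n" using un(2) by simp
  show "q i = p i" if "i \<le> n + 1" for i using un(3)[OF that] by simp
qed

theorem theorem1p1:
  fixes a a' f f' :: "real \<Rightarrow> real" and u0 lam :: real and k :: nat
  assumes a_C1: "\<And>x. x \<in> {0..1} \<Longrightarrow> (a has_real_derivative a' x) (at x within {0..1})"
      "continuous_on {0..1} a'"
    and a_pos: "\<And>x. x \<in> {0..1} \<Longrightarrow> a x > 0"
    and u0_pos: "u0 > 0"
    and f_C1: "\<And>s. s \<in> {0..} \<Longrightarrow> (f has_real_derivative f' s) (at s within {0..})"
      "continuous_on {0..} f'"
    and f_zero: "f 0 = 0" "f u0 = 0"
    and f_neg: "\<And>s. s \<in> {0<..<u0} \<Longrightarrow> f s < 0"
    and f_pos: "\<And>s. s \<in> {u0<..} \<Longrightarrow> f s > 0"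
    and A_or_B:
      "(\<exists>ubar>u0. (LBINT s=u0..ubar. f s) = C_const a a' * (LBINT s=u0..0. f s)) \<or>
       (LBINT x=0..1. \<bar>a x\<bar>) * (SUP s\<in>{0..}. neg_part (f s)) < 1"
    and k_ge: "k \<ge> 1"
    and lam: "is_kth_neumann_eigenvalue a (k + 1) lam"
    and f'_gt: "f' u0 > lam"
  shows "\<exists>u :: nat \<Rightarrow> real \<Rightarrow> real.
     (\<forall>j\<in>{1..2*k}. BV_solution a f (u j) \<and> good_representative (u j) \<and>
        \<not> (\<exists>c. AE x in lebesgue_on {0<..<1}. u j x = c)) \<and>
     (\<forall>i\<in>{1..2*k}. \<forall>j\<in>{1..2*k}. i \<noteq> j \<longrightarrow>
        \<not> (AE x in lebesgue_on {0<..<1}. u i x = u j x)) \<and>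
     (\<forall>j\<in>{1..k}. has_exact_nodal_profile 1 u0 (u j) j) \<and>
     (\<forall>l\<in>{1..k}. has_exact_nodal_profile (-1) u0 (u (2*k + 1 - l)) l) \<and>
     (\<forall>j\<in>{1..2*k}. energy_extends_continuously a f u0 (u j))"
proof -
  define good where "good \<sigma> n U \<longleftrightarrow> BV_solution a f U \<and> good_representative U \<and>
    (\<exists>p. nodal_profile \<sigma> u0 U n p) \<and> energy_extends_continuously a f u0 U" for \<sigma> n U
  have ex: "\<exists>U. good \<sigma> n U" if n: "1 \<le> n" "n \<le> k" and \<sigma>: "\<sigma> = 1 \<or> \<sigma> = - 1" for \<sigma> n
  proof -
    obtain x u \<beta> \<theta> P s0 where "solution_curve a f x u \<beta> \<theta> P u0 s0 \<sigma> n"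
      using solution_curve_exists[OF a_C1 a_pos u0_pos f_C1 f_zero f_neg f_pos A_or_B lam f'_gt n \<sigma>] by blast
    then interpret solution_curve a f x u \<beta> \<theta> P u0 s0 \<sigma> n .
    show ?thesis
      unfolding good_def
      by (intro exI[of _ U] conjI exI[of _ p] BV_solution_U good_representative_U nodal_profile_U energy_U)
  qed
  \<comment> \<open>Indices up to \<open>k\<close> belong to the solutions that start below
    \<open>u0\<close>, and the upper half lists the others in reverse, so that index
    \<open>2 * k + 1 - l\<close> has \<open>l\<close> nodes. The pair of sign and number of nodes
    determines the index, which gives distinctness.\<close>
  define sg :: "nat \<Rightarrow> real" where "sg j = (if j \<le> k then 1 else - 1)" for j
  define nu where "nu j = (if j \<le> k then j else 2 * k + 1 - j)" for j
  define u where "u j = (SOME U. good (sg j) (nu j) U)" for j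
  have sg: "sg j = 1 \<or> sg j = - 1" for j by (simp add: sg_def)
  have nu: "1 \<le> nu j" "nu j \<le> k" if "j \<in> {1..2*k}" for j using that by (auto simp: nu_def)
  have good: "good (sg j) (nu j) (u j)" if "j \<in> {1..2*k}" for j
    unfolding u_def by (rule someI_ex[OF ex[OF nu[OF that] sg]])
  have BV: "BV_solution a f (u j)" and rep: "good_representative (u j)"
    and E: "energy_extends_continuously a f u0 (u j)" if "j \<in> {1..2*k}" for j
    using good[OF that] unfolding good_def by blast+
  have prof: "\<exists>p. nodal_profile (sg j) u0 (u j) (nu j) p" if "j \<in> {1..2*k}" for j
    using good[OF that] unfolding good_def by blast
  have exact: "has_exact_nodal_profile (sg j) u0 (u j) (nu j)" if j: "j \<in> {1..2*k}" for j
    using prof[OF j] exact_nodal_profile[OF _ sg] by blast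
  have nonconst: "\<not> (\<exists>c. AE x in lebesgue_on {0<..<1}. u j x = c)" if j: "j \<in> {1..2*k}" for j
    using prof[OF j] sign_profile_not_constant[OF sign_profile_of_nodal nu(1)[OF j]] by blast
  have distinct: "\<not> (AE x in lebesgue_on {0<..<1}. u i x = u j x)"
    if ij: "i \<in> {1..2*k}" "j \<in> {1..2*k}" "i \<noteq> j" for i j
  proof
    assume ae: "AE x in lebesgue_on {0<..<1}. u i x = u j x"
    obtain p q where "nodal_profile (sg i) u0 (u i) (nu i) p" "nodal_profile (sg j) u0 (u j) (nu j) q"
      using prof[OF ij(1)] prof[OF ij(2)] by blast
    from sign_profile_unique(1,2)[OF sign_profile_of_nodal[OF this(1)] sign_profile_of_nodal[OF this(2)] ae sg sg]
    have "sg i = sg j" "nu i = nu j" .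
    then show False using ij by (auto simp: sg_def nu_def split: if_splits)
  qed
  have low: "j \<in> {1..2*k}" "sg j = 1" "nu j = j" if "j \<in> {1..k}" for j
    using that by (auto simp: sg_def nu_def)
  have high: "2*k + 1 - l \<in> {1..2*k}" "sg (2*k + 1 - l) = - 1" "nu (2*k + 1 - l) = l" if "l \<in> {1..k}" for l
    using that by (auto simp: sg_def nu_def)
  show ?thesis
  proof (intro exI[of _ u] conjI ballI impI)
    show "has_exact_nodal_profile 1 u0 (u j) j" if "j \<in> {1..k}" for j
      using exact[OF low(1)[OF that]] unfolding low(2,3)[OF that] .
    show "has_exact_nodal_profile (- 1) u0 (u (2*k + 1 - l)) l" if "l \<in> {1..k}" for l
      using exact[OF high(1)[OF that]] unfolding high(2,3)[OF that] .
  qed (fact BV rep nonconst distinct E)+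
qed

end
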